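(* Let $d\ge 2$ and let $D\subset\mathbb{C}^d$ be a bounded strongly $\mathbb{C}$-convex domain. Let $f:bD\to(0,\infty)$ be a bounded probability density function with respect to $\sigma$ that is bounded away from $0$. Let $g:bD\to(0,\infty)$ belong to $\mathcal{C}^\alpha(bD)$ for some $\alpha\in(0,1]$, and put $\boldsymbol\delta_n(w)=g(w)\delta_n$ with $\delta_n=\left(\frac{\log n}{n}\right)^{1/d}$. Let $\eta_n$ be the Poisson process on $bD$ with intensity measure $nf\sigma$, and let $\beta_n$ be the binomial process on $bD$ with $n$ points and density $f$. If $\mathbb{P}(P(\eta_n;\boldsymbol\delta_n)\subset D)\to 1$ as $n\to\infty$, then $$\left(\frac{n}{\log n}\right)^{1/d}\delta_V\big(D,P(\eta_n;\boldsymbol\delta_n)\big)\longrightarrow\int_{bD}g(z)\,d\sigma(z)\quad\text{in probability as } n\to\infty .$$ Likewise, if $\mathbb{P}(P(\beta_n;\boldsymbol\delta_n)\subset D)\to 1$ as $n\to\infty$, then $$\left(\frac{n}{\log n}\right)^{1/d}\delta_V\big(D,P(\beta_n;\boldsymbol\delta_n)\big)\longrightarrow\int_{bD}g(z)\,d\sigma(z)\quad\text{in probability as } n\to\infty .$$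
   Context: Notation: $\langle z,w\rangle=z_1w_1+\cdots+z_dw_d$ for $z,w\in\mathbb{C}^d$ (bilinear); $\|\cdot\|$ is the Euclidean norm; $\lambda$ is Lebesgue measure on $\mathbb{C}^d\cong\mathbb{R}^{2d}$; $bD$ is the boundary of $D$; $\sigma$ is Euclidean surface area measure on $bD$; $\partial\rho=(\partial\rho/\partial z_1,\dots,\partial\rho/\partial z_d)$ with $\partial/\partial z_j=\frac12(\partial/\partial x_j-i\,\partial/\partial y_j)$. Strongly $\mathbb{C}$-convex domain ($d\ge2$): a domain $D=\{z\in\mathbb{C}^d:\rho(z)<0\}$, where $\rho:\mathbb{C}^d\to\mathbb{R}$ is a $\mathcal{C}^2$ function whose gradient is nonvanishing on $bD$ (a defining function), such that for each $w\in bD$ and each nonzero $v$ in the complex tangent space $\mathcal{H}_wbD=\{v\in\mathbb{C}^d:\langle\partial\rho(w),v\rangle=0\}$, $$\sum_{j,k=1}^d\frac{\partial^2\rho}{\partial z_j\partial\bar z_k}(w)v_j\bar v_k+\operatorname{Re}\sum_{j,k=1}^d\frac{\partial^2\rho}{\partial z_j\partial z_k}(w)v_jv_k>0 .$$ Induced polyhedron: for a finite set $\varphi\subset bD$ and a function $\boldsymbol\delta:bD\to(0,\infty)$, $P(\varphi;\boldsymbol\delta)$ is the union of those connected components of $$\bigcap_{w\in\varphi}\left\{z\in\mathbb{C}^d:\frac{|\langle\partial\rho(w),w-z\rangle|}{\|\partial\rho(w)\|}>\boldsymbol\delta(w)\right\}$$ that intersect $D$ (an empty intersection is $\mathbb{C}^d$).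 This does not depend on the choice of $\rho$. Error of approximation: $\delta_V(D,P)=\lambda(D\setminus P)\mathbf{1}(P\subset D)+\lambda(D)\mathbf{1}(P\not\subset D)$. Point processes: let $W^1,W^2,\dots$ be i.i.d. points on $bD$ with distribution $f\sigma$. Then $\beta_n=\{W^1,\dots,W^n\}$ and $\eta_n=\{W^1,\dots,W^{N_n}\}$, where $N_n$ is a Poisson random variable with mean $n$ independent of the $W^i$. $\mathcal{C}^\alpha(bD)$ is the space of $\alpha$-Hölder functions $g:bD\to\mathbb{R}$, i.e. with $\|g\|_\infty+\sup_{x\ne y}|g(x)-g(y)|/\|x-y\|^\alpha<\infty$. *)

theory Defs
  imports "HOL-Probability.Probability"
begin

section \<open>Wirtinger derivatives and strongly C-convex domains\<close>

text \<open>The bilinear (not sesquilinear) pairing on complex \<open>d\<close>-space.\<close>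

definition cpair :: "complex ^ 'd \<Rightarrow> complex ^ 'd \<Rightarrow> complex" where
  "cpair z w = (\<Sum>j\<in>UNIV. z $ j * w $ j)"

definition dir_deriv :: "('a::real_normed_vector \<Rightarrow> 'b::real_normed_vector) \<Rightarrow> 'a \<Rightarrow> 'a \<Rightarrow> 'b" where
  "dir_deriv F e z = vector_derivative (\<lambda>t. F (z + t *\<^sub>R e)) (at 0)"

text \<open>The real coordinates of \<open>z $ j\<close> are \<open>x\<^sub>j\<close>, \<open>y\<^sub>j\<close>, with coordinate vectors
  \<open>axis j 1\<close> and \<open>axis j \<i>\<close>.\<close>

definition wirtinger :: "'d::finite \<Rightarrow> (complex ^ 'd \<Rightarrow> complex) \<Rightarrow> complex ^ 'd \<Rightarrow> complex" where
  "wirtinger j F z = (dir_deriv F (axis j 1) z - \<i> * dir_deriv F (axis j \<i>) z) / 2"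

definition wirtinger_bar :: "'d::finite \<Rightarrow> (complex ^ 'd \<Rightarrow> complex) \<Rightarrow> complex ^ 'd \<Rightarrow> complex" where
  "wirtinger_bar j F z = (dir_deriv F (axis j 1) z + \<i> * dir_deriv F (axis j \<i>) z) / 2"

definition del_rho :: "(complex ^ 'd \<Rightarrow> real) \<Rightarrow> complex ^ 'd \<Rightarrow> complex ^ 'd" where
  "del_rho \<rho> z = (\<chi> j. wirtinger j (\<lambda>u. of_real (\<rho> u)) z)"

definition complex_tangent_space :: "(complex ^ 'd \<Rightarrow> real) \<Rightarrow> complex ^ 'd \<Rightarrow> (complex ^ 'd) set" where
  "complex_tangent_space \<rho> w = {v. cpair (del_rho \<rho> w) v = 0}"

definition C2_fun :: "('a::euclidean_space \<Rightarrow> real) \<Rightarrow> bool" where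
  "C2_fun \<rho> \<longleftrightarrow>
     (\<exists>(G :: 'a \<Rightarrow> 'a) (H :: 'a \<Rightarrow> 'a \<Rightarrow>\<^sub>L 'a).
        (\<forall>x. GDERIV \<rho> x :> G x) \<and>
        (\<forall>x. (G has_derivative blinfun_apply (H x)) (at x)) \<and>
        continuous_on UNIV H)"

text \<open>The first double sum below is real by Hermitian symmetry, so taking its real part only
  adjusts the type.\<close>

definition strongly_C_convex_domain :: "(complex ^ 'd \<Rightarrow> real) \<Rightarrow> (complex ^ 'd) set \<Rightarrow> bool" where
  "strongly_C_convex_domain \<rho> D \<longleftrightarrow>
     open D \<and> connected D \<and> D \<noteq> {} \<and>
     C2_fun \<rho> \<and> D = {z. \<rho> z < 0} \<and>
     (\<forall>w\<in>frontier D. \<not> (GDERIV \<rho> w :> 0)) \<and>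
     (\<forall>w\<in>frontier D. \<forall>v\<in>complex_tangent_space \<rho> w. v \<noteq> 0 \<longrightarrow>
        Re (\<Sum>j\<in>UNIV. \<Sum>k\<in>UNIV.
              wirtinger j (wirtinger_bar k (\<lambda>u. of_real (\<rho> u))) w * v $ j * cnj (v $ k))
      + Re (\<Sum>j\<in>UNIV. \<Sum>k\<in>UNIV.
              wirtinger j (wirtinger k (\<lambda>u. of_real (\<rho> u))) w * v $ j * v $ k) > 0)"


section \<open>Euclidean surface area measure\<close>

text \<open>A chart \<open>(b, V, h, G)\<close> exhibits \<open>S \<inter> V\<close> as the graph \<open>x \<bullet> b = h x\<close> of a continuously
  differentiable function of the coordinates orthogonal to the basis vector \<open>b\<close>; the function
  \<open>h\<close> is extended to the whole space so as to be constant along \<open>b\<close>, and \<open>G\<close> is its gradient.\<close>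

type_synonym 'a chart = "'a \<times> 'a set \<times> ('a \<Rightarrow> real) \<times> ('a \<Rightarrow> 'a)"

definition graph_chart :: "('a::euclidean_space) set \<Rightarrow> 'a chart \<Rightarrow> bool" where
  "graph_chart S = (\<lambda>(b, V, h, G).
     b \<in> Basis \<and> open V \<and>
     (\<forall>x t. h (x + t *\<^sub>R b) = h x) \<and>
     (\<forall>x\<in>V. GDERIV h x :> G x) \<and> continuous_on V G \<and>
     S \<inter> V = {x \<in> V. x \<bullet> b = h x})"

abbreviation chart_dom :: "'a chart \<Rightarrow> 'a set" where
  "chart_dom c \<equiv> fst (snd c)"

text \<open>The classical surface integral of \<open>sqrt (1 + |grad h|\<^sup>2)\<close> over the part of the graph lying in
  \<open>E\<close>. Lebesgue measure on the hyperplane orthogonal to \<open>b\<close> is realised by integrating over the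
  slab \<open>0 \<le> x \<bullet> b \<le> 1\<close> of unit width; \<open>x + (h x - x \<bullet> b) b\<close> is the point of the graph above or
  below \<open>x\<close>.\<close>

definition chart_area :: "'a::euclidean_space chart \<Rightarrow> 'a set \<Rightarrow> ennreal" where
  "chart_area = (\<lambda>(b, V, h, G) E.
     \<integral>\<^sup>+ x. (let p = x + (h x - x \<bullet> b) *\<^sub>R b in
        indicator {0..1} (x \<bullet> b) * indicator (E \<inter> V) p * ennreal (sqrt (1 + (norm (G p))\<^sup>2)))
     \<partial>lborel)"

definition graph_atlas :: "('a::euclidean_space) set \<Rightarrow> (nat \<Rightarrow> 'a chart) \<Rightarrow> bool" where
  "graph_atlas S c \<longleftrightarrow> (\<forall>i. graph_chart S (c i)) \<and> S \<subseteq> (\<Union>i. chart_dom (c i))"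

text \<open>Surface area measure of a \<open>C\<^sup>1\<close> hypersurface \<open>S\<close>, as a measure on the Borel subsets of \<open>S\<close>: a
  Borel set is cut into pieces along some countable atlas of graph charts and the areas of
  the pieces are added. By the change of variables formula the result does not depend on the
  atlas. Without an atlas (\<open>S\<close> not an embedded \<open>C\<^sup>1\<close> hypersurface) the value is unspecified.\<close>

definition surface_measure :: "('a::euclidean_space) set \<Rightarrow> 'a measure" where
  "surface_measure S =
     (let c = (SOME c. graph_atlas S c) in
      measure_of S (sets (restrict_space borel S))
        (\<lambda>E. \<Sum>i. chart_area (c i) (E \<inter> chart_dom (c i) - (\<Union>j<i. chart_dom (c j)))))"

lemma space_surface_measure [simp]: "space (surface_measure S) = S"
proof -
  have "sets (restrict_space borel S) \<subseteq> Pow S"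
    using sets.space_closed[of "restrict_space borel S"] by (simp add: space_restrict_space)
  then show ?thesis by (simp add: surface_measure_def Let_def space_measure_of)
qed

lemma sets_surface_measure [simp, measurable_cong]:
  "sets (surface_measure S) = sets (restrict_space borel S)"
proof -
  have "sigma_algebra S (sets (restrict_space borel S))"
    using sets.sigma_algebra_axioms[of "restrict_space borel S"] by (simp add: space_restrict_space)
  then show ?thesis
    by (simp add: surface_measure_def Let_def sigma_algebra.sets_measure_of_eq)
qed


section \<open>Induced polyhedra, approximation error, convergence in probability\<close>

definition induced_polyhedron ::
    "(complex ^ 'd \<Rightarrow> real) \<Rightarrow> (complex ^ 'd) set \<Rightarrow> (complex ^ 'd) set \<Rightarrow> (complex ^ 'd \<Rightarrow> real) \<Rightarrow>
     (complex ^ 'd) set" where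
  "induced_polyhedron \<rho> D \<phi> \<delta> =
     \<Union>{C \<in> components {z. \<forall>w\<in>\<phi>. cmod (cpair (del_rho \<rho> w) (w - z)) / norm (del_rho \<rho> w) > \<delta> w}.
         C \<inter> D \<noteq> {}}"

definition approx_error :: "('a::euclidean_space) set \<Rightarrow> 'a set \<Rightarrow> real" where
  "approx_error D P = (if P \<subseteq> D then measure lebesgue (D - P) else measure lebesgue D)"

definition holder_on :: "real \<Rightarrow> ('a::metric_space) set \<Rightarrow> ('a \<Rightarrow> real) \<Rightarrow> bool" where
  "holder_on \<alpha> S g \<longleftrightarrow>
     bounded (g ` S) \<and> (\<exists>L. \<forall>x\<in>S. \<forall>y\<in>S. \<bar>g x - g y\<bar> \<le> L * dist x y powr \<alpha>)"

text \<open>Measurability is required explicitly, since \<open>measure M\<close> is \<open>0\<close> on non-measurable sets; it is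
  asked only eventually, as the first few members of a sequence are immaterial.\<close>

definition tends_in_probability :: "'m measure \<Rightarrow> (nat \<Rightarrow> 'm \<Rightarrow> real) \<Rightarrow> real \<Rightarrow> bool" where
  "tends_in_probability M X c \<longleftrightarrow>
     (\<forall>\<^sub>F n in sequentially. X n \<in> borel_measurable M) \<and>
     (\<forall>\<epsilon>>0. (\<lambda>n. measure M {\<omega> \<in> space M. \<bar>X n \<omega> - c\<bar> > \<epsilon>}) \<longlonglongrightarrow> 0)"

definition first_points :: "(nat \<Rightarrow> 'm \<Rightarrow> 'a) \<Rightarrow> nat \<Rightarrow> 'm \<Rightarrow> 'a set" where
  "first_points W k \<omega> = (\<lambda>i. W i \<omega>) ` {..<k}"

text \<open>\<open>N\<close> supplies Poisson variables \<open>N n\<close> of mean \<open>n\<close>, each independent of the whole sequence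
  \<open>W\<close>; nothing is required of the joint law of different \<open>N n\<close>. Independence is that of the
  generated sigma-algebras, as \<open>indep_var\<close> is limited to variables of the same type. Positivity of \<open>n\<close> is needed
  because \<open>poisson_pmf\<close> is only specified for positive rates.\<close>

definition poisson_counts ::
    "'m measure \<Rightarrow> 'a measure \<Rightarrow> (nat \<Rightarrow> 'm \<Rightarrow> 'a) \<Rightarrow> (nat \<Rightarrow> 'm \<Rightarrow> nat) \<Rightarrow> bool" where
  "poisson_counts M \<sigma> W N \<longleftrightarrow> (\<forall>n>0.
     N n \<in> measurable M (count_space UNIV) \<and>
     distr M (count_space UNIV) (N n) = measure_pmf (poisson_pmf (real n)) \<and>
     prob_space.indep_set M
       (sets (vimage_algebra (space M) (N n) (count_space UNIV)))
       (sets (vimage_algebra (space M) (\<lambda>\<omega> i. W i \<omega>) (Pi\<^sub>M UNIV (\<lambda>_. \<sigma>)))))"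

end

theory Submission
  imports Defs
begin

text \<open>
  The volume of the part of \<open>D\<close> removed by the polyhedron is asymptotically a surface integral, for
  the following reasons.

  Inside \<open>D\<close> the polyhedron is the set of points satisfying all the inequalities, because a point of
  \<open>D\<close> lies in a component meeting \<open>D\<close> (\<open>domain_minus_polyhedron\<close>). On the event that the
  polyhedron is contained in \<open>D\<close> the error is therefore the volume of the points of \<open>D\<close> that are cut
  off by some sample point \<open>w\<close>, that is, whose distance from the complex tangent hyperplane at
  \<open>w\<close> is at most \<open>g w \<delta>\<^sub>n\<close>.

  Strong \<open>\<complex>\<close>-convexity says that \<open>\<rho>\<close> grows quadratically along complex tangent directions. Near the
  diagonal this gives \<open>- \<rho>(z) + c |z - w|\<^sup>2 \<le> 2 |\<langle>\<partial>\<rho>(w), w - z\<rangle>| (1 + O(|z - w|))\<close>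
  (\<open>tangent_pairing_estimate\<close>). Away from the diagonal the pairing has to be bounded below, which is a
  global statement: a complex tangent hyperplane meets the closure of \<open>D\<close> in one point
  (\<open>tangent_hyperplane_supporting\<close>). It follows from the connectedness of the sections of \<open>D\<close> by
  complex lines (\<open>section_connected\<close>), which is a continuity argument: as the line moves, components of
  the section can neither touch nor appear where they could be reached. Together these estimates show
  that a cut off point is within \<open>O(\<surd>\<delta>\<^sub>n)\<close> of the centre of the cap and that \<open>- \<rho>\<close> there is at most
  \<open>(1 + o(1)) |\<nabla>\<rho>| g \<delta>\<^sub>n\<close>. In the normal direction this is depth \<open>g \<delta>\<^sub>n\<close>, so the volume that can
  be cut off at all is asymptotically at most \<open>\<delta>\<^sub>n \<integral> g d\<sigma>\<close>.

  For the converse consider a point at depth \<open>t \<delta>\<^sub>n\<close> below a boundary point \<open>p\<close> with \<open>t < g(p)\<close>. It is cut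
  off by every sample point in a set of area at least a constant times \<open>\<delta>\<^sub>n\<^sup>d = ln n / n\<close>
  (\<open>cap_area_lower_bound\<close>): this set extends over \<open>\<surd>\<delta>\<^sub>n\<close> in \<open>2 d - 2\<close> tangential directions and over
  \<open>\<delta>\<^sub>n\<close> in the remaining one. Since about \<open>n\<close> points are thrown, the probability that all of them miss
  it tends to zero. Hence the expected volume has the same
  asymptotics as the deterministic upper bound, and Markov's inequality for the difference gives
  convergence in probability.

  Both volumes are computed by one principle (\<open>layer_limit\<close>): weights on space that converge, along
  coordinate lines through boundary points and after rescaling by \<open>\<delta>\<^sub>n\<close>, to the indicator of a layer have
  integrals asymptotic to \<open>\<delta>\<^sub>n\<close> times the surface integral of the thickness. In a graph chart this is
  dominated convergence for the vertical coordinate. Only pointwise limits are needed, and no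
  tubular coordinates. The same principle, applied to \<open>-\<delta> < \<rho> < 0\<close>, shows that overlapping charts
  agree on area, so that the surface measure can be computed in any chart.
\<close>

section \<open>Bounded domains with a regular defining function\<close>

lemma graph_chart_open: "graph_chart S c \<Longrightarrow> open (chart_dom c)"
  by (cases c) (simp add: graph_chart_def)

locale regular_domain =
  fixes \<rho> :: "'a::euclidean_space \<Rightarrow> real" and G :: "'a \<Rightarrow> 'a" and D :: "'a set"
  assumes rho_deriv: "\<And>x. (\<rho> has_derivative (\<lambda>v. G x \<bullet> v)) (at x)"
    and contG: "continuous_on UNIV G"
    and D_eq: "D = {x. \<rho> x < 0}"
    and bounded_D: "bounded D"
    and G_nonzero: "\<And>x. x \<in> frontier D \<Longrightarrow> G x \<noteq> 0"
begin

lemma cont_rho: "continuous_on A \<rho>"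
  by (intro continuous_at_imp_continuous_on ballI has_derivative_continuous[OF rho_deriv])

lemma open_D: "open D"
  unfolding D_eq by (intro open_Collect_less cont_rho continuous_intros)

lemma closure_le: "x \<in> closure D \<Longrightarrow> \<rho> x \<le> 0"
proof -
  have "closed {x. \<rho> x \<le> 0}" by (intro closed_Collect_le cont_rho continuous_intros)
  moreover have "D \<subseteq> {x. \<rho> x \<le> 0}" unfolding D_eq by auto
  ultimately have "closure D \<subseteq> {x. \<rho> x \<le> 0}" by (rule closure_minimal[rotated])
  then show "x \<in> closure D \<Longrightarrow> \<rho> x \<le> 0" by auto
qed

lemma frontier_closure: "frontier D = closure D - D"
  using open_D by (simp add: frontier_def interior_open)

lemma frontier_zero: "x \<in> frontier D \<Longrightarrow> \<rho> x = 0"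
  using closure_le[of x] D_eq unfolding frontier_closure by auto

lemma compact_frontier_D: "compact (frontier D)"
  using bounded_D by (rule compact_frontier_bounded)

lemma rho_mean_value:
  obtains t where "0 < t" "t < 1" "\<rho> (x + v) = \<rho> x + G (x + t *\<^sub>R v) \<bullet> v"
proof -
  have "((\<lambda>t. \<rho> (x + t *\<^sub>R v)) has_real_derivative G (x + t *\<^sub>R v) \<bullet> v) (at t)" for t
    unfolding has_field_derivative_def
    by (rule has_derivative_eq_rhs,
        rule has_derivative_compose[where f="\<lambda>t. x + t *\<^sub>R v", OF _ rho_deriv])
       (auto intro!: derivative_eq_intros simp: mult.commute)
  then obtain t where "0 < t" "t < 1"
      "\<rho> (x + 1 *\<^sub>R v) - \<rho> (x + 0 *\<^sub>R v) = (1 - 0) * (G (x + t *\<^sub>R v) \<bullet> v)"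
    using MVT2[of 0 1 "\<lambda>t. \<rho> (x + t *\<^sub>R v)" "\<lambda>t. G (x + t *\<^sub>R v) \<bullet> v"] by auto
  then show ?thesis using that[of t] by auto
qed

lemma rho_directional_limit: "((\<lambda>t. (\<rho> (x + t *\<^sub>R v) - \<rho> x) / t) \<longlongrightarrow> G x \<bullet> v) (at 0)"
proof -
  have "((\<lambda>t. \<rho> (x + t *\<^sub>R v)) has_real_derivative G (x + 0 *\<^sub>R v) \<bullet> v) (at 0)"
    unfolding has_field_derivative_def
    by (rule has_derivative_eq_rhs,
        rule has_derivative_compose[where f="\<lambda>t. x + t *\<^sub>R v", OF _ rho_deriv])
       (auto intro!: derivative_eq_intros simp: mult.commute)
  then show ?thesis by (simp add: DERIV_def)
qed

text \<open>Moving against the gradient from a zero of \<open>\<rho>\<close> enters the domain.\<close>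

lemma regular_zero_in_frontier:
  assumes "\<rho> x = 0" "G x \<noteq> 0"
  shows "x \<in> frontier D"
proof -
  have "((\<lambda>t. (\<rho> (x + t *\<^sub>R (- G x)) - \<rho> x) / t) \<longlongrightarrow> G x \<bullet> (- G x)) (at_right 0)"
    using rho_directional_limit by (rule tendsto_within_subset) auto
  moreover have "G x \<bullet> (- G x) < 0" using assms by simp
  ultimately have "\<forall>\<^sub>F t in at_right 0. (\<rho> (x + t *\<^sub>R (- G x)) - \<rho> x) / t < 0"
    by (rule order_tendstoD(2))
  moreover have "\<forall>\<^sub>F t in at_right (0::real). t > 0" by (simp add: eventually_at_right_less)
  ultimately have ev: "\<forall>\<^sub>F t in at_right 0. x + t *\<^sub>R (- G x) \<in> D"
    by eventually_elim (auto simp: assms D_eq divide_less_0_iff)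
  have "((\<lambda>t. x + t *\<^sub>R (- G x)) \<longlongrightarrow> x + 0 *\<^sub>R (- G x)) (at_right 0)"
    by (intro tendsto_intros)
  then have "x \<in> closure D"
    by (intro Lim_in_closed_set[of "closure D" "\<lambda>t. x + t *\<^sub>R (- G x)" "at_right (0::real)" x]
          closed_closure eventually_mono[OF ev]) (auto intro: closure_subset[THEN subsetD])
  moreover have "x \<notin> D" using assms by (auto simp: D_eq)
  ultimately show ?thesis by (simp add: frontier_closure)
qed

lemma frontier_nonempty:
  assumes "z \<in> D" shows "frontier D \<noteq> {}"
proof -
  have "D \<noteq> UNIV" using bounded_D not_bounded_UNIV by auto
  then show ?thesis using assms frontier_not_empty by blast
qed

text \<open>The defining function controls the distance to the boundary. Near a boundary point \<open>\<rho>\<close> grows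
  at a definite rate along the gradient direction, so a point \<open>z\<close> of the domain leaves it after
  a distance of order \<open>- \<rho> z\<close>; compactness makes the rate uniform.\<close>

lemma boundary_distance_le:
  obtains C where "C > 0" "\<And>z. z \<in> D \<Longrightarrow> \<exists>y\<in>frontier D. dist z y \<le> C * - \<rho> z"
proof -
  have "\<exists>C>0. \<forall>z\<in>D. \<exists>y\<in>frontier D. dist z y \<le> C * - \<rho> z"
  proof (rule ccontr)
    assume neg: "\<not> ?thesis"
    have "\<exists>z. z \<in> D \<and> (\<forall>y\<in>frontier D. dist z y > real (Suc k) * - \<rho> z)" for k
      using neg[simplified, rule_format, of "real (Suc k)"] by force
    then obtain z where zD: "\<And>k. z k \<in> D"
      and z: "\<And>k y. y \<in> frontier D \<Longrightarrow> dist (z k) y > real (Suc k) * - \<rho> (z k)"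
      by metis
    have "compact (closure D)" using bounded_D compact_closure by blast
    moreover have "\<forall>k. z k \<in> closure D" using zD closure_subset by blast
    ultimately obtain l r where l: "l \<in> closure D" "strict_mono r" "(z \<circ> r) \<longlonglongrightarrow> l"
      using compact_def by metis
    have rho_lim: "(\<lambda>k. \<rho> (z (r k))) \<longlonglongrightarrow> \<rho> l"
      using continuous_on_tendsto_compose[OF cont_rho[of UNIV] l(3)] by (simp add: o_def)
    obtain y0 where y0: "y0 \<in> frontier D" using frontier_nonempty[OF zD[of 0]] by auto
    obtain B where B: "\<And>x. x \<in> D \<Longrightarrow> dist x y0 \<le> B"
      using bounded_D bounded_any_center[of D y0] by (auto simp: dist_commute)
    have bnd: "- \<rho> (z (r k)) \<le> B * inverse (real (Suc (r k)))" for k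
      using z[OF y0, of "r k"] B[OF zD, of "r k"] by (simp add: field_simps)
    have inv: "(\<lambda>k. inverse (real (Suc (r k)))) \<longlonglongrightarrow> 0"
      using LIMSEQ_subseq_LIMSEQ[OF LIMSEQ_inverse_real_of_nat l(2)] by (simp add: o_def)
    have "- \<rho> l \<le> 0"
    proof (rule LIMSEQ_le)
      show "(\<lambda>k. - \<rho> (z (r k))) \<longlonglongrightarrow> - \<rho> l" using rho_lim by (rule tendsto_minus)
      show "(\<lambda>k. B * inverse (real (Suc (r k)))) \<longlonglongrightarrow> 0" using tendsto_mult_right_zero[OF inv] by simp
    qed (use bnd in auto)
    then have rl: "\<rho> l = 0" "l \<in> frontier D"
      using closure_le[OF l(1)] l(1) D_eq unfolding frontier_closure by auto
    define n where "n = G l"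
    have n: "n \<noteq> 0" using G_nonzero rl n_def by auto
    define c where "c = (norm n)\<^sup>2 / 2"
    have c: "c > 0" "c < G l \<bullet> n" using n by (auto simp: c_def n_def power2_norm_eq_inner)
    have "open {x. c < G x \<bullet> n}" by (intro open_Collect_less continuous_intros contG)
    then obtain R where R: "R > 0" "ball l R \<subseteq> {x. c < G x \<bullet> n}"
      using c unfolding open_contains_ball by auto
    have "(\<lambda>k. - \<rho> (z (r k)) / c * norm n) \<longlonglongrightarrow> - 0 / c * norm n"
      using rho_lim rl c by (intro tendsto_intros) auto
    then have e1: "\<forall>\<^sub>F k in sequentially. - \<rho> (z (r k)) / c * norm n < R / 2"
      using R by (intro order_tendstoD(2)) auto
    have e2: "\<forall>\<^sub>F k in sequentially. dist (z (r k)) l < R / 2"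
      using l(3) R(1) unfolding tendsto_iff o_def by (metis half_gt_zero)
    have e3: "\<forall>\<^sub>F k in sequentially. norm n / c \<le> real (Suc (r k))"
    proof -
      have "\<forall>\<^sub>F k in sequentially. k \<ge> nat \<lceil>norm n / c\<rceil>" by (rule eventually_ge_at_top)
      then show ?thesis
      proof eventually_elim
        case (elim k)
        have "k \<le> r k" using l(2) by (rule seq_suble)
        then show ?case using elim by linarith
      qed
    qed
    have "\<exists>k. - \<rho> (z (r k)) / c * norm n < R / 2 \<and> dist (z (r k)) l < R / 2 \<and> norm n / c \<le> real (Suc (r k))"
      using eventually_conj[OF e1 eventually_conj[OF e2 e3]] eventually_happens'[of sequentially] by simp
    then obtain k where k: "- \<rho> (z (r k)) / c * norm n < R / 2" "dist (z (r k)) l < R / 2"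
        "norm n / c \<le> real (Suc (r k))" by blast
    define x where "x = z (r k)"
    define T where "T = - \<rho> x / c"
    have xD: "x \<in> D" "\<rho> x < 0" using zD[of "r k"] by (auto simp: x_def D_eq)
    have T: "T > 0" "T * norm n < R / 2" using xD c(1) k(1) by (auto simp: T_def x_def divide_less_0_iff)
    obtain t where t: "0 < t" "t < 1" "\<rho> (x + T *\<^sub>R n) = \<rho> x + G (x + t *\<^sub>R (T *\<^sub>R n)) \<bullet> (T *\<^sub>R n)"
      using rho_mean_value .
    have "dist (x + t *\<^sub>R (T *\<^sub>R n)) l \<le> dist x l + norm (t *\<^sub>R (T *\<^sub>R n))"
      using dist_triangle[of "x + t *\<^sub>R (T *\<^sub>R n)" l x] by (simp add: dist_norm)
    also have "norm (t *\<^sub>R (T *\<^sub>R n)) \<le> T * norm n" using t T by (simp add: mult_left_le_one_le)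
    finally have "x + t *\<^sub>R (T *\<^sub>R n) \<in> ball l R" using T k(2) by (simp add: x_def dist_commute)
    then have "c * T \<le> (G (x + t *\<^sub>R (T *\<^sub>R n)) \<bullet> n) * T" using R T by (intro mult_right_mono) auto
    then have "\<rho> (x + T *\<^sub>R n) \<ge> \<rho> x + c * T" using t(3) by (simp add: mult.commute)
    then have nD: "x + T *\<^sub>R n \<notin> D" using c by (simp add: T_def D_eq)
    have "closed_segment x (x + T *\<^sub>R n) \<inter> frontier D \<noteq> {}"
      using xD nD by (intro connected_Int_frontier) auto
    then obtain y where y: "y \<in> frontier D" "y \<in> closed_segment x (x + T *\<^sub>R n)" by auto
    then have "dist x y \<le> T * norm n" using segment_bound(1)[OF y(2)] T by (simp add: dist_norm norm_minus_commute)
    also have "\<dots> = norm n / c * - \<rho> x" by (simp add: T_def)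
    also have "\<dots> \<le> real (Suc (r k)) * - \<rho> x" using k(3) xD by (intro mult_right_mono) auto
    finally show False using z[OF y(1), of "r k"] by (simp add: x_def)
  qed
  then show ?thesis using that by blast
qed

subsection \<open>Graph charts of the boundary\<close>

text \<open>The function \<open>\<rho>\<close> vanishes identically on the graph. Differentiating this relation expresses the gradient
  of the height function by that of \<open>\<rho>\<close>.\<close>

lemma chart_slope:
  assumes c: "graph_chart (frontier D) (b, V, h, Gh)" and p: "p \<in> frontier D" "p \<in> V"
  shows "G p \<bullet> b \<noteq> 0" "sqrt (1 + (norm (Gh p))\<^sup>2) = norm (G p) / \<bar>G p \<bullet> b\<bar>"
proof -
  have b: "b \<in> Basis" and V: "open V" and hb: "\<And>x t. h (x + t *\<^sub>R b) = h x"
    and hd: "\<And>x. x \<in> V \<Longrightarrow> (h has_derivative (\<lambda>v. v \<bullet> Gh x)) (at x)"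
    and S: "frontier D \<inter> V = {x \<in> V. x \<bullet> b = h x}"
    using c by (auto simp: graph_chart_def gderiv_def)
  have hp: "p \<bullet> b = h p" using p S by auto
  define P where "P x = x + (h x - x \<bullet> b) *\<^sub>R b" for x
  have Pp: "P p = p" by (simp add: P_def hp)
  have Pd: "(P has_derivative (\<lambda>v. v + (v \<bullet> Gh p - v \<bullet> b) *\<^sub>R b)) (at p)"
    unfolding P_def by (auto intro!: derivative_eq_intros hd p)
  have "\<forall>\<^sub>F x in at p. P x \<in> V"
    using has_derivative_continuous[OF Pd] V p(2) Pp
    by (auto simp: continuous_at intro: topological_tendstoD)
  then have zero: "\<forall>\<^sub>F x in at p. \<rho> (P x) = 0"
  proof eventually_elim
    case (elim x)
    have "P x \<bullet> b = h (P x)" using b by (simp add: P_def hb inner_add_left)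
    then have "P x \<in> frontier D" using S elim by auto
    then show ?case by (rule frontier_zero)
  qed
  have "((\<lambda>x. \<rho> (P x)) has_derivative (\<lambda>v. G (P p) \<bullet> (v + (v \<bullet> Gh p - v \<bullet> b) *\<^sub>R b))) (at p)"
    by (rule has_derivative_compose[OF Pd rho_deriv])
  moreover have "((\<lambda>x. \<rho> (P x)) has_derivative (\<lambda>v. 0)) (at p)"
  proof (rule has_derivative_transform_eventually[OF has_derivative_const[of 0]])
    show "\<forall>\<^sub>F x in at p. 0 = \<rho> (P x)" using zero by eventually_elim simp
  qed (use frontier_zero[OF p(1)] Pp in auto)
  ultimately have "(\<lambda>v. G (P p) \<bullet> (v + (v \<bullet> Gh p - v \<bullet> b) *\<^sub>R b)) = (\<lambda>v. 0)"
    by (rule has_derivative_unique)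
  then have "(G p + (G p \<bullet> b) *\<^sub>R (Gh p - b)) \<bullet> v = 0" for v
  proof -
    have "G p \<bullet> (v + (v \<bullet> Gh p - v \<bullet> b) *\<^sub>R b) = 0"
      using fun_cong[OF \<open>(\<lambda>v. G (P p) \<bullet> (v + (v \<bullet> Gh p - v \<bullet> b) *\<^sub>R b)) = (\<lambda>v. 0)\<close>, of v] by (simp add: Pp)
    then show ?thesis
      by (simp add: inner_add_left inner_add_right inner_diff_left inner_diff_right inner_commute[of _ v] mult.commute)
  qed
  then have eq: "G p + (G p \<bullet> b) *\<^sub>R (Gh p - b) = 0" by (metis inner_eq_zero_iff)
  show nz: "G p \<bullet> b \<noteq> 0" using eq G_nonzero[OF p(1)] by auto
  have "(G p \<bullet> b) *\<^sub>R Gh p = (G p \<bullet> b) *\<^sub>R b - G p" using eq by (simp add: algebra_simps)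
  then have "Gh p = b - (1 / (G p \<bullet> b)) *\<^sub>R G p"
  proof -
    have "(1 / (G p \<bullet> b)) *\<^sub>R ((G p \<bullet> b) *\<^sub>R Gh p) = (1 / (G p \<bullet> b)) *\<^sub>R ((G p \<bullet> b) *\<^sub>R b - G p)"
      using \<open>(G p \<bullet> b) *\<^sub>R Gh p = (G p \<bullet> b) *\<^sub>R b - G p\<close> by simp
    then show ?thesis using nz by (simp add: scaleR_diff_right)
  qed
  then have n1: "(norm (Gh p))\<^sup>2 = (b - (1 / (G p \<bullet> b)) *\<^sub>R G p) \<bullet> (b - (1 / (G p \<bullet> b)) *\<^sub>R G p)"
    by (metis power2_norm_eq_inner)
  define a where "a = G p \<bullet> b"
  have n2: "(b - (1 / a) *\<^sub>R G p) \<bullet> (b - (1 / a) *\<^sub>R G p)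
      = b \<bullet> b - 2 * ((1 / a) * a) + (1 / a)\<^sup>2 * (G p \<bullet> G p)"
    unfolding inner_diff_left inner_diff_right inner_commute[of b "G p"] inner_scaleR_left
      inner_scaleR_right a_def power2_eq_square by (simp only: algebra_simps) 
  have n3: "(1 / a) * a = 1" "b \<bullet> b = 1" using nz b by (auto simp: a_def)
  have n4: "(1 / a)\<^sup>2 * (G p \<bullet> G p) = (norm (G p) / \<bar>a\<bar>)\<^sup>2"
    unfolding power2_norm_eq_inner[symmetric] power_divide power2_abs by simp
  have e: "1 + (norm (Gh p))\<^sup>2 = (norm (G p) / \<bar>a\<bar>)\<^sup>2"
    unfolding n1 a_def[symmetric] n2 n3 n4 by simp
  show "sqrt (1 + (norm (Gh p))\<^sup>2) = norm (G p) / \<bar>G p \<bullet> b\<bar>"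
    unfolding e a_def[symmetric] by (rule real_sqrt_unique) auto
qed

text \<open>Replacing the \<open>b\<close>-coordinate by \<open>\<rho>\<close> is a local diffeomorphism at a boundary point where the
  \<open>b\<close>-derivative of \<open>\<rho>\<close> does not vanish; the boundary is then the graph of the \<open>b\<close>-coordinate
  of its inverse.\<close>

lemma chart_at_boundary_point:
  assumes p: "p \<in> frontier D"
  obtains c where "graph_chart (frontier D) c" "p \<in> chart_dom c"
proof -
  obtain b where b: "b \<in> Basis" "G p \<bullet> b \<noteq> 0"
    using G_nonzero[OF p] by (metis euclidean_all_zero_iff)
  define U where "U = {x. G x \<bullet> b \<noteq> 0}"
  have oU: "open U" unfolding U_def by (intro open_Collect_neq continuous_intros contG)
  define \<Phi> where "\<Phi> x = x + (\<rho> x - x \<bullet> b) *\<^sub>R b" for x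
  define \<Phi>' where "\<Phi>' x = id_blinfun + (blinfun_scaleR_left b o\<^sub>L blinfun_inner_right (G x - b))" for x
  have \<Phi>'_apply: "blinfun_apply (\<Phi>' x) v = v + ((G x - b) \<bullet> v) *\<^sub>R b" for x v
    by (simp add: \<Phi>'_def blinfun.add_left)
  have der: "(\<Phi> has_derivative blinfun_apply (\<Phi>' x)) (at x)" for x
    unfolding \<Phi>_def \<Phi>'_apply[abs_def]
    by (auto intro!: derivative_eq_intros rho_deriv simp: inner_diff_left inner_commute[of b])
  have cont: "continuous_on U \<Phi>'"
    unfolding \<Phi>'_def by (intro continuous_intros continuous_on_subset[OF contG]
      bounded_linear.continuous_on[OF bounded_linear_blinfun_inner_right]
      bounded_bilinear.continuous_on[OF bounded_bilinear_blinfun_compose]) auto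
  define inv' where "inv' = (id_blinfun :: 'a \<Rightarrow>\<^sub>L 'a) -
      (blinfun_scaleR_left ((1 / (G p \<bullet> b)) *\<^sub>R b) o\<^sub>L blinfun_inner_right (G p - b))"
  have inv: "inv' o\<^sub>L \<Phi>' p = id_blinfun"
  proof (rule blinfun_eqI)
    fix v
    have "(G p - b) \<bullet> b = G p \<bullet> b - 1" using b by (simp add: inner_diff_left)
    then have "(G p - b) \<bullet> (v + ((G p - b) \<bullet> v) *\<^sub>R b) = (G p \<bullet> b) * ((G p - b) \<bullet> v)"
      by (simp add: inner_add_right algebra_simps)
    then show "blinfun_apply (inv' o\<^sub>L \<Phi>' p) v = blinfun_apply id_blinfun v"
      using b by (simp add: inv'_def \<Phi>'_apply blinfun.diff_left)
  qed
  obtain U' V' \<Psi> \<Psi>' where IF: "open U'" "U' \<subseteq> U" "p \<in> U'" "open V'" "\<Phi> p \<in> V'"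
      "homeomorphism U' V' \<Phi> \<Psi>"
      "\<And>y. y \<in> V' \<Longrightarrow> (\<Psi> has_derivative (\<Psi>' y)) (at y)"
  proof (rule inverse_function_theorem[OF oU der cont _ inv])
    show "p \<in> U" using b by (simp add: U_def)
    fix U' V g g'
    assume *: "open U'" "U' \<subseteq> U" "p \<in> U'" "open V" "\<Phi> p \<in> V" "homeomorphism U' V \<Phi> g"
      "\<And>y. y \<in> V \<Longrightarrow> (g has_derivative (g' y)) (at y)"
    show thesis by (rule that[OF *])
  qed
  have \<Psi>\<Phi>: "\<And>x. x \<in> U' \<Longrightarrow> \<Psi> (\<Phi> x) = x" and \<Phi>\<Psi>: "\<And>y. y \<in> V' \<Longrightarrow> \<Phi> (\<Psi> y) = y"
    and \<Psi>U: "\<And>y. y \<in> V' \<Longrightarrow> \<Psi> y \<in> U'"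
    using IF(6) by (auto simp: homeomorphism_def)
  define \<pi> where "\<pi> x = x - (x \<bullet> b) *\<^sub>R b" for x :: 'a
  define h where "h x = \<Psi> (\<pi> x) \<bullet> b" for x
  define Gh where "Gh x = b - (1 / (G (\<Psi> (\<pi> x)) \<bullet> b)) *\<^sub>R G (\<Psi> (\<pi> x))" for x
  define V where "V = U' \<inter> {x. \<pi> x \<in> V'}"
  have cont_\<pi>: "continuous_on A \<pi>" for A unfolding \<pi>_def by (intro continuous_intros)
  have "open (\<pi> -` V')" using IF(4) cont_\<pi>[of UNIV] by (rule open_vimage)
  then have oV: "open V" unfolding V_def using IF(1) by (auto simp: vimage_def)
  have \<pi>b: "\<pi> (x + t *\<^sub>R b) = \<pi> x" for x t using b by (simp add: \<pi>_def inner_add_left algebra_simps)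
  \<comment> \<open>\<open>\<Phi>\<close> turns the level \<open>\<rho> = 0\<close> into the hyperplane orthogonal to \<open>b\<close>.\<close>
  have \<Phi>0: "\<Phi> x = \<pi> x" if "\<rho> x = 0" for x using that by (simp add: \<Phi>_def \<pi>_def)
  have lift: "\<rho> (\<Psi> (\<pi> x)) = 0" "\<Psi> (\<pi> x) = \<pi> x + h x *\<^sub>R b" if "\<pi> x \<in> V'" for x
  proof -
    have e: "\<Phi> (\<Psi> (\<pi> x)) = \<pi> x" using \<Phi>\<Psi> that by auto
    then have "\<Phi> (\<Psi> (\<pi> x)) \<bullet> b = \<pi> x \<bullet> b" by simp
    then show 0: "\<rho> (\<Psi> (\<pi> x)) = 0"
      using b by (simp add: \<Phi>_def \<pi>_def inner_add_left inner_diff_left)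
    show "\<Psi> (\<pi> x) = \<pi> x + h x *\<^sub>R b" using e 0 by (simp add: \<Phi>_def h_def algebra_simps)
  qed
  have S: "frontier D \<inter> V = {x \<in> V. x \<bullet> b = h x}"
  proof (intro equalityI subsetI)
    fix x assume x: "x \<in> frontier D \<inter> V"
    then have "\<Psi> (\<pi> x) = x" using \<Psi>\<Phi>[of x] \<Phi>0[of x] frontier_zero[of x] by (auto simp: V_def)
    then show "x \<in> {x \<in> V. x \<bullet> b = h x}" using x by (simp add: h_def)
  next
    fix x assume x: "x \<in> {x \<in> V. x \<bullet> b = h x}"
    then have "\<Psi> (\<pi> x) = x" using lift(2)[of x] by (auto simp: V_def \<pi>_def)
    then have "\<rho> x = 0" using lift(1)[of x] x by (auto simp: V_def)
    moreover have "G x \<noteq> 0" using x IF(2) by (auto simp: V_def U_def)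
    ultimately show "x \<in> frontier D \<inter> V" using regular_zero_in_frontier x by auto
  qed
  have hder: "(h has_derivative (\<lambda>v. v \<bullet> Gh x)) (at x)" if x: "x \<in> V" for x
  proof -
    define y where "y = \<Psi> (\<pi> x)"
    have xV: "\<pi> x \<in> V'" using x by (simp add: V_def)
    have yb: "G y \<bullet> b \<noteq> 0" using \<Psi>U[OF xV] IF(2) by (auto simp: y_def U_def)
    have \<pi>d: "(\<pi> has_derivative \<pi>) (at x)"
      unfolding \<pi>_def by (auto intro!: derivative_eq_intros)
    have \<Psi>d: "((\<lambda>x. \<Psi> (\<pi> x)) has_derivative (\<lambda>v. \<Psi>' (\<pi> x) (\<pi> v))) (at x)"
      by (rule has_derivative_compose[OF \<pi>d IF(7)[OF xV]])
    have hd: "(h has_derivative (\<lambda>v. \<Psi>' (\<pi> x) (\<pi> v) \<bullet> b)) (at x)"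
      unfolding h_def by (rule has_derivative_inner_left[OF \<Psi>d])
    have "((\<lambda>x. \<rho> (\<Psi> (\<pi> x))) has_derivative (\<lambda>v. G y \<bullet> \<Psi>' (\<pi> x) (\<pi> v))) (at x)"
      unfolding y_def by (rule has_derivative_compose[OF \<Psi>d rho_deriv])
    moreover have "((\<lambda>x. \<rho> (\<Psi> (\<pi> x))) has_derivative (\<lambda>v. 0)) (at x)"
    proof (rule has_derivative_transform_within_open[of "\<lambda>_. 0" _ x UNIV V])
      show "((\<lambda>_. 0) has_derivative (\<lambda>v. 0)) (at x)" by (rule has_derivative_const)
    qed (use oV x lift(1) in \<open>auto simp: V_def\<close>)
    ultimately have "(\<lambda>v. G y \<bullet> \<Psi>' (\<pi> x) (\<pi> v)) = (\<lambda>v. 0)" by (rule has_derivative_unique)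
    then have e1: "G y \<bullet> \<Psi>' (\<pi> x) (\<pi> v) = 0" for v by (rule fun_cong)
    have "((\<lambda>x. \<Psi> (\<pi> x)) has_derivative (\<lambda>v. \<pi> v + (\<Psi>' (\<pi> x) (\<pi> v) \<bullet> b) *\<^sub>R b)) (at x)"
    proof (rule has_derivative_transform_within_open[of "\<lambda>x. \<pi> x + h x *\<^sub>R b" _ x UNIV V])
      show "((\<lambda>x. \<pi> x + h x *\<^sub>R b) has_derivative (\<lambda>v. \<pi> v + (\<Psi>' (\<pi> x) (\<pi> v) \<bullet> b) *\<^sub>R b)) (at x)"
        by (auto intro!: derivative_eq_intros \<pi>d hd)
    qed (use oV x lift(2) in \<open>auto simp: V_def\<close>)
    then have e2: "\<Psi>' (\<pi> x) (\<pi> v) = \<pi> v + (\<Psi>' (\<pi> x) (\<pi> v) \<bullet> b) *\<^sub>R b" for v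
      by (rule fun_cong[OF has_derivative_unique[OF \<Psi>d]])
    have "\<Psi>' (\<pi> x) (\<pi> v) \<bullet> b = v \<bullet> Gh x" for v
    proof -
      define s where "s = \<Psi>' (\<pi> x) (\<pi> v) \<bullet> b"
      have 0: "G y \<bullet> (\<pi> v + s *\<^sub>R b) = 0"
        using trans[OF sym[OF arg_cong[OF e2[of v], of "\<lambda>u. G y \<bullet> u"]] e1[of v]]
        unfolding s_def .
      have "G y \<bullet> \<pi> v = G y \<bullet> v - (v \<bullet> b) * (G y \<bullet> b)"
        by (simp add: \<pi>_def inner_diff_right)
      with 0 have "s * (G y \<bullet> b) = (v \<bullet> b) * (G y \<bullet> b) - G y \<bullet> v"
        by (simp add: inner_add_right)
      then have "s = ((v \<bullet> b) * (G y \<bullet> b) - G y \<bullet> v) / (G y \<bullet> b)"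
        using yb by (metis nonzero_eq_divide_eq)
      also have "\<dots> = v \<bullet> b - (G y \<bullet> v) / (G y \<bullet> b)"
        unfolding diff_divide_distrib nonzero_mult_div_cancel_right[OF yb] ..
      also have "\<dots> = v \<bullet> Gh x"
        unfolding Gh_def y_def[symmetric] inner_diff_right inner_scaleR_right inner_commute[of v "G y"] by simp
      finally show ?thesis unfolding s_def .
    qed
    then have "(\<lambda>v. \<Psi>' (\<pi> x) (\<pi> v) \<bullet> b) = (\<lambda>v. v \<bullet> Gh x)" by (rule ext)
    then show ?thesis using hd by (simp only:)
  qed
  have "continuous_on V' \<Psi>" using IF(6) by (simp add: homeomorphism_def)
  then have c\<Psi>: "continuous_on V (\<lambda>x. \<Psi> (\<pi> x))"
    by (rule continuous_on_compose2[OF _ cont_\<pi>]) (auto simp: V_def)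
  have "continuous_on V Gh" unfolding Gh_def
    using IF(2) \<Psi>U by (intro continuous_intros continuous_on_compose2[OF contG c\<Psi>])
      (auto simp: V_def U_def)
  then have "graph_chart (frontier D) (b, V, h, Gh)"
    using b oV hder S \<pi>b by (auto simp: graph_chart_def gderiv_def h_def)
  moreover have "p \<in> V" using IF(3,5) \<Phi>0[OF frontier_zero[OF p]] by (simp add: V_def)
  ultimately show ?thesis using that by auto
qed

lemma graph_atlas_exists: "\<exists>c. graph_atlas (frontier D) c"
proof -
  let ?C = "{c. graph_chart (frontier D) c}"
  obtain b :: 'a where b: "b \<in> Basis" using nonempty_Basis by blast
  have triv: "graph_chart (frontier D) (b, {}, (\<lambda>_. 0), (\<lambda>_. 0))"
    using b unfolding graph_chart_def by simp
  have *: "\<forall>c\<in>?C. open (chart_dom c)" by (simp add: graph_chart_open)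
  have **: "frontier D \<subseteq> (\<Union>c\<in>?C. chart_dom c)"
  proof
    fix p assume "p \<in> frontier D"
    then obtain c where "graph_chart (frontier D) c" "p \<in> chart_dom c" by (rule chart_at_boundary_point)
    then show "p \<in> (\<Union>c\<in>?C. chart_dom c)" by blast
  qed
  obtain F where F: "F \<subseteq> ?C" "finite F" "frontier D \<subseteq> (\<Union>c\<in>F. chart_dom c)"
  proof (rule compactE_image[OF compact_frontier_D, of ?C chart_dom])
    show "open (chart_dom c)" if "c \<in> ?C" for c using that * by blast
  qed (use ** in auto)
  define F' where "F' = insert (b, {}, (\<lambda>_. 0), (\<lambda>_. 0)) F"
  have F': "F' \<noteq> {}" "countable F'" "F' \<subseteq> ?C" "frontier D \<subseteq> (\<Union>c\<in>F'. chart_dom c)"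
    using F triv by (auto simp: F'_def intro: countable_finite)
  have "range (from_nat_into F') = F'" using F' by (intro range_from_nat_into) auto
  moreover have "(\<Union>i. chart_dom (from_nat_into F' i)) = (\<Union>c\<in>range (from_nat_into F'). chart_dom c)"
    by blast
  ultimately have "graph_atlas (frontier D) (from_nat_into F')"
    unfolding graph_atlas_def using F'(3,4) from_nat_into[OF F'(1)] by (auto simp only:)
  then show ?thesis by blast
qed

end

section \<open>Surface integrals as limits of thin shells\<close>

lemma nn_integral_lborel_translate:
  fixes F :: "'a::euclidean_space \<Rightarrow> ennreal"
  assumes "F \<in> borel_measurable borel"
  shows "(\<integral>\<^sup>+ x. F (c + x) \<partial>lborel) = (\<integral>\<^sup>+ x. F x \<partial>lborel)"
proof -
  have "(\<integral>\<^sup>+ x. F x \<partial>lborel) = (\<integral>\<^sup>+ x. F x \<partial>distr lborel borel ((+) c))"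
    by (simp add: lborel_distr_plus)
  also have "\<dots> = (\<integral>\<^sup>+ x. F (c + x) \<partial>lborel)"
    using assms by (intro nn_integral_distr) auto
  finally show ?thesis ..
qed

text \<open>Tonelli along a coordinate direction: every line in direction \<open>b\<close> is entered once, at its points
  inside the unit slab. This is the coordinate system in which the area of a graph is defined.\<close>

lemma nn_integral_lborel_slab:
  fixes F :: "'a::euclidean_space \<Rightarrow> ennreal"
  assumes F[measurable]: "F \<in> borel_measurable borel" and b: "b \<in> Basis"
  shows "(\<integral>\<^sup>+ x. F x \<partial>lborel) =
    (\<integral>\<^sup>+ x. indicator {0..1} (x \<bullet> b) * (\<integral>\<^sup>+ t. F (x + t *\<^sub>R b) \<partial>lborel) \<partial>lborel)"
proof -
  have "(\<integral>\<^sup>+ x. indicator {0..1} (x \<bullet> b) * (\<integral>\<^sup>+ t. F (x + t *\<^sub>R b) \<partial>lborel) \<partial>lborel)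
      = (\<integral>\<^sup>+ x. (\<integral>\<^sup>+ t. indicator {0..1} (x \<bullet> b) * F (x + t *\<^sub>R b) \<partial>lborel) \<partial>lborel)"
    by (intro nn_integral_cong nn_integral_cmult[symmetric]) auto
  also have "\<dots> = (\<integral>\<^sup>+ t. (\<integral>\<^sup>+ x. indicator {0..1} (x \<bullet> b) * F (x + t *\<^sub>R b) \<partial>lborel) \<partial>lborel)"
    by (rule lborel_pair.Fubini'[symmetric]) measurable
  also have "\<dots> = (\<integral>\<^sup>+ t. (\<integral>\<^sup>+ y. indicator {0..1} (y \<bullet> b - t) * F y \<partial>lborel) \<partial>lborel)"
  proof (rule nn_integral_cong)
    fix t :: real
    have "(\<integral>\<^sup>+ x. indicator {0..1} (x \<bullet> b) * F (x + t *\<^sub>R b) \<partial>lborel)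
        = (\<integral>\<^sup>+ x. indicator {0..1} ((t *\<^sub>R b + x) \<bullet> b - t) * F (t *\<^sub>R b + x) \<partial>lborel)"
      using b by (intro nn_integral_cong) (simp add: inner_add_left add.commute)
    also have "\<dots> = (\<integral>\<^sup>+ y. indicator {0..1} (y \<bullet> b - t) * F y \<partial>lborel)"
      by (rule nn_integral_lborel_translate[where F="\<lambda>y. indicator {0..1} (y \<bullet> b - t) * F y"]) measurable
    finally show "(\<integral>\<^sup>+ x. indicator {0..1} (x \<bullet> b) * F (x + t *\<^sub>R b) \<partial>lborel)
        = (\<integral>\<^sup>+ y. indicator {0..1} (y \<bullet> b - t) * F y \<partial>lborel)" .
  qed
  also have "\<dots> = (\<integral>\<^sup>+ y. (\<integral>\<^sup>+ t. indicator {0..1} (y \<bullet> b - t) * F y \<partial>lborel) \<partial>lborel)"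
    by (rule lborel_pair.Fubini') measurable
  also have "\<dots> = (\<integral>\<^sup>+ y. F y \<partial>lborel)"
  proof (rule nn_integral_cong)
    fix y :: 'a
    have "(\<integral>\<^sup>+ t. indicator {0..1} (y \<bullet> b - t) * F y \<partial>lborel)
        = (\<integral>\<^sup>+ t. indicator {y \<bullet> b - 1..y \<bullet> b} t \<partial>lborel) * F y"
      by (subst nn_integral_multc[symmetric]) (auto intro!: nn_integral_cong simp: indicator_def)
    then show "(\<integral>\<^sup>+ t. indicator {0..1} (y \<bullet> b - t) * F y \<partial>lborel) = F y" by simp
  qed
  finally show ?thesis ..
qed

lemma nn_integral_reflect_scale:
  assumes [measurable]: "f \<in> borel_measurable borel" and "(0::real) < d"
  shows "(\<integral>\<^sup>+ t. f t \<partial>lborel) = ennreal d * (\<integral>\<^sup>+ s. f (c - s * d) \<partial>lborel)"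
  using nn_integral_real_affine[of f "- d" c] assms by (simp add: mult.commute)

definition chart_foot :: "'a::euclidean_space \<Rightarrow> ('a \<Rightarrow> real) \<Rightarrow> 'a \<Rightarrow> 'a" where
  "chart_foot b h x = x + (h x - x \<bullet> b) *\<^sub>R b"

definition chart_shadow :: "'a::euclidean_space \<Rightarrow> 'a set \<Rightarrow> ('a \<Rightarrow> real) \<Rightarrow> 'a set" where
  "chart_shadow b V h = {x. chart_foot b h x \<in> V}"

text \<open>Outside the shadow of the chart nothing is known about \<open>h\<close>, not even measurability. The height
  is therefore cut off there.\<close>

definition chart_height :: "'a::euclidean_space \<Rightarrow> 'a set \<Rightarrow> ('a \<Rightarrow> real) \<Rightarrow> 'a \<Rightarrow> real" where
  "chart_height b V h x = (if x \<in> chart_shadow b V h then h x - x \<bullet> b else 0)"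

text \<open>The area element over the unit slab, and its image on the surface. The latter is \<open>chart_area\<close> as a
  measure.\<close>

definition chart_density :: "'a::euclidean_space chart \<Rightarrow> 'a \<Rightarrow> ennreal" where
  "chart_density = (\<lambda>(b, V, h, Gh) x. indicator {0..1} (x \<bullet> b) *
     (if x \<in> chart_shadow b V h then ennreal (sqrt (1 + (norm (Gh (chart_foot b h x)))\<^sup>2)) else 0))"

definition chart_measure :: "'a::euclidean_space chart \<Rightarrow> 'a measure" where
  "chart_measure c = (case c of (b, V, h, Gh) \<Rightarrow>
     distr (density lborel (chart_density c)) borel (\<lambda>x. x + chart_height b V h x *\<^sub>R b))"

lemma sets_chart_measure [simp, measurable_cong]: "sets (chart_measure c) = sets borel"
  by (simp add: chart_measure_def split: prod.split)

lemma space_chart_measure [simp]: "space (chart_measure c) = UNIV"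
  by (simp add: chart_measure_def split: prod.split)

locale graph_chart_of =
  fixes S :: "'a::euclidean_space set" and b V h Gh
  assumes chart: "graph_chart S (b, V, h, Gh)"
begin

lemma b_Basis: "b \<in> Basis" and open_V: "open V" and h_line: "h (x + t *\<^sub>R b) = h x"
  and h_deriv: "x \<in> V \<Longrightarrow> (h has_derivative (\<lambda>v. v \<bullet> Gh x)) (at x)"
  and cont_Gh: "continuous_on V Gh"
  and graph_eq: "S \<inter> V = {x \<in> V. x \<bullet> b = h x}"
  using chart by (auto simp: graph_chart_def gderiv_def)

lemma shadow_line: "x + t *\<^sub>R b \<in> chart_shadow b V h \<longleftrightarrow> x \<in> chart_shadow b V h"
  using b_Basis by (simp add: chart_shadow_def chart_foot_def h_line inner_add_left algebra_simps)

lemma foot_in_S: "x \<in> chart_shadow b V h \<Longrightarrow> chart_foot b h x \<in> S \<inter> V"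
  using b_Basis unfolding graph_eq chart_shadow_def chart_foot_def
  by (simp add: h_line inner_add_left)

lemma isCont_h: assumes "x \<in> chart_shadow b V h" shows "isCont h x"
proof -
  define t where "t = h x - x \<bullet> b"
  have "isCont h (x + t *\<^sub>R b)" using assms h_deriv has_derivative_continuous
    unfolding chart_shadow_def chart_foot_def t_def by blast
  then have "isCont (\<lambda>y. h (y + t *\<^sub>R b)) x"
    by (intro isCont_o2[where g=h and f="\<lambda>y. y + t *\<^sub>R b"]) auto
  then show ?thesis by (simp add: h_line)
qed

lemma isCont_foot: "x \<in> chart_shadow b V h \<Longrightarrow> isCont (chart_foot b h) x"
  unfolding chart_foot_def by (intro continuous_intros isCont_h)

lemma open_shadow: "open (chart_shadow b V h)"
proof (subst open_subopen, intro ballI)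
  fix x assume x: "x \<in> chart_shadow b V h"
  have "\<forall>\<^sub>F y in nhds x. chart_foot b h y \<in> V"
    using isCont_foot[OF x] open_V x unfolding chart_shadow_def
    by (auto simp: continuous_at_imp_continuous_within isCont_def tendsto_at_iff_tendsto_nhds
        intro: topological_tendstoD)
  then show "\<exists>T. open T \<and> x \<in> T \<and> T \<subseteq> chart_shadow b V h"
    unfolding eventually_nhds chart_shadow_def by blast
qed

lemma shadow_measurable [measurable]: "chart_shadow b V h \<in> sets borel"
  using open_shadow by (rule borel_open)

lemma height_measurable [measurable]: "chart_height b V h \<in> borel_measurable borel"
proof -
  have "continuous_on (chart_shadow b V h) (\<lambda>x. h x - x \<bullet> b)"
    by (intro continuous_intros continuous_at_imp_continuous_on ballI isCont_h)
  then have "(\<lambda>x. if x \<in> chart_shadow b V h then h x - x \<bullet> b else 0) \<in> borel_measurable borel"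
    by (intro borel_measurable_continuous_on_if) auto
  then show ?thesis unfolding chart_height_def[abs_def] .
qed

lemma height_foot: "x \<in> chart_shadow b V h \<Longrightarrow> x + chart_height b V h x *\<^sub>R b = chart_foot b h x"
  by (simp add: chart_height_def chart_foot_def)

lemma density_measurable [measurable]: "chart_density (b, V, h, Gh) \<in> borel_measurable borel"
proof -
  have "continuous_on (chart_shadow b V h) (\<lambda>x. Gh (chart_foot b h x))"
    by (rule continuous_on_compose2[OF cont_Gh])
       (auto intro!: continuous_at_imp_continuous_on isCont_foot simp: chart_shadow_def)
  then have "continuous_on (chart_shadow b V h) (\<lambda>x. sqrt (1 + (norm (Gh (chart_foot b h x)))\<^sup>2))"
    by (intro continuous_intros)
  then have "(\<lambda>x. if x \<in> chart_shadow b V h then sqrt (1 + (norm (Gh (chart_foot b h x)))\<^sup>2) else 0)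
      \<in> borel_measurable borel"
    by (intro borel_measurable_continuous_on_if) auto
  then have [measurable]: "(\<lambda>x. ennreal (if x \<in> chart_shadow b V h then sqrt (1 + (norm (Gh (chart_foot b h x)))\<^sup>2) else 0))
      \<in> borel_measurable borel" by measurable
  have "chart_density (b, V, h, Gh) = (\<lambda>x. indicator {0..1} (x \<bullet> b) *
      ennreal (if x \<in> chart_shadow b V h then sqrt (1 + (norm (Gh (chart_foot b h x)))\<^sup>2) else 0))"
    by (auto simp: chart_density_def fun_eq_iff)
  then show ?thesis by simp
qed


lemma nn_integral_chart_measure:
  assumes [measurable]: "F \<in> borel_measurable borel"
  shows "(\<integral>\<^sup>+ z. F z \<partial>chart_measure (b, V, h, Gh))
    = (\<integral>\<^sup>+ x. chart_density (b, V, h, Gh) x * F (x + chart_height b V h x *\<^sub>R b) \<partial>lborel)"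
  unfolding chart_measure_def
  by (simp add: nn_integral_distr nn_integral_density)

lemma emeasure_chart_measure:
  assumes [measurable]: "E \<in> sets borel"
  shows "emeasure (chart_measure (b, V, h, Gh)) E = chart_area (b, V, h, Gh) E"
proof -
  have "emeasure (chart_measure (b, V, h, Gh)) E = (\<integral>\<^sup>+ z. indicator E z \<partial>chart_measure (b, V, h, Gh))"
    by simp
  also have "\<dots> = (\<integral>\<^sup>+ x. chart_density (b, V, h, Gh) x * indicator E (x + chart_height b V h x *\<^sub>R b) \<partial>lborel)"
    by (rule nn_integral_chart_measure) measurable
  also have "\<dots> = chart_area (b, V, h, Gh) E"
    unfolding chart_area_def Let_def prod.case
  proof (rule nn_integral_cong)
    fix x
    show "chart_density (b, V, h, Gh) x * indicator E (x + chart_height b V h x *\<^sub>R b) =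
         indicator {0..1} (x \<bullet> b) * indicator (E \<inter> V) (x + (h x - x \<bullet> b) *\<^sub>R b) *
         ennreal (sqrt (1 + (norm (Gh (x + (h x - x \<bullet> b) *\<^sub>R b)))\<^sup>2))"
      by (auto simp: chart_density_def chart_height_def chart_shadow_def chart_foot_def indicator_def)
  qed
  finally show ?thesis .
qed

lemma chart_measure_Int_V:
  assumes [measurable]: "E \<in> sets borel" "S \<in> sets borel"
  shows "emeasure (chart_measure (b, V, h, Gh)) (E \<inter> (S \<inter> V)) = emeasure (chart_measure (b, V, h, Gh)) E"
proof -
  have [measurable]: "V \<in> sets borel" using open_V by (rule borel_open)
  show ?thesis using foot_in_S
    by (auto simp: emeasure_chart_measure chart_area_def Let_def chart_shadow_def chart_foot_def
        indicator_def intro!: nn_integral_cong)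
qed

text \<open>On a compact part of the chart the slope is bounded. Points at distance of order \<open>\<delta>\<close> from the surface
  are therefore also at vertical distance of order \<open>\<delta>\<close> from the graph, and the line through them meets
  the graph inside the chart.\<close>

lemma height_le_distance:
  assumes K: "compact K" "K \<subseteq> V"
  obtains e \<Lambda> where "e > 0" "\<Lambda> \<ge> 0"
    "\<And>z y. z \<in> K \<Longrightarrow> y \<in> S \<Longrightarrow> dist z y < e \<Longrightarrow> z \<in> chart_shadow b V h \<and> \<bar>h z - z \<bullet> b\<bar> \<le> \<Lambda> * dist z y"
proof -
  obtain e where e: "e > 0" "(\<Union>x\<in>K. ball x e) \<subseteq> V"
    using compact_subset_open_imp_ball_epsilon_subset[OF K(1) open_V K(2)] by blast
  define K' where "K' = (\<Union>x\<in>K. \<Union>y\<in>cball 0 (e / 2). {x + y})"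
  have cK': "compact K'" unfolding K'_def by (intro compact_sums' K compact_cball)
  have inK': "cball z (e / 2) \<subseteq> K'" if "z \<in> K" for z
  proof
    fix y assume "y \<in> cball z (e / 2)"
    then have "y = z + (y - z)" "y - z \<in> cball 0 (e / 2)" by (auto simp: dist_norm norm_minus_commute)
    then show "y \<in> K'" using that unfolding K'_def by blast
  qed
  have K'V: "K' \<subseteq> V"
  proof
    fix y assume "y \<in> K'"
    then obtain x w where "x \<in> K" "norm w \<le> e / 2" "y = x + w" unfolding K'_def by auto
    then have "y \<in> ball x e" "x \<in> K" using e(1) by (auto simp: dist_norm)
    then show "y \<in> V" using e(2) by blast
  qed
  have "compact (Gh ` K')" using cK' cont_Gh K'V by (meson compact_continuous_image continuous_on_subset)
  then have "bounded (Gh ` K')" by (rule compact_imp_bounded)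
  then obtain \<Lambda> where "\<Lambda> > 0" "\<forall>x\<in>Gh ` K'. norm x \<le> \<Lambda>"
    unfolding bounded_pos by blast
  then have \<Lambda>: "\<And>x. x \<in> K' \<Longrightarrow> norm (Gh x) \<le> \<Lambda>" "\<Lambda> > 0" by auto
  define e' where "e' = min (e / 2) (e / (\<Lambda> + 1))"
  show ?thesis
  proof
    show "e' > 0" "\<Lambda> + 1 \<ge> 0" using e \<Lambda> by (auto simp: e'_def)
    fix z y assume z: "z \<in> K" and y: "y \<in> S" and d: "dist z y < e'"
    have yb: "y \<in> cball z (e / 2)" using d by (simp add: e'_def)
    have "norm (h z - h y) \<le> \<Lambda> * norm (z - y)"
    proof (rule differentiable_bound[of "cball z (e / 2)" h "\<lambda>x v. v \<bullet> Gh x"])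
      fix x assume x: "x \<in> cball z (e / 2)"
      then have x': "x \<in> K'" using inK'[OF z] by auto
      show "(h has_derivative (\<lambda>v. v \<bullet> Gh x)) (at x within cball z (e / 2))"
        using h_deriv x' K'V has_derivative_at_withinI by blast
      have "norm (v \<bullet> Gh x) \<le> \<Lambda> * norm v" for v
      proof -
        have "norm (v \<bullet> Gh x) \<le> norm v * norm (Gh x)" by (simp add: Cauchy_Schwarz_ineq2)
        also have "\<dots> \<le> norm v * \<Lambda>" using \<Lambda>(1)[OF x'] by (intro mult_left_mono) auto
        finally show ?thesis by (simp add: mult.commute)
      qed
      then show "onorm (\<lambda>v. v \<bullet> Gh x) \<le> \<Lambda>" using \<Lambda>(2) by (intro onorm_bound) auto
    qed (use yb e(1) in auto)
    moreover have "h y = y \<bullet> b"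
    proof -
      have "y \<in> V" using inK'[OF z] K'V yb by (meson subsetD)
      then have "y \<in> S \<inter> V" using y by simp
      then show ?thesis unfolding graph_eq by simp
    qed
    moreover have "\<bar>y \<bullet> b - z \<bullet> b\<bar> \<le> norm (z - y)"
      using Basis_le_norm[OF b_Basis, of "y - z"] by (simp add: inner_diff_left norm_minus_commute)
    ultimately have hz: "\<bar>h z - z \<bullet> b\<bar> \<le> (\<Lambda> + 1) * dist z y" by (simp add: dist_norm algebra_simps)
    have "dist z (chart_foot b h z) = \<bar>h z - z \<bullet> b\<bar>"
      using b_Basis by (simp add: chart_foot_def dist_norm)
    also have "\<dots> < e"
    proof -
      have "(\<Lambda> + 1) * dist z y < (\<Lambda> + 1) * (e / (\<Lambda> + 1))"
        using d \<Lambda>(2) by (intro mult_strict_left_mono) (auto simp: e'_def)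
      then show ?thesis using hz \<Lambda>(2) by simp
    qed
    finally have "chart_foot b h z \<in> V" using e(2) z by (meson UN_I mem_ball subsetD)
    then show "z \<in> chart_shadow b V h \<and> \<bar>h z - z \<bullet> b\<bar> \<le> (\<Lambda> + 1) * dist z y"
      using hz by (simp add: chart_shadow_def)
  qed
qed

lemma AE_chart_measure:
  assumes [measurable]: "S \<in> sets borel"
  shows "AE z in chart_measure (b, V, h, Gh). z \<in> S \<inter> V"
proof (rule AE_I')
  have [measurable]: "V \<in> sets borel" using open_V by (rule borel_open)
  have "emeasure (chart_measure (b, V, h, Gh)) (- (S \<inter> V)) = emeasure (chart_measure (b, V, h, Gh)) (- (S \<inter> V) \<inter> (S \<inter> V))"
    by (rule chart_measure_Int_V[symmetric]) auto
  then show "- (S \<inter> V) \<in> null_sets (chart_measure (b, V, h, Gh))"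
    unfolding Compl_disjoint2 by (intro null_setsI) auto
qed auto

lemma emeasure_chart_compact_finite:
  assumes K: "compact K" "K \<subseteq> V"
  shows "emeasure (chart_measure (b, V, h, Gh)) K < \<infinity>"
proof -
  have [measurable]: "K \<in> sets borel" using K(1) by (simp add: borel_compact)
  have "compact (Gh ` K)" using K cont_Gh by (meson compact_continuous_image continuous_on_subset)
  then have "bounded (Gh ` K)" by (rule compact_imp_bounded)
  then obtain B where B: "B > 0" "\<forall>x\<in>Gh ` K. norm x \<le> B" unfolding bounded_pos by blast
  have "bounded K" using K(1) by (rule compact_imp_bounded)
  then obtain R where R: "R > 0" "\<forall>z\<in>K. norm z \<le> R" unfolding bounded_pos by blast
  have "emeasure (chart_measure (b, V, h, Gh)) K \<le> (\<integral>\<^sup>+ x. ennreal (sqrt (1 + B\<^sup>2)) * indicator (cball (0::'a) (2 * R + 1)) x \<partial>lborel)"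
    unfolding emeasure_chart_measure[OF \<open>K \<in> sets borel\<close>] chart_area_def Let_def prod.case
  proof (rule nn_integral_mono)
    fix x :: 'a
    define q where "q = x + (h x - x \<bullet> b) *\<^sub>R b"
    show "indicator {0..1} (x \<bullet> b) * indicator (K \<inter> V) (x + (h x - x \<bullet> b) *\<^sub>R b) *
         ennreal (sqrt (1 + (norm (Gh (x + (h x - x \<bullet> b) *\<^sub>R b)))\<^sup>2))
       \<le> ennreal (sqrt (1 + B\<^sup>2)) * indicator (cball 0 (2 * R + 1)) x"
    proof (cases "x \<bullet> b \<in> {0..1} \<and> q \<in> K")
      case True
      then have "norm (Gh q) \<le> B" "norm q \<le> R" using B R by auto
      then have 1: "sqrt (1 + (norm (Gh q))\<^sup>2) \<le> sqrt (1 + B\<^sup>2)" by (simp add: power_mono)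
      have "q \<bullet> b = h x" using b_Basis by (simp add: q_def inner_add_left)
      moreover have "\<bar>q \<bullet> b\<bar> \<le> R" using Basis_le_norm[OF b_Basis, of q] \<open>norm q \<le> R\<close> by auto
      ultimately have "\<bar>h x - x \<bullet> b\<bar> \<le> R + 1" using True by auto
      moreover have "norm x \<le> norm q + \<bar>h x - x \<bullet> b\<bar>"
        using norm_triangle_ineq4[of q "(h x - x \<bullet> b) *\<^sub>R b"] b_Basis by (simp add: q_def)
      ultimately have "x \<in> cball 0 (2 * R + 1)" using \<open>norm q \<le> R\<close> by simp
      then show ?thesis using True 1 unfolding q_def[symmetric]
        by (auto simp: indicator_def intro: ennreal_leI)
    next
      case False
      then show ?thesis unfolding q_def[symmetric] by (auto simp: indicator_def)
    qed
  qed
  also have "\<dots> < \<infinity>"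
    using emeasure_lborel_cball_finite[of "0::'a" "2 * R + 1"]
    by (simp add: nn_integral_cmult_indicator ennreal_mult_less_top infinity_ennreal_def)
  finally show ?thesis .
qed

end

context regular_domain
begin

text \<open>A sequence of weights on space concentrating on the layer below the boundary in which the
  defining function exceeds \<open>- L \<delta>\<close>, up to lower order. The convergence is only pointwise,
  along coordinate directions transversal to the boundary.\<close>

definition boundary_layer :: "(nat \<Rightarrow> real) \<Rightarrow> (nat \<Rightarrow> 'a \<Rightarrow> real) \<Rightarrow> ('a \<Rightarrow> real) \<Rightarrow> bool" where
  "boundary_layer \<delta> u L \<longleftrightarrow>
     (\<forall>n. \<delta> n > 0) \<and> \<delta> \<longlonglongrightarrow> 0 \<and>
     (\<forall>n. u n \<in> borel_measurable borel) \<and> (\<forall>n z. 0 \<le> u n z \<and> u n z \<le> 1) \<and>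
     (\<exists>C\<ge>0. \<forall>\<^sub>F n in sequentially. \<forall>z. u n z \<noteq> 0 \<longrightarrow> (\<exists>y\<in>frontier D. dist z y \<le> C * \<delta> n)) \<and>
     (\<forall>p\<in>frontier D. \<forall>b\<in>Basis. \<forall>s. G p \<bullet> b \<noteq> 0 \<longrightarrow> s \<noteq> 0 \<longrightarrow> s * (G p \<bullet> b) \<noteq> L p \<longrightarrow>
        (\<lambda>n. u n (p - (s * \<delta> n) *\<^sub>R b)) \<longlonglongrightarrow> (if 0 < s * (G p \<bullet> b) \<and> s * (G p \<bullet> b) < L p then 1 else 0)) \<and>
     L \<in> borel_measurable borel \<and> (\<forall>p. 0 \<le> L p)"

lemma nn_integral_layer_profile:
  assumes "a \<noteq> (0::real)" "0 \<le> l" "0 \<le> c"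
  shows "(\<integral>\<^sup>+ s. ennreal (c * (if 0 < s * a \<and> s * a < l then 1 else 0)) \<partial>lborel) = ennreal (c * (l / \<bar>a\<bar>))"
proof -
  have eq: "{s. 0 < s * a \<and> s * a < l} = (if a > 0 then {0<..<l / a} else {l / a<..<0})"
    using assms(1) by (auto simp: field_simps zero_less_mult_iff)
  have em: "emeasure lborel {s. 0 < s * a \<and> s * a < l} = ennreal (l / \<bar>a\<bar>)"
    unfolding eq using assms by (auto simp: divide_nonneg_neg divide_nonpos_neg)
  have [measurable]: "{s. 0 < s * a \<and> s * a < l} \<in> sets borel" unfolding eq by auto
  have "(\<integral>\<^sup>+ s. ennreal (c * (if 0 < s * a \<and> s * a < l then 1 else 0)) \<partial>lborel)
      = (\<integral>\<^sup>+ s. ennreal c * indicator {s. 0 < s * a \<and> s * a < l} s \<partial>lborel)"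
    by (intro nn_integral_cong) (auto simp: indicator_def)
  also have "\<dots> = ennreal c * ennreal (l / \<bar>a\<bar>)" by (simp add: nn_integral_cmult_indicator em)
  finally show ?thesis using assms by (subst ennreal_mult) auto
qed

text \<open>Rescaling the vertical coordinate by \<open>\<delta>\<close> turns the integral over the layer into an integral over
  a fixed region. There the integrands converge pointwise and are bounded, and the vertical extent of
  the limit layer above \<open>x\<close> is \<open>L / \<bar>\<partial>\<rho> / \<partial>b\<bar>\<close>, which is \<open>L / \<bar>G\<bar>\<close> times the area density.\<close>

lemma layer_limit_chart:
  assumes layer: "boundary_layer \<delta> u L"
    and chart: "graph_chart (frontier D) (b, V, h, Gh)"
    and \<phi>: "continuous_on UNIV \<phi>" "\<And>z. 0 \<le> \<phi> z" "compact K" "K \<subseteq> V" "\<And>z. \<phi> z \<noteq> 0 \<Longrightarrow> z \<in> K"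
  shows "(\<lambda>n. (\<integral>\<^sup>+ z. ennreal (u n z * \<phi> z) \<partial>lborel) / ennreal (\<delta> n))
    \<longlonglongrightarrow> (\<integral>\<^sup>+ z. ennreal (\<phi> z * L z / norm (G z)) \<partial>chart_measure (b, V, h, Gh))"
proof -
  interpret graph_chart_of "frontier D" b V h Gh using chart by unfold_locales
  have \<delta>: "\<And>n. \<delta> n > 0" "\<delta> \<longlonglongrightarrow> 0" and u[measurable]: "\<And>n. u n \<in> borel_measurable borel"
    and u01: "\<And>n z. 0 \<le> u n z" "\<And>n z. u n z \<le> 1"
    and lim: "\<And>p b s. p \<in> frontier D \<Longrightarrow> b \<in> Basis \<Longrightarrow> G p \<bullet> b \<noteq> 0 \<Longrightarrow> s \<noteq> 0 \<Longrightarrow>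
      s * (G p \<bullet> b) \<noteq> L p \<Longrightarrow>
        (\<lambda>n. u n (p - (s * \<delta> n) *\<^sub>R b)) \<longlonglongrightarrow> (if 0 < s * (G p \<bullet> b) \<and> s * (G p \<bullet> b) < L p then 1 else 0)"
    and L[measurable]: "L \<in> borel_measurable borel" and L0: "\<And>p. 0 \<le> L p"
    using layer unfolding boundary_layer_def by auto
  obtain C where C: "C \<ge> 0"
    "\<forall>\<^sub>F n in sequentially. \<forall>z. u n z \<noteq> 0 \<longrightarrow> (\<exists>y\<in>frontier D. dist z y \<le> C * \<delta> n)"
    using layer unfolding boundary_layer_def by auto
  obtain e \<Lambda> where e: "e > 0" "\<Lambda> \<ge> 0"
    "\<And>z y. z \<in> K \<Longrightarrow> y \<in> frontier D \<Longrightarrow> dist z y < e \<Longrightarrow> z \<in> chart_shadow b V h \<and> \<bar>h z - z \<bullet> b\<bar> \<le> \<Lambda> * dist z y"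
    using height_le_distance[OF \<phi>(3,4)] by blast
  have [measurable]: "\<phi> \<in> borel_measurable borel" using \<phi>(1) by (rule borel_measurable_continuous_onI)
  have [measurable]: "G \<in> borel_measurable borel" using contG by (rule borel_measurable_continuous_onI)
  have "compact (\<phi> ` K)" using \<phi>(1,3) by (meson compact_continuous_image continuous_on_subset subset_UNIV)
  then obtain B where "B > 0" "\<forall>x\<in>\<phi> ` K. norm x \<le> B"
    using compact_imp_bounded[of "\<phi> ` K"] unfolding bounded_pos by auto
  then have B: "B > 0" "\<And>z. \<phi> z \<le> B" using \<phi>(2,5) by (auto, metis abs_of_nonneg less_imp_le)
  have "bounded K" using \<phi>(3) by (rule compact_imp_bounded)
  then obtain R where R: "R > 0" "\<And>z. z \<in> K \<Longrightarrow> norm z \<le> R" unfolding bounded_pos by auto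

  define z where "z n x s = x + (chart_height b V h x - s * \<delta> n) *\<^sub>R b" for n x s
  define \<Omega> where "\<Omega> = cball (0::'a) (2 * R + 1)"
  define S where "S = \<Lambda> * C"
  have z_meas[measurable]: "(\<lambda>x. z n (f x) (g x)) \<in> borel_measurable M"
    if [measurable]: "f \<in> borel_measurable M" "g \<in> borel_measurable M" for M :: "'b measure" and f g n
    unfolding z_def by measurable
  have "\<forall>\<^sub>F n in sequentially. C * \<delta> n < e"
    using tendsto_mult_right_zero[OF \<delta>(2), of C] e(1) by (rule order_tendstoD(2))
  \<comment> \<open>For large \<open>n\<close> the integrand is supported over the shadow of the chart and in a bounded region, which
    provides the dominating function.\<close>
  with C(2) have "\<forall>\<^sub>F n in sequentially. \<forall>x s. 0 \<le> x \<bullet> b \<and> x \<bullet> b \<le> 1 \<and> u n (z n x s) * \<phi> (z n x s) \<noteq> 0 \<longrightarrow>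
      x \<in> chart_shadow b V h \<and> \<bar>s\<bar> \<le> S \<and> x \<in> \<Omega>"
  proof eventually_elim
    case (elim n)
    show ?case
    proof (intro allI impI)
      fix x s assume *: "0 \<le> x \<bullet> b \<and> x \<bullet> b \<le> 1 \<and> u n (z n x s) * \<phi> (z n x s) \<noteq> 0"
      define w where "w = z n x s"
      have wK: "w \<in> K" and nz: "u n w \<noteq> 0" using * \<phi>(5) by (auto simp: w_def)
      obtain y where y: "y \<in> frontier D" "dist w y \<le> C * \<delta> n" using elim(1) nz by blast
      have w1: "w \<in> chart_shadow b V h" "\<bar>h w - w \<bullet> b\<bar> \<le> \<Lambda> * dist w y"
        using e(3)[OF wK y(1)] y(2) elim(2) by auto
      have xs: "x \<in> chart_shadow b V h" using w1(1) unfolding w_def z_def shadow_line .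
      have "h w - w \<bullet> b = s * \<delta> n"
        using xs b_Basis by (simp add: w_def z_def h_line chart_height_def inner_add_left)
      then have "\<bar>s\<bar> * \<delta> n \<le> \<Lambda> * dist w y" using w1(2) \<delta>(1)[of n] by (simp add: abs_mult)
      also have "\<dots> \<le> \<Lambda> * (C * \<delta> n)" using y(2) e(2) by (intro mult_left_mono) auto
      finally have sS: "\<bar>s\<bar> \<le> S" using \<delta>(1)[of n] by (simp add: S_def)
      define t where "t = chart_height b V h x - s * \<delta> n"
      have wt: "w = x + t *\<^sub>R b" by (simp add: w_def z_def t_def)
      have "w \<bullet> b = x \<bullet> b + t" using b_Basis by (simp add: wt inner_add_left)
      moreover have "\<bar>w \<bullet> b\<bar> \<le> R" using Basis_le_norm[OF b_Basis, of w] R(2)[OF wK] by auto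
      ultimately have "\<bar>t\<bar> \<le> R + 1" using * by auto
      moreover have "norm x \<le> norm w + \<bar>t\<bar>"
        using norm_triangle_ineq4[of w "t *\<^sub>R b"] b_Basis by (simp add: wt)
      ultimately have "x \<in> \<Omega>" using R(2)[OF wK] by (simp add: \<Omega>_def)
      with xs sS show "x \<in> chart_shadow b V h \<and> \<bar>s\<bar> \<le> S \<and> x \<in> \<Omega>" by blast
    qed
  qed
  then obtain n0 where n0: "\<And>n x s. n \<ge> n0 \<Longrightarrow> 0 \<le> x \<bullet> b \<Longrightarrow> x \<bullet> b \<le> 1 \<Longrightarrow>
      u n (z n x s) * \<phi> (z n x s) \<noteq> 0 \<Longrightarrow> x \<in> chart_shadow b V h \<and> \<bar>s\<bar> \<le> S \<and> x \<in> \<Omega>"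
    unfolding eventually_sequentially by auto

  define F where "F n x s = ennreal (u n (z n x s) * \<phi> (z n x s))" for n x s
  define J where "J n x = indicator {0..1} (x \<bullet> b) * (\<integral>\<^sup>+ s. F n x s \<partial>lborel)" for n x
  define J' where "J' x = chart_density (b, V, h, Gh) x *
     (let p = x + chart_height b V h x *\<^sub>R b in ennreal (\<phi> p * L p / norm (G p)))" for x
  have F_meas[measurable]: "F n x \<in> borel_measurable borel" for n x
    unfolding F_def by measurable
  have F_meas2[measurable]: "(\<lambda>(x, s). F n x s) \<in> borel_measurable (lborel \<Otimes>\<^sub>M lborel)" for n
    unfolding F_def by measurable
  have J_meas: "J n \<in> borel_measurable lborel" for n
    unfolding J_def by measurable
  have scaled: "(\<integral>\<^sup>+ z. ennreal (u n z * \<phi> z) \<partial>lborel) = ennreal (\<delta> n) * (\<integral>\<^sup>+ x. J n x \<partial>lborel)" for n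
  proof -
    have "(\<integral>\<^sup>+ z. ennreal (u n z * \<phi> z) \<partial>lborel) =
       (\<integral>\<^sup>+ x. indicator {0..1} (x \<bullet> b) * (\<integral>\<^sup>+ t. ennreal (u n (x + t *\<^sub>R b) * \<phi> (x + t *\<^sub>R b)) \<partial>lborel) \<partial>lborel)"
      by (rule nn_integral_lborel_slab[OF _ b_Basis]) measurable
    also have "\<dots> = (\<integral>\<^sup>+ x. ennreal (\<delta> n) * J n x \<partial>lborel)"
    proof (rule nn_integral_cong)
      fix x
      have "(\<integral>\<^sup>+ t. ennreal (u n (x + t *\<^sub>R b) * \<phi> (x + t *\<^sub>R b)) \<partial>lborel) = ennreal (\<delta> n) * (\<integral>\<^sup>+ s. F n x s \<partial>lborel)"
        unfolding F_def z_def
        by (rule nn_integral_reflect_scale[where f="\<lambda>t. ennreal (u n (x + t *\<^sub>R b) * \<phi> (x + t *\<^sub>R b))"])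
           (use \<delta> in auto)
      then show "indicator {0..1} (x \<bullet> b) * (\<integral>\<^sup>+ t. ennreal (u n (x + t *\<^sub>R b) * \<phi> (x + t *\<^sub>R b)) \<partial>lborel)
          = ennreal (\<delta> n) * J n x" by (simp add: J_def mult.left_commute)
    qed
    also have "\<dots> = ennreal (\<delta> n) * (\<integral>\<^sup>+ x. J n x \<partial>lborel)" by (rule nn_integral_cmult[OF J_meas])
    finally show ?thesis .
  qed
  have quot: "(\<integral>\<^sup>+ z. ennreal (u n z * \<phi> z) \<partial>lborel) / ennreal (\<delta> n) = (\<integral>\<^sup>+ x. J n x \<partial>lborel)" for n
    unfolding scaled mult.commute[of "ennreal (\<delta> n)"] using \<delta>(1)[of n]
    by (intro mult_divide_eq_ennreal) (auto simp: ennreal_eq_0_iff)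

  have Fb: "F (n + n0) x s \<le> ennreal B * indicator {-S..S} s" if "0 \<le> x \<bullet> b" "x \<bullet> b \<le> 1" for n x s
  proof (cases "u (n + n0) (z (n + n0) x s) * \<phi> (z (n + n0) x s) = 0")
    case False
    have "u (n + n0) (z (n + n0) x s) * \<phi> (z (n + n0) x s) \<le> 1 * B"
      using u01 B \<phi>(2) by (intro mult_mono) auto
    moreover have "\<bar>s\<bar> \<le> S" using n0[OF _ that False] by auto
    ultimately show ?thesis using B by (auto simp: F_def indicator_def abs_le_iff intro!: ennreal_leI)
  next
    case True
    then show ?thesis by (simp only: F_def ennreal_0 zero_le)
  qed
  have Fout: "F (n + n0) x s = 0" if "0 \<le> x \<bullet> b" "x \<bullet> b \<le> 1" "\<not> (x \<in> chart_shadow b V h \<and> x \<in> \<Omega>)" for n x s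
  proof -
    have "u (n + n0) (z (n + n0) x s) * \<phi> (z (n + n0) x s) = 0"
      using n0[OF le_add2 that(1,2)] that(3) by blast
    then show ?thesis by (simp only: F_def ennreal_0)
  qed

  have pw: "(\<lambda>n. J (n + n0) x) \<longlonglongrightarrow> J' x" for x
  proof (cases "0 \<le> x \<bullet> b \<and> x \<bullet> b \<le> 1")
    case False
    then show ?thesis by (simp add: J_def J'_def chart_density_def)
  next
    case slab: True
    show ?thesis
    proof (cases "x \<in> chart_shadow b V h")
      case False
      then show ?thesis using Fout slab by (simp add: J_def J'_def chart_density_def)
    next
      case True
      define p where "p = chart_foot b h x"
      have p: "p \<in> frontier D" "p \<in> V" using foot_in_S[OF True] by (auto simp: p_def)
      have zp: "z n x s = p - (s * \<delta> n) *\<^sub>R b" for n s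
        using height_foot[OF True] by (simp add: z_def p_def scaleR_diff_left algebra_simps)
      define a where "a = G p \<bullet> b"
      have a: "a \<noteq> 0" "sqrt (1 + (norm (Gh p))\<^sup>2) = norm (G p) / \<bar>a\<bar>"
        using chart_slope[OF chart p] by (auto simp: a_def)
      have "(\<lambda>n. \<integral>\<^sup>+ s. F (n + n0) x s \<partial>lborel)
          \<longlonglongrightarrow> (\<integral>\<^sup>+ s. ennreal (\<phi> p * (if 0 < s * a \<and> s * a < L p then 1 else 0)) \<partial>lborel)"
      proof (rule nn_integral_dominated_convergence[where w="\<lambda>s. ennreal B * indicator {-S..S} s"])
        show "(\<integral>\<^sup>+ s. ennreal B * indicator {- S..S} s \<partial>lborel) < \<infinity>"
          by (simp add: nn_integral_cmult_indicator emeasure_lborel_Icc_eq ennreal_mult_less_top)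
        show "AE s in lborel. F (j + n0) x s \<le> ennreal B * indicator {- S..S} s" for j
          using Fb slab by auto
        have "AE s in lborel. s \<noteq> 0" "AE s in lborel. s \<noteq> L p / a" by (rule AE_lborel_singleton)+
        then show "AE s in lborel. (\<lambda>n. F (n + n0) x s) \<longlonglongrightarrow> ennreal (\<phi> p * (if 0 < s * a \<and> s * a < L p then 1 else 0))"
        proof eventually_elim
          case (elim s)
          have 1: "(\<lambda>n. u n (p - (s * \<delta> n) *\<^sub>R b)) \<longlonglongrightarrow> (if 0 < s * a \<and> s * a < L p then 1 else 0)"
            unfolding a_def using elim a(1) by (intro lim p b_Basis) (auto simp: a_def field_simps)
          have "(\<lambda>n. p - (s * \<delta> n) *\<^sub>R b) \<longlonglongrightarrow> p - (s * 0) *\<^sub>R b" by (intro tendsto_intros \<delta>)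
          then have "(\<lambda>n. \<phi> (p - (s * \<delta> n) *\<^sub>R b)) \<longlonglongrightarrow> \<phi> p"
            using continuous_on_tendsto_compose[OF \<phi>(1)] by auto
          then have "(\<lambda>n. u n (p - (s * \<delta> n) *\<^sub>R b) * \<phi> (p - (s * \<delta> n) *\<^sub>R b))
              \<longlonglongrightarrow> (if 0 < s * a \<and> s * a < L p then 1 else 0) * \<phi> p"
            by (intro tendsto_mult 1)
          then have "(\<lambda>n. F n x s) \<longlonglongrightarrow> ennreal ((if 0 < s * a \<and> s * a < L p then 1 else 0) * \<phi> p)"
            unfolding F_def zp by (rule tendsto_ennrealI)
          then have "(\<lambda>n. F (n + n0) x s) \<longlonglongrightarrow> ennreal ((if 0 < s * a \<and> s * a < L p then 1 else 0) * \<phi> p)"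
            by (rule LIMSEQ_ignore_initial_segment)
          then show ?case by (simp add: mult.commute)
        qed
      qed measurable
      also have "(\<integral>\<^sup>+ s. ennreal (\<phi> p * (if 0 < s * a \<and> s * a < L p then 1 else 0)) \<partial>lborel) = ennreal (\<phi> p * (L p / \<bar>a\<bar>))"
        by (rule nn_integral_layer_profile[OF a(1) L0 \<phi>(2)])
      also have "ennreal (\<phi> p * (L p / \<bar>a\<bar>)) = J' x"
      proof -
        have "J' x = ennreal (norm (G p) / \<bar>a\<bar>) * ennreal (\<phi> p * L p / norm (G p))"
          using slab True a(2) by (simp add: J'_def chart_density_def Let_def height_foot p_def)
        also have "\<dots> = ennreal (norm (G p) / \<bar>a\<bar> * (\<phi> p * L p / norm (G p)))"
          using \<phi>(2) L0 by (intro ennreal_mult[symmetric]) auto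
        also have "norm (G p) / \<bar>a\<bar> * (\<phi> p * L p / norm (G p)) = \<phi> p * (L p / \<bar>a\<bar>)"
          using G_nonzero[OF p(1)] by simp
        finally show ?thesis ..
      qed
      finally show ?thesis using slab by (simp add: J_def)
    qed
  qed
  have "(\<lambda>n. \<integral>\<^sup>+ x. J (n + n0) x \<partial>lborel) \<longlonglongrightarrow> (\<integral>\<^sup>+ x. J' x \<partial>lborel)"
  proof (rule nn_integral_dominated_convergence[where w="\<lambda>x. (ennreal B * ennreal (2 * S)) * indicator \<Omega> x"])
    show "J' \<in> borel_measurable lborel" unfolding J'_def Let_def by measurable
    have "emeasure lborel \<Omega> < \<top>"
      using emeasure_lborel_cball_finite[of "0::'a" "2 * R + 1"] by (simp add: \<Omega>_def infinity_ennreal_def)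
    moreover have "\<Omega> \<in> sets lborel" by (simp add: \<Omega>_def)
    ultimately show "(\<integral>\<^sup>+ x. ennreal B * ennreal (2 * S) * indicator \<Omega> x \<partial>lborel) < \<infinity>"
      by (simp add: nn_integral_cmult_indicator ennreal_mult_less_top)
    show "J (i + n0) \<in> borel_measurable lborel" for i by (rule J_meas)
    show "(\<lambda>x. ennreal B * ennreal (2 * S) * indicator \<Omega> x) \<in> borel_measurable lborel"
    proof -
      have [measurable]: "\<Omega> \<in> sets borel" by (simp add: \<Omega>_def)
      show ?thesis by measurable
    qed
    show "AE x in lborel. J (j + n0) x \<le> ennreal B * ennreal (2 * S) * indicator \<Omega> x" for j
    proof (rule AE_I2)
      fix x
      show "J (j + n0) x \<le> ennreal B * ennreal (2 * S) * indicator \<Omega> x"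
      proof (cases "0 \<le> x \<bullet> b \<and> x \<bullet> b \<le> 1 \<and> x \<in> \<Omega>")
        case True
        have "(\<integral>\<^sup>+ s. F (j + n0) x s \<partial>lborel) \<le> (\<integral>\<^sup>+ s. ennreal B * indicator {-S..S} s \<partial>lborel)"
          using Fb True by (intro nn_integral_mono) auto
        also have "\<dots> = ennreal B * ennreal (2 * S)"
        proof -
          have "0 \<le> S" using e(2) C(1) by (simp add: S_def)
          then show ?thesis by (simp add: nn_integral_cmult_indicator)
        qed
        finally show ?thesis using True by (simp add: J_def)
      next
        case False
        show ?thesis
        proof (cases "0 \<le> x \<bullet> b \<and> x \<bullet> b \<le> 1")
          case slab: True
          have "F (j + n0) x = (\<lambda>_. 0)" using Fout slab False by blast
          then show ?thesis by (simp add: J_def)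
        qed (simp add: J_def)
      qed
    qed
    show "AE x in lborel. (\<lambda>n. J (n + n0) x) \<longlonglongrightarrow> J' x" using pw by auto
  qed
  then have "(\<lambda>n. \<integral>\<^sup>+ x. J n x \<partial>lborel) \<longlonglongrightarrow> (\<integral>\<^sup>+ x. J' x \<partial>lborel)" by (rule LIMSEQ_offset)
  moreover have "(\<integral>\<^sup>+ x. J' x \<partial>lborel) = (\<integral>\<^sup>+ z. ennreal (\<phi> z * L z / norm (G z)) \<partial>chart_measure (b, V, h, Gh))"
    unfolding J'_def Let_def by (rule nn_integral_chart_measure[symmetric]) measurable
  ultimately show ?thesis unfolding quot by simp
qed

lemma frontier_borel [measurable]: "frontier D \<in> sets borel"
  using compact_frontier_D by (rule borel_compact)

lemma rho_quotient_limit: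
  assumes \<delta>: "\<And>n. \<delta> n > 0" "\<delta> \<longlonglongrightarrow> 0" and p: "p \<in> frontier D" and s: "s \<noteq> 0"
  shows "(\<lambda>n. \<rho> (p - (s * \<delta> n) *\<^sub>R v) / \<delta> n) \<longlonglongrightarrow> - (s * (G p \<bullet> v))"
proof -
  have "filterlim (\<lambda>n. - (s * \<delta> n)) (at 0) sequentially"
    using \<delta> s tendsto_minus[OF tendsto_mult_right_zero[OF \<delta>(2), of s]]
    by (auto simp: filterlim_at intro!: always_eventually) (metis less_irrefl)
  from filterlim_compose[OF rho_directional_limit[of p v] this]
  have "(\<lambda>n. - s * (\<rho> (p - (s * \<delta> n) *\<^sub>R v) / - (s * \<delta> n))) \<longlonglongrightarrow> - s * (G p \<bullet> v)"
    using frontier_zero[OF p] by (intro tendsto_mult_left) simp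
  then show ?thesis using s by (simp add: field_simps)
qed

text \<open>A layer whose definition does not mention charts; it serves to compare them.\<close>

lemma sublevel_boundary_layer:
  assumes \<delta>: "\<And>n. \<delta> n > 0" "\<delta> \<longlonglongrightarrow> 0"
  shows "boundary_layer \<delta> (\<lambda>n. indicat_real {z \<in> D. - \<rho> z < \<delta> n}) (\<lambda>_. 1)"
proof -
  have [measurable]: "\<rho> \<in> borel_measurable borel" using cont_rho by (rule borel_measurable_continuous_onI)
  obtain C where C: "C > 0" "\<And>z. z \<in> D \<Longrightarrow> \<exists>y\<in>frontier D. dist z y \<le> C * - \<rho> z"
    using boundary_distance_le by blast
  have "\<exists>y\<in>frontier D. dist z y \<le> C * \<delta> n" if zD: "z \<in> D" "- \<rho> z < \<delta> n" for z n
  proof -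
    obtain y where "y \<in> frontier D" "dist z y \<le> C * - \<rho> z" using C(2)[OF zD(1)] by blast
    moreover have "C * - \<rho> z \<le> C * \<delta> n" using C(1) zD(2) by (intro mult_left_mono) auto
    ultimately show ?thesis by force
  qed
  moreover have "(\<lambda>n. indicat_real {z \<in> D. - \<rho> z < \<delta> n} (p - (s * \<delta> n) *\<^sub>R b))
      \<longlonglongrightarrow> (if 0 < s * (G p \<bullet> b) \<and> s * (G p \<bullet> b) < 1 then 1 else 0)"
    if p: "p \<in> frontier D" and s: "s \<noteq> 0" "G p \<bullet> b \<noteq> 0" "s * (G p \<bullet> b) \<noteq> 1" for p b s
  proof -
    define q where "q n = p - (s * \<delta> n) *\<^sub>R b" for n
    have lim: "(\<lambda>n. \<rho> (q n) / \<delta> n) \<longlonglongrightarrow> - (s * (G p \<bullet> b))"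
      unfolding q_def by (rule rho_quotient_limit[OF \<delta> p s(1)])
    have "s * (G p \<bullet> b) \<noteq> 0" using s by simp
    with s(3) consider "s * (G p \<bullet> b) < 0" | "0 < s * (G p \<bullet> b)" "s * (G p \<bullet> b) < 1" | "1 < s * (G p \<bullet> b)"
      by linarith
    then have "(\<lambda>n. indicat_real {z \<in> D. - \<rho> z < \<delta> n} (q n))
      \<longlonglongrightarrow> (if 0 < s * (G p \<bullet> b) \<and> s * (G p \<bullet> b) < 1 then 1 else 0)"
    proof cases
      case 1
      then have "\<forall>\<^sub>F n in sequentially. \<rho> (q n) / \<delta> n > 0" using lim by (intro order_tendstoD(1)) auto
      then have "\<forall>\<^sub>F n in sequentially. indicat_real {z \<in> D. - \<rho> z < \<delta> n} (q n) = 0"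
        by eventually_elim (use \<delta>(1) in \<open>auto simp: D_eq zero_less_divide_iff indicator_def dest: less_imp_not_less\<close>)
      then show ?thesis using 1 by (simp add: tendsto_eventually)
    next
      case 2
      have "\<forall>\<^sub>F n in sequentially. \<rho> (q n) / \<delta> n < 0" using lim 2 by (intro order_tendstoD(2)) auto
      moreover have "\<forall>\<^sub>F n in sequentially. \<rho> (q n) / \<delta> n > - 1" using lim 2 by (intro order_tendstoD(1)) auto
      ultimately have "\<forall>\<^sub>F n in sequentially. indicat_real {z \<in> D. - \<rho> z < \<delta> n} (q n) = 1"
      proof eventually_elim
        case (elim n)
        then show ?case using \<delta>(1)[of n] by (simp add: D_eq divide_less_0_iff less_divide_eq)
      qed
      then show ?thesis using 2 by (simp add: tendsto_eventually)
    next
      case 3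
      have "\<forall>\<^sub>F n in sequentially. \<rho> (q n) / \<delta> n < - 1" using lim 3 by (intro order_tendstoD(2)) auto
      then have "\<forall>\<^sub>F n in sequentially. indicat_real {z \<in> D. - \<rho> z < \<delta> n} (q n) = 0"
      proof eventually_elim
        case (elim n)
        then show ?case using \<delta>(1)[of n] by (simp add: divide_less_eq)
      qed
      then show ?thesis using 3 by (simp add: tendsto_eventually)
    qed
    then show ?thesis unfolding q_def .
  qed
  moreover have "indicat_real {z \<in> D. - \<rho> z < \<delta> n} \<in> borel_measurable borel" for n
  proof -
    have [measurable]: "D \<in> sets borel" using open_D by (rule borel_open)
    show ?thesis by measurable
  qed
  ultimately show ?thesis
    unfolding boundary_layer_def using \<delta> C(1)
    by (auto intro!: exI[of _ C] always_eventually split: split_indicator simp del: of_nat_Suc)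
qed

text \<open>Two charts assign the same area to a set on which both are defined, because the area they assign
  is the limit of the volumes of the same thin shells. This holds first for integrals of continuous
  functions and carries over to open sets by approximation from below, and to Borel sets because
  the open sets generate them.\<close>

lemma chart_measure_unique_continuous:
  assumes c1: "graph_chart (frontier D) (b1, V1, h1, G1)" and c2: "graph_chart (frontier D) (b2, V2, h2, G2)"
    and \<phi>: "continuous_on UNIV \<phi>" "\<And>z. 0 \<le> \<phi> z" "compact K" "K \<subseteq> V1 \<inter> V2" "\<And>z. \<phi> z \<noteq> 0 \<Longrightarrow> z \<in> K"
  shows "(\<integral>\<^sup>+ z. ennreal (\<phi> z) \<partial>chart_measure (b1, V1, h1, G1)) = (\<integral>\<^sup>+ z. ennreal (\<phi> z) \<partial>chart_measure (b2, V2, h2, G2))"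
proof -
  define \<delta> where "\<delta> n = inverse (real (Suc n))" for n
  have \<delta>: "\<And>n. \<delta> n > 0" "\<delta> \<longlonglongrightarrow> 0"
    unfolding \<delta>_def by (simp, rule LIMSEQ_inverse_real_of_nat)
  \<comment> \<open>The factor compensates for the thickness \<open>1 / |G|\<close> of the layer.\<close>
  define \<psi> where "\<psi> z = \<phi> z * norm (G z)" for z
  have \<psi>: "continuous_on UNIV \<psi>" "\<And>z. 0 \<le> \<psi> z" "\<And>z. \<psi> z \<noteq> 0 \<Longrightarrow> z \<in> K"
    unfolding \<psi>_def using \<phi> contG by (auto intro!: continuous_intros)
  have *: "(\<integral>\<^sup>+ z. ennreal (\<psi> z * 1 / norm (G z)) \<partial>chart_measure (b, V, h, Gh)) = (\<integral>\<^sup>+ z. ennreal (\<phi> z) \<partial>chart_measure (b, V, h, Gh))"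
    if "graph_chart (frontier D) (b, V, h, Gh)" for b V h Gh
  proof -
    interpret graph_chart_of "frontier D" b V h Gh using that by unfold_locales
    have "AE z in chart_measure (b, V, h, Gh). z \<in> frontier D \<inter> V" by (rule AE_chart_measure) measurable
    then show ?thesis
      by (intro nn_integral_cong_AE, eventually_elim) (use G_nonzero in \<open>auto simp: \<psi>_def\<close>)
  qed
  show ?thesis
    using LIMSEQ_unique[OF layer_limit_chart[OF sublevel_boundary_layer[OF \<delta>] c1 \<psi>(1,2) \<phi>(3) _ \<psi>(3)]
        layer_limit_chart[OF sublevel_boundary_layer[OF \<delta>] c2 \<psi>(1,2) \<phi>(3) _ \<psi>(3)]] \<phi>(4)
    unfolding *[OF c1] *[OF c2] by auto
qed

lemma chart_measure_unique_open:
  assumes c1: "graph_chart (frontier D) (b1, V1, h1, G1)" and c2: "graph_chart (frontier D) (b2, V2, h2, G2)"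
    and U: "open U" "bounded U" "U \<subseteq> V1 \<inter> V2"
  shows "emeasure (chart_measure (b1, V1, h1, G1)) U = emeasure (chart_measure (b2, V2, h2, G2)) U"
proof -
  define \<phi> where "\<phi> k z = min 1 (max 0 (real k * infdist z (- U) - 1))" for k z
  have ne: "- U \<noteq> {}" using U(2) not_bounded_UNIV by (metis Compl_empty_eq double_compl)
  have cont: "continuous_on UNIV (\<phi> k)" for k unfolding \<phi>_def by (intro continuous_intros)
  have meas[measurable]: "\<phi> k \<in> borel_measurable borel" for k using cont by (rule borel_measurable_continuous_onI)
  have mono: "incseq (\<lambda>k z. ennreal (\<phi> k z))"
    unfolding incseq_def le_fun_def \<phi>_def
    by (intro allI impI ennreal_leI min.mono max.mono order_refl diff_right_mono mult_right_mono)
       (auto simp: infdist_nonneg)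
  have sup: "(SUP k. ennreal (\<phi> k z)) = indicator U z" for z
  proof (cases "z \<in> U")
    case True
    have "infdist z (- U) > 0" using True U(1) ne by (intro infdist_pos_not_in_closed) auto
    then obtain k where "real k * infdist z (- U) > 2" using reals_Archimedean3 by blast
    then have "\<phi> k z = 1" by (simp add: \<phi>_def)
    then have "1 \<le> (SUP k. ennreal (\<phi> k z))" by (metis SUP_upper UNIV_I ennreal_1)
    moreover have "(SUP k. ennreal (\<phi> k z)) \<le> 1"
      by (intro SUP_least) (simp add: \<phi>_def ennreal_le_1)
    ultimately show ?thesis using True by simp
  next
    case False
    then have "infdist z (- U) = 0" by simp
    then show ?thesis using False by (simp add: \<phi>_def)
  qed
  have "(\<integral>\<^sup>+ z. indicator U z \<partial>chart_measure c) = (SUP k. \<integral>\<^sup>+ z. ennreal (\<phi> k z) \<partial>chart_measure c)" for c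
    unfolding sup[symmetric] by (rule nn_integral_monotone_convergence_SUP[OF mono]) measurable
  moreover have "(\<integral>\<^sup>+ z. ennreal (\<phi> k z) \<partial>chart_measure (b1, V1, h1, G1)) = (\<integral>\<^sup>+ z. ennreal (\<phi> k z) \<partial>chart_measure (b2, V2, h2, G2))" for k
  proof (cases "k = 0")
    case False
    define K where "K = {z. infdist z (- U) \<ge> 1 / real k}"
    have "K \<subseteq> U"
    proof
      fix z assume "z \<in> K"
      then have "1 / real k \<le> infdist z (- U)" by (simp add: K_def)
      moreover have "0 < 1 / real k" using False by simp
      ultimately have "infdist z (- U) \<noteq> 0" by linarith
      then show "z \<in> U" using infdist_zero[of z "- U"] by (cases "z \<in> U") auto
    qed
    moreover have "closed K" unfolding K_def by (intro closed_Collect_le continuous_intros)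
    ultimately have "compact K" using bounded_subset[OF U(2)] by (simp add: compact_eq_bounded_closed)
    show ?thesis
    proof (rule chart_measure_unique_continuous[OF c1 c2 cont, where K=K])
      show "compact K" by fact
      show "K \<subseteq> V1 \<inter> V2" using \<open>K \<subseteq> U\<close> U(3) by auto
      show "z \<in> K" if "\<phi> k z \<noteq> 0" for z
        using that False by (auto simp: \<phi>_def K_def field_simps max_def min_def split: if_splits)
    qed (simp add: \<phi>_def)
  qed (simp add: \<phi>_def)
  ultimately have "(\<integral>\<^sup>+ z. indicator U z \<partial>chart_measure (b1, V1, h1, G1)) = (\<integral>\<^sup>+ z. indicator U z \<partial>chart_measure (b2, V2, h2, G2))"
    by simp
  then show ?thesis using U(1) by simp
qed

lemma chart_measure_unique:
  assumes c1: "graph_chart (frontier D) (b1, V1, h1, G1)" and c2: "graph_chart (frontier D) (b2, V2, h2, G2)"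
    and E[measurable]: "E \<in> sets borel" "E \<subseteq> V1 \<inter> V2" "E \<subseteq> frontier D"
  shows "emeasure (chart_measure (b1, V1, h1, G1)) E = emeasure (chart_measure (b2, V2, h2, G2)) E"
proof -
  let ?M = "chart_measure (b1, V1, h1, G1)" and ?N = "chart_measure (b2, V2, h2, G2)"
  interpret C1: graph_chart_of "frontier D" b1 V1 h1 G1 using c1 by unfold_locales
  interpret C2: graph_chart_of "frontier D" b2 V2 h2 G2 using c2 by unfold_locales
  have "bounded (frontier D)" using compact_frontier_D by (rule compact_imp_bounded)
  then obtain R where R: "frontier D \<subseteq> ball 0 R" using bounded_subset_ballD by blast
  \<comment> \<open>Exhausting the overlap by sets with compact closure makes the measures finite.\<close>
  define W where "W = V1 \<inter> V2 \<inter> ball 0 R"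
  have W: "open W" "bounded W" unfolding W_def using C1.open_V C2.open_V by (auto intro: bounded_subset[OF bounded_ball])
  have ne: "- W \<noteq> {}" using W(2) not_bounded_UNIV by (metis Compl_empty_eq double_compl)
  define U where "U k = {z. infdist z (- W) > inverse (real (Suc k))}" for k
  define K where "K k = {z. infdist z (- W) \<ge> inverse (real (Suc k))}" for k
  have oU: "open (U k)" for k unfolding U_def by (intro open_Collect_less continuous_intros)
  then have [measurable]: "U k \<in> sets borel" for k by (rule borel_open)
  have KW: "K k \<subseteq> W" for k
  proof
    fix z assume "z \<in> K k"
    then have "inverse (real (Suc k)) \<le> infdist z (- W)" by (simp add: K_def del: of_nat_Suc)
    moreover have "0 < inverse (real (Suc k))" by simp
    ultimately have "infdist z (- W) \<noteq> 0" by linarith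
    then show "z \<in> W" using infdist_zero[of z "- W"] by (cases "z \<in> W") auto
  qed
  have UK: "U k \<subseteq> K k" for k by (auto simp: U_def K_def)
  have "closed (K k)" for k unfolding K_def by (intro closed_Collect_le continuous_intros)
  then have cK: "compact (K k)" for k using bounded_subset[OF W(2) KW] by (simp add: compact_eq_bounded_closed)
  have fin: "emeasure ?M (U k) < \<infinity>" for k
  proof -
    have "emeasure ?M (U k) \<le> emeasure ?M (K k)" using UK cK by (intro emeasure_mono) (auto simp: borel_compact)
    also have "\<dots> < \<infinity>" using KW[of k] cK by (intro C1.emeasure_chart_compact_finite) (auto simp: W_def)
    finally show ?thesis .
  qed
  have eq: "density ?M (indicator (U k)) = density ?N (indicator (U k))" for k
  proof (rule measure_eqI_generator_eq[where E="{S. open S}" and \<Omega>=UNIV and A="\<lambda>_. UNIV"])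
    show "Int_stable {S. open S}" by (auto simp: Int_stable_def)
    show "emeasure (density ?M (indicator (U k))) X = emeasure (density ?N (indicator (U k))) X" if "X \<in> {S. open S}" for X
    proof -
      have [measurable]: "X \<in> sets borel" using that by (auto intro: borel_open)
      have "emeasure ?M (U k \<inter> X) = emeasure ?N (U k \<inter> X)"
      proof (rule chart_measure_unique_open[OF c1 c2])
        have "U k \<inter> X \<subseteq> W" using UK[of k] KW[of k] by auto
        then show "U k \<inter> X \<subseteq> V1 \<inter> V2" "bounded (U k \<inter> X)"
          using bounded_subset[OF W(2)] by (auto simp: W_def)
      qed (use oU that in auto)
      then show ?thesis by (simp add: emeasure_restricted)
    qed
    show "emeasure (density ?M (indicator (U k))) ((\<lambda>_. UNIV) i) \<noteq> \<infinity>" for i :: nat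
      using fin[of k] by (simp add: emeasure_restricted)
  qed (auto simp: borel_def)
  have EU: "emeasure ?M (U k \<inter> E) = emeasure ?N (U k \<inter> E)" for k
    using arg_cong[OF eq[of k], of "\<lambda>M. emeasure M E"] by (simp add: emeasure_restricted)
  have inc: "incseq (\<lambda>k. U k \<inter> E)"
    unfolding incseq_def U_def by (auto intro: le_less_trans[rotated] le_imp_inverse_le simp del: of_nat_Suc)
  have UN: "(\<Union>k. U k \<inter> E) = E"
  proof (intro equalityI subsetI)
    fix z assume z: "z \<in> E"
    then have "z \<in> W" using E(2,3) R by (auto simp: W_def)
    then have "infdist z (- W) > 0" using W(1) ne by (intro infdist_pos_not_in_closed) auto
    then obtain k where "inverse (real (Suc k)) < infdist z (- W)" using reals_Archimedean by blast
    then show "z \<in> (\<Union>k. U k \<inter> E)" using z by (auto simp: U_def)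
  qed auto
  have "emeasure M E = (SUP k. emeasure M (U k \<inter> E))" if "sets M = sets borel" for M
    using SUP_emeasure_incseq[of "\<lambda>k. U k \<inter> E" M] inc UN that by (simp add: image_subset_iff)
  then show ?thesis using EU by simp
qed

abbreviation area :: "'a measure" where "area \<equiv> surface_measure (frontier D)"

lemma sets_area: "E \<in> sets area \<longleftrightarrow> E \<in> sets borel \<and> E \<subseteq> frontier D"
  by (auto simp: sets_restrict_space_iff)

lemma chart_measure_overlap:
  assumes "graph_chart (frontier D) c1" "graph_chart (frontier D) c2"
    and "E \<in> sets borel" "E \<subseteq> chart_dom c1 \<inter> chart_dom c2" "E \<subseteq> frontier D"
  shows "emeasure (chart_measure c1) E = emeasure (chart_measure c2) E"
  using assms by (cases c1; cases c2) (auto intro!: chart_measure_unique)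

lemma chart_area_eq:
  assumes "graph_chart (frontier D) c" "E \<in> sets borel"
  shows "chart_area c E = emeasure (chart_measure c) E"
proof -
  obtain b V h Gh where c: "c = (b, V, h, Gh)" by (cases c)
  interpret graph_chart_of "frontier D" b V h Gh using assms c by unfold_locales auto
  show ?thesis using emeasure_chart_measure[OF assms(2)] c by simp
qed

text \<open>Since overlapping charts agree, the area of a set inside the domain of one chart is the area seen
  by that chart, whichever atlas the surface measure was built from.\<close>

lemma emeasure_area_chart:
  assumes c: "graph_chart (frontier D) c" and E: "E \<in> sets borel" "E \<subseteq> frontier D" "E \<subseteq> chart_dom c"
  shows "emeasure area E = emeasure (chart_measure c) E"
proof -
  define a where "a = (SOME c. graph_atlas (frontier D) c)"
  have "graph_atlas (frontier D) a" unfolding a_def using graph_atlas_exists by (rule someI_ex)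
  then have a: "\<And>i. graph_chart (frontier D) (a i)" "frontier D \<subseteq> (\<Union>i. chart_dom (a i))"
    by (auto simp: graph_atlas_def)
  define A where "A i = chart_dom (a i) - (\<Union>j<i. chart_dom (a j))" for i
  have [measurable]: "chart_dom (a i) \<in> sets borel" for i
    using graph_chart_open[OF a(1)] by (rule borel_open)
  have A[measurable]: "A i \<in> sets borel" for i unfolding A_def by measurable
  have A_eq: "A = disjointed (\<lambda>i. chart_dom (a i))"
    by (simp add: fun_eq_iff A_def disjointed_def atLeast0LessThan)
  have dis: "disjoint_family A"
    using disjoint_family_disjointed[of "\<lambda>i. chart_dom (a i)"] unfolding A_eq .
  have UA: "(\<Union>i. A i) = (\<Union>i. chart_dom (a i))"
    unfolding A_eq by (rule UN_disjointed_eq)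
  define \<mu> where "\<mu> E = (\<Sum>i. chart_area (a i) (E \<inter> chart_dom (a i) - (\<Union>j<i. chart_dom (a j))))" for E
  have \<mu>: "\<mu> E = (\<Sum>i. emeasure (chart_measure (a i)) (E \<inter> A i))" if [measurable]: "E \<in> sets borel" for E
    unfolding \<mu>_def by (intro suminf_cong) (simp add: A_def Int_Diff chart_area_eq[OF a(1)])
  have area: "area = measure_of (frontier D) (sets (restrict_space borel (frontier D))) \<mu>"
    by (simp add: surface_measure_def Let_def a_def \<mu>_def[abs_def])
  have "emeasure area E = \<mu> E"
  proof (rule emeasure_measure_of[OF area])
    show "sets (restrict_space borel (frontier D)) \<subseteq> Pow (frontier D)"
      using sets.space_closed[of "restrict_space borel (frontier D)"] by (simp add: space_restrict_space)
    show "E \<in> sets area" using E unfolding sets_area by blast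
    have \<mu>0: "\<mu> {} = 0" by (simp add: \<mu>)
    then show "positive (sets area) \<mu>" by (simp add: positive_def)
    show "countably_additive (sets area) \<mu>"
      unfolding countably_additive_def
    proof (intro allI impI)
      fix F :: "nat \<Rightarrow> 'a set" assume F: "range F \<subseteq> sets area" "disjoint_family F"
      have F'[measurable]: "F k \<in> sets borel" for k using F(1) sets_area by blast
      have "(\<Sum>k. \<mu> (F k)) = (\<Sum>k. \<integral>\<^sup>+ i. emeasure (chart_measure (a i)) (F k \<inter> A i) \<partial>count_space UNIV)"
        by (simp add: \<mu> nn_integral_count_space_nat)
      also have "\<dots> = (\<integral>\<^sup>+ i. (\<Sum>k. emeasure (chart_measure (a i)) (F k \<inter> A i)) \<partial>count_space UNIV)"
        by (rule nn_integral_suminf[symmetric]) simp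
      also have "\<dots> = (\<integral>\<^sup>+ i. emeasure (chart_measure (a i)) (\<Union>k. F k \<inter> A i) \<partial>count_space UNIV)"
        using F(2) by (intro nn_integral_cong suminf_emeasure) (auto simp: disjoint_family_on_def)
      also have "\<dots> = \<mu> (\<Union> (range F))"
        by (simp add: \<mu> nn_integral_count_space_nat UN_simps[symmetric] del: UN_simps)
      finally show "(\<Sum>k. \<mu> (F k)) = \<mu> (\<Union> (range F))" .
    qed
  qed
  also have "\<mu> E = (\<Sum>i. emeasure (chart_measure c) (E \<inter> A i))"
    unfolding \<mu>[OF E(1)]
  proof (rule suminf_cong)
    fix i
    show "emeasure (chart_measure (a i)) (E \<inter> A i) = emeasure (chart_measure c) (E \<inter> A i)"
    proof (rule chart_measure_overlap[OF a(1) c])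
      show "E \<inter> A i \<in> sets borel" using E(1) A by (rule sets.Int)
      show "E \<inter> A i \<subseteq> chart_dom (a i) \<inter> chart_dom c" using E(3) unfolding A_def by blast
      show "E \<inter> A i \<subseteq> frontier D" using E(2) by blast
    qed
  qed
  also have "\<dots> = emeasure (chart_measure c) (\<Union>i. E \<inter> A i)"
    using dis E(1) by (intro suminf_emeasure) (auto simp: disjoint_family_on_def)
  also have "(\<Union>i. E \<inter> A i) = E"
  proof -
    have "E \<subseteq> (\<Union>i. A i)" unfolding UA using E(2) a(2) by (rule subset_trans)
    then show ?thesis by blast
  qed
  finally show ?thesis .
qed

lemma nn_integral_area_chart:
  assumes c: "graph_chart (frontier D) (b, V, h, Gh)"
    and F[measurable]: "F \<in> borel_measurable borel" and out: "\<And>z. z \<notin> V \<Longrightarrow> F z = 0"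
  shows "(\<integral>\<^sup>+ z. F z \<partial>area) = (\<integral>\<^sup>+ z. F z \<partial>chart_measure (b, V, h, Gh))"
proof -
  interpret graph_chart_of "frontier D" b V h Gh using c by unfold_locales
  have [measurable]: "V \<in> sets borel" using open_V by (rule borel_open)
  have id[measurable]: "(\<lambda>z. z) \<in> measurable area borel"
    by (simp add: measurable_cong_sets[OF sets_surface_measure refl] measurable_restrict_space1)
  define \<sigma> where "\<sigma> = distr area borel (\<lambda>z. z)"
  have [simp, measurable_cong]: "sets \<sigma> = sets borel" by (simp add: \<sigma>_def)
  have eq: "density \<sigma> (indicator V) = density (chart_measure (b, V, h, Gh)) (indicator V)"
  proof (rule measure_eqI)
    fix X assume "X \<in> sets (density \<sigma> (indicator V))"
    then have [measurable]: "X \<in> sets borel" by simp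
    have "emeasure \<sigma> (V \<inter> X) = emeasure area (V \<inter> X \<inter> frontier D)"
      unfolding \<sigma>_def by (subst emeasure_distr) (auto simp: vimage_def Int_commute)
    also have "\<dots> = emeasure (chart_measure (b, V, h, Gh)) (V \<inter> X \<inter> frontier D)"
      by (intro emeasure_area_chart[OF c]) auto
    also have "V \<inter> X \<inter> frontier D = (V \<inter> X) \<inter> (frontier D \<inter> V)" by auto
    also have "emeasure (chart_measure (b, V, h, Gh)) \<dots> = emeasure (chart_measure (b, V, h, Gh)) (V \<inter> X)"
      by (rule chart_measure_Int_V) measurable
    finally show "emeasure (density \<sigma> (indicator V)) X = emeasure (density (chart_measure (b, V, h, Gh)) (indicator V)) X"
      by (simp add: emeasure_restricted)
  qed simp
  have cut: "(\<integral>\<^sup>+ z. F z \<partial>N) = (\<integral>\<^sup>+ z. F z \<partial>density N (indicator V))" if N: "sets N = sets borel" for N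
  proof -
    have "F \<in> borel_measurable N" "indicator V \<in> borel_measurable N"
      unfolding measurable_cong_sets[OF N refl] by (rule F, simp)
    then have "(\<integral>\<^sup>+ z. F z \<partial>density N (indicator V)) = (\<integral>\<^sup>+ z. indicator V z * F z \<partial>N)"
      by (intro nn_integral_density) auto
    also have "\<dots> = (\<integral>\<^sup>+ z. F z \<partial>N)" using out by (intro nn_integral_cong) (auto simp: indicator_def)
    finally show ?thesis ..
  qed
  have "(\<integral>\<^sup>+ z. F z \<partial>\<sigma>) = (\<integral>\<^sup>+ z. F z \<partial>density \<sigma> (indicator V))" by (rule cut) simp
  also have "\<dots> = (\<integral>\<^sup>+ z. F z \<partial>chart_measure (b, V, h, Gh))" unfolding eq by (rule cut[symmetric]) simp
  finally have "(\<integral>\<^sup>+ z. F z \<partial>\<sigma>) = (\<integral>\<^sup>+ z. F z \<partial>chart_measure (b, V, h, Gh))" .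
  moreover have "(\<integral>\<^sup>+ z. F z \<partial>\<sigma>) = (\<integral>\<^sup>+ z. F z \<partial>area)"
    unfolding \<sigma>_def by (rule nn_integral_distr[OF id]) (simp add: F)
  ultimately show ?thesis by simp
qed

text \<open>The volume of a boundary layer is, to first order, the surface integral of its thickness. A
  partition of unity localises the layer in charts.\<close>

theorem layer_limit:
  assumes layer: "boundary_layer \<delta> u L" and ne: "frontier D \<noteq> {}"
  shows "(\<lambda>n. (\<integral>\<^sup>+ z. ennreal (u n z) \<partial>lborel) / ennreal (\<delta> n))
    \<longlonglongrightarrow> (\<integral>\<^sup>+ z. ennreal (L z / norm (G z)) \<partial>area)"
proof -
  have \<delta>: "\<And>n. \<delta> n > 0" "\<delta> \<longlonglongrightarrow> 0" and u[measurable]: "\<And>n. u n \<in> borel_measurable borel"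
    and u01: "\<And>n z. 0 \<le> u n z" "\<And>n z. u n z \<le> 1"
    and L[measurable]: "L \<in> borel_measurable borel" and L0: "\<And>p. 0 \<le> L p"
    using layer unfolding boundary_layer_def by auto
  obtain C where C: "C \<ge> 0"
    "\<forall>\<^sub>F n in sequentially. \<forall>z. u n z \<noteq> 0 \<longrightarrow> (\<exists>y\<in>frontier D. dist z y \<le> C * \<delta> n)"
    using layer unfolding boundary_layer_def by auto
  have [measurable]: "G \<in> borel_measurable borel" using contG by (rule borel_measurable_continuous_onI)
  have areaM: "f \<in> borel_measurable area" if "f \<in> borel_measurable borel" for f :: "'a \<Rightarrow> ennreal"
    using that by (simp add: measurable_cong_sets[OF sets_surface_measure refl] measurable_restrict_space1)
  have "\<exists>c r. graph_chart (frontier D) c \<and> r > 0 \<and> cball p r \<subseteq> chart_dom c" if "p \<in> frontier D" for p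
    using chart_at_boundary_point[OF that] graph_chart_open open_contains_cball by metis
  then obtain c r where c: "\<And>p. p \<in> frontier D \<Longrightarrow> graph_chart (frontier D) (c p)"
    and r: "\<And>p. p \<in> frontier D \<Longrightarrow> r p > (0::real)"
    and cr: "\<And>p. p \<in> frontier D \<Longrightarrow> cball p (r p) \<subseteq> chart_dom (c p)" by metis
  have "frontier D \<subseteq> (\<Union>p\<in>frontier D. ball p (r p))" using r by force
  then obtain F where F: "F \<subseteq> frontier D" "finite F" "frontier D \<subseteq> (\<Union>p\<in>F. ball p (r p))"
    using compactE_image[OF compact_frontier_D, of "frontier D" "\<lambda>p. ball p (r p)"] by auto
  define \<psi> where "\<psi> p z = max 0 (r p - dist z p)" for p z
  define T where "T z = (\<Sum>p\<in>F. \<psi> p z)" for z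
  have cont_\<psi>: "continuous_on UNIV (\<psi> p)" for p unfolding \<psi>_def by (intro continuous_intros)
  have cont_T: "continuous_on UNIV T" unfolding T_def by (intro continuous_intros cont_\<psi>)
  have "continuous_on (frontier D) T" using cont_T by (rule continuous_on_subset) auto
  from continuous_attains_inf[OF compact_frontier_D ne this]
  obtain y0 where y0: "y0 \<in> frontier D" "\<And>y. y \<in> frontier D \<Longrightarrow> T y0 \<le> T y" by auto
  define \<epsilon> where "\<epsilon> = T y0 / 2"
  have "T y0 > 0"
  proof -
    obtain p where "p \<in> F" "dist y0 p < r p" using F(3) y0(1) by (auto simp: dist_commute)
    then show ?thesis unfolding T_def using F(2) by (intro sum_pos2[of F p]) (auto simp: \<psi>_def)
  qed
  then have \<epsilon>: "\<epsilon> > 0" "\<And>y. y \<in> frontier D \<Longrightarrow> 2 * \<epsilon> \<le> T y" using y0(2) by (auto simp: \<epsilon>_def)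
  \<comment> \<open>The maximum keeps the quotient continuous where \<open>T\<close> vanishes and changes nothing near the boundary.\<close>
  define \<phi> where "\<phi> p z = \<psi> p z / max (T z) \<epsilon>" for p z
  have \<phi>: "continuous_on UNIV (\<phi> p)" "\<And>z. 0 \<le> \<phi> p z" "compact (cball p (r p))"
      "\<And>z. \<phi> p z \<noteq> 0 \<Longrightarrow> z \<in> cball p (r p)" for p
  proof -
    show "continuous_on UNIV (\<phi> p)" unfolding \<phi>_def using \<epsilon>(1)
      by (intro continuous_on_divide continuous_on_max cont_\<psi> cont_T continuous_on_const) (auto simp: max_def)
    show "0 \<le> \<phi> p z" for z
      unfolding \<phi>_def using \<epsilon>(1) by (intro divide_nonneg_nonneg) (auto simp: \<psi>_def max_def)
    show "z \<in> cball p (r p)" if "\<phi> p z \<noteq> 0" for z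
      using that by (auto simp: \<phi>_def \<psi>_def max_def dist_commute split: if_splits)
  qed (rule compact_cball)
  have [measurable]: "\<phi> p \<in> borel_measurable borel" for p using \<phi>(1) by (rule borel_measurable_continuous_onI)
  have one: "(\<Sum>p\<in>F. \<phi> p z) = 1" if "\<epsilon> \<le> T z" for z
    using that \<epsilon>(1) by (simp add: \<phi>_def sum_divide_distrib[symmetric] T_def[symmetric] max_def)
  have lip: "\<bar>T z - T y\<bar> \<le> card F * dist z y" for z y
  proof -
    have "\<bar>T z - T y\<bar> \<le> (\<Sum>p\<in>F. \<bar>\<psi> p z - \<psi> p y\<bar>)"
      unfolding T_def sum_subtractf[symmetric] by (rule sum_abs)
    also have "\<dots> \<le> (\<Sum>p\<in>F. dist z y)"
    proof (rule sum_mono)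
      fix p
      have "\<bar>max 0 s - max 0 t\<bar> \<le> \<bar>s - t\<bar>" for s t :: real by (simp add: max_def)
      then have "\<bar>\<psi> p z - \<psi> p y\<bar> \<le> \<bar>(r p - dist z p) - (r p - dist y p)\<bar>" unfolding \<psi>_def .
      also have "\<dots> \<le> dist z y"
        using dist_triangle[of z p y] dist_triangle[of y p z] dist_commute[of y z] by linarith
      finally show "\<bar>\<psi> p z - \<psi> p y\<bar> \<le> dist z y" .
    qed
    finally show ?thesis by simp
  qed
  have "(\<lambda>n. card F * (C * \<delta> n)) \<longlonglongrightarrow> card F * (C * 0)" by (intro tendsto_intros \<delta>)
  then have "\<forall>\<^sub>F n in sequentially. card F * (C * \<delta> n) < \<epsilon>" using \<epsilon>(1) by (intro order_tendstoD(2)) auto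
  with C(2) have "\<forall>\<^sub>F n in sequentially. \<forall>z. ennreal (u n z) = (\<Sum>p\<in>F. ennreal (u n z * \<phi> p z))"
  proof eventually_elim
    case (elim n)
    show ?case
    proof
      fix z
      show "ennreal (u n z) = (\<Sum>p\<in>F. ennreal (u n z * \<phi> p z))"
      proof (cases "u n z = 0")
        case False
        then obtain y where y: "y \<in> frontier D" "dist z y \<le> C * \<delta> n" using elim(1) by auto
        have "card F * dist z y \<le> card F * (C * \<delta> n)" using y(2) by (intro mult_left_mono) auto
        then have "\<epsilon> \<le> T z" using lip[of z y] \<epsilon>(2)[OF y(1)] elim(2) by linarith
        from one[OF this] have "u n z = (\<Sum>p\<in>F. u n z * \<phi> p z)" by (simp add: sum_distrib_left[symmetric])
        then show ?thesis using u01 \<phi>(2) by (subst sum_ennreal) auto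
      qed simp
    qed
  qed
  then have ev: "\<forall>\<^sub>F n in sequentially. (\<Sum>p\<in>F. (\<integral>\<^sup>+ z. ennreal (u n z * \<phi> p z) \<partial>lborel) / ennreal (\<delta> n))
      = (\<integral>\<^sup>+ z. ennreal (u n z) \<partial>lborel) / ennreal (\<delta> n)"
  proof eventually_elim
    case (elim n)
    have "(\<integral>\<^sup>+ z. ennreal (u n z) \<partial>lborel) = (\<integral>\<^sup>+ z. (\<Sum>p\<in>F. ennreal (u n z * \<phi> p z)) \<partial>lborel)"
      using elim by (intro nn_integral_cong) auto
    also have "\<dots> = (\<Sum>p\<in>F. \<integral>\<^sup>+ z. ennreal (u n z * \<phi> p z) \<partial>lborel)"
      by (rule nn_integral_sum) measurable
    finally show ?case by (simp add: divide_ennreal_def sum_distrib_right)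
  qed
  have "(\<lambda>n. \<Sum>p\<in>F. (\<integral>\<^sup>+ z. ennreal (u n z * \<phi> p z) \<partial>lborel) / ennreal (\<delta> n))
      \<longlonglongrightarrow> (\<Sum>p\<in>F. \<integral>\<^sup>+ z. ennreal (\<phi> p z * L z / norm (G z)) \<partial>area)"
  proof (rule tendsto_sum)
    fix p assume "p \<in> F"
    then have p: "p \<in> frontier D" using F(1) by auto
    obtain b V h Gh where cp: "c p = (b, V, h, Gh)" by (cases "c p")
    have ch: "graph_chart (frontier D) (b, V, h, Gh)" and sub: "cball p (r p) \<subseteq> V" using c[OF p] cr[OF p] cp by auto
    have "(\<integral>\<^sup>+ z. ennreal (\<phi> p z * L z / norm (G z)) \<partial>area)
        = (\<integral>\<^sup>+ z. ennreal (\<phi> p z * L z / norm (G z)) \<partial>chart_measure (b, V, h, Gh))"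
    proof (rule nn_integral_area_chart[OF ch])
      fix z assume "z \<notin> V"
      then have "\<phi> p z = 0" using \<phi>(4)[of p z] sub by blast
      then show "ennreal (\<phi> p z * L z / norm (G z)) = 0" by simp
    qed measurable
    then show "(\<lambda>n. (\<integral>\<^sup>+ z. ennreal (u n z * \<phi> p z) \<partial>lborel) / ennreal (\<delta> n))
      \<longlonglongrightarrow> (\<integral>\<^sup>+ z. ennreal (\<phi> p z * L z / norm (G z)) \<partial>area)"
      using layer_limit_chart[OF layer ch \<phi>(1,2,3) sub \<phi>(4)] by simp
  qed
  from Lim_transform_eventually[OF this ev]
  have "(\<lambda>n. (\<integral>\<^sup>+ z. ennreal (u n z) \<partial>lborel) / ennreal (\<delta> n))
      \<longlonglongrightarrow> (\<Sum>p\<in>F. \<integral>\<^sup>+ z. ennreal (\<phi> p z * L z / norm (G z)) \<partial>area)" .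
  moreover have "(\<Sum>p\<in>F. \<integral>\<^sup>+ z. ennreal (\<phi> p z * L z / norm (G z)) \<partial>area) = (\<integral>\<^sup>+ z. ennreal (L z / norm (G z)) \<partial>area)"
  proof -
    have "(\<Sum>p\<in>F. \<integral>\<^sup>+ z. ennreal (\<phi> p z * L z / norm (G z)) \<partial>area)
        = (\<integral>\<^sup>+ z. (\<Sum>p\<in>F. ennreal (\<phi> p z * L z / norm (G z))) \<partial>area)"
      by (rule nn_integral_sum[symmetric], rule areaM) measurable
    also have "\<dots> = (\<integral>\<^sup>+ z. ennreal (L z / norm (G z)) \<partial>area)"
    proof (rule nn_integral_cong)
      fix z assume "z \<in> space area"
      then have "\<epsilon> \<le> T z" using \<epsilon>(1) \<epsilon>(2)[of z] by simp
      have "(\<Sum>p\<in>F. ennreal (\<phi> p z * L z / norm (G z))) = ennreal (\<Sum>p\<in>F. \<phi> p z * L z / norm (G z))"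
        using \<phi>(2) L0 by (intro sum_ennreal) auto
      also have "(\<Sum>p\<in>F. \<phi> p z * L z / norm (G z)) = (\<Sum>p\<in>F. \<phi> p z) * (L z / norm (G z))"
        by (simp add: sum_distrib_right sum_divide_distrib)
      finally show "(\<Sum>p\<in>F. ennreal (\<phi> p z * L z / norm (G z))) = ennreal (L z / norm (G z))"
        using one[OF \<open>\<epsilon> \<le> T z\<close>] by simp
    qed
    finally show ?thesis .
  qed
  ultimately show ?thesis by (simp only:)
qed

end

section \<open>Complex tangent hyperplanes\<close>

subsection \<open>Real and complex derivatives\<close>

text \<open>The Hermitian pairing with a real gradient. For \<open>g\<close> the gradient of \<open>\<rho>\<close> at \<open>w\<close> it is twice the
  bilinear pairing with \<open>\<partial>\<rho>(w)\<close>, so its kernel is the complex tangent space.\<close>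

definition hform :: "complex ^ 'd \<Rightarrow> complex ^ 'd \<Rightarrow> complex" where
  "hform g u = (\<Sum>j\<in>UNIV. cnj (g $ j) * u $ j)"

lemma hform_add: "hform g (u + v) = hform g u + hform g v"
  and hform_minus: "hform g (- u) = - hform g u"
  and hform_scale: "hform g (c *s u) = c * hform g u"
  and hform_diff_left: "hform (g - g') u = hform g u - hform g' u"
  by (auto simp: hform_def sum.distrib sum_subtractf sum_negf sum_distrib_left algebra_simps)

lemma hform_scaleR: "hform g (r *\<^sub>R u) = of_real r * hform g u"
  by (simp add: hform_def scaleR_conv_of_real[symmetric] scaleR_sum_right)

lemma hform_scale_left: "hform (c *s g) u = cnj c * hform g u"
  by (simp add: hform_def sum_distrib_left algebra_simps)

lemma Re_hform: "Re (hform g u) = g \<bullet> u"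
  by (simp add: hform_def inner_vec_def inner_complex_def)

lemma Im_hform: "Im (hform g u) = (\<i> *s g) \<bullet> u"
  unfolding Re_hform[symmetric] hform_scale_left by simp

lemma hform_self: "hform g g = of_real ((norm g)\<^sup>2)"
proof (rule complex_eqI)
  show "Re (hform g g) = Re (of_real ((norm g)\<^sup>2))" by (simp add: Re_hform dot_square_norm)
  show "Im (hform g g) = Im (of_real ((norm g)\<^sup>2))" by (simp add: hform_def mult.commute)
qed

lemma norm_complex_scale: "norm (c *s (u :: complex ^ 'd)) = cmod c * norm u"
  unfolding norm_vec_def L2_set_right_distrib[OF norm_ge_zero] by (simp add: norm_mult)

lemma norm_hform_le: "cmod (hform g u) \<le> norm g * norm u"
proof (cases "hform g u = 0")
  case False
  define c where "c = cnj (hform g u) / cmod (hform g u)"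
  have "cmod c = 1" using False by (simp add: c_def norm_divide)
  have "c * hform g u = of_real (cmod (hform g u))"
  proof -
    have "c * hform g u = (hform g u * cnj (hform g u)) / of_real (cmod (hform g u))"
      by (simp add: c_def mult.commute)
    also have "\<dots> = of_real (cmod (hform g u))"
      unfolding complex_norm_square[symmetric] using False by (simp add: power2_eq_square)
    finally show ?thesis .
  qed
  then have "cmod (hform g u) = Re (hform g (c *s u))" by (simp add: hform_scale)
  also have "\<dots> \<le> norm g * norm (c *s u)" unfolding Re_hform by (rule norm_cauchy_schwarz)
  finally show ?thesis using \<open>cmod c = 1\<close> by (simp add: norm_complex_scale)
qed simp

lemma scaleR_complex_scale: "s *\<^sub>R (c *s u) = (of_real s * c) *s (u :: complex ^ 'd)"
proof -
  have "(s *\<^sub>R (c *s u)) $ i = ((of_real s * c) *s u) $ i" for i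
    unfolding vector_scaleR_component vector_smult_component by (simp add: scaleR_conv_of_real)
  then show ?thesis unfolding vec_eq_iff by blast
qed

lemma continuous_on_hform [continuous_intros]:
  "continuous_on A f \<Longrightarrow> continuous_on A g \<Longrightarrow> continuous_on A (\<lambda>x. hform (f x) (g x))"
  unfolding hform_def by (intro continuous_intros)

lemma continuous_on_vec_scale [continuous_intros]:
  "continuous_on A f \<Longrightarrow> continuous_on A g \<Longrightarrow> continuous_on A (\<lambda>x. f x *s (g x :: complex ^ 'd))"
  unfolding vector_scalar_mult_def by (intro continuous_intros)

lemma dir_deriv_eq:
  assumes "(F has_derivative F') (at z)"
  shows "dir_deriv F e z = F' e"
proof -
  have "((\<lambda>t. F (z + t *\<^sub>R e)) has_derivative (\<lambda>t. F' (t *\<^sub>R e))) (at 0)"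
    by (rule has_derivative_compose[where f="\<lambda>t. z + t *\<^sub>R e"])
       (auto intro!: derivative_eq_intros simp: assms)
  then have "((\<lambda>t. F (z + t *\<^sub>R e)) has_vector_derivative F' e) (at 0)"
    using has_derivative_bounded_linear[OF assms]
    by (simp add: has_vector_derivative_def linear_simps bounded_linear.linear linear_cmul)
  then show ?thesis unfolding dir_deriv_def by (rule vector_derivative_at)
qed

lemma complex_axis_expansion:
  "v = (\<Sum>j\<in>UNIV. Re (v $ j) *\<^sub>R axis j 1 + Im (v $ j) *\<^sub>R axis j \<i>)"
proof -
  have "v $ k = (\<Sum>j\<in>UNIV. Re (v $ j) *\<^sub>R axis j 1 + Im (v $ j) *\<^sub>R axis j \<i>) $ k" for k
  proof -
    have "(\<Sum>j\<in>UNIV. Re (v $ j) *\<^sub>R axis j 1 + Im (v $ j) *\<^sub>R axis j \<i>) $ k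
        = (\<Sum>j\<in>UNIV. if j = k then v $ k else 0)"
      unfolding sum_component by (intro sum.cong) (auto simp: axis_def complex_eq_iff)
    then show ?thesis by simp
  qed
  then show ?thesis unfolding vec_eq_iff by blast
qed

context
  fixes \<rho> :: "complex ^ 'd \<Rightarrow> real" and G :: "complex ^ 'd \<Rightarrow> complex ^ 'd"
    and H :: "complex ^ 'd \<Rightarrow> (complex ^ 'd) \<Rightarrow>\<^sub>L (complex ^ 'd)"
  assumes G: "\<And>x. GDERIV \<rho> x :> G x"
    and H: "\<And>x. (G has_derivative blinfun_apply (H x)) (at x)"
begin

lemma of_real_rho_deriv: "((\<lambda>u. complex_of_real (\<rho> u)) has_derivative (\<lambda>v. complex_of_real (v \<bullet> G z))) (at z)"
  using G[of z] unfolding gderiv_def by (rule has_derivative_of_real)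

lemma wirtinger_rho: "wirtinger j (\<lambda>u. of_real (\<rho> u)) = (\<lambda>z. cnj (G z $ j) / 2)"
  and wirtinger_bar_rho: "wirtinger_bar j (\<lambda>u. of_real (\<rho> u)) = (\<lambda>z. G z $ j / 2)"
  unfolding wirtinger_def wirtinger_bar_def dir_deriv_eq[OF of_real_rho_deriv]
  by (auto simp: fun_eq_iff complex_eq_iff inner_axis' inner_complex_def)

lemma cpair_del_rho: "cpair (del_rho \<rho> w) u = hform (G w) u / 2"
  unfolding cpair_def del_rho_def wirtinger_rho hform_def
  by (simp add: sum_divide_distrib)

lemma norm_del_rho: "norm (del_rho \<rho> w) = norm (G w) / 2"
proof -
  have "(\<Sum>j\<in>UNIV. (norm (cnj (G w $ j) / 2))\<^sup>2) = (\<Sum>j\<in>UNIV. (norm (G w $ j))\<^sup>2) / 4"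
    by (simp add: sum_divide_distrib norm_divide power_divide)
  then have "norm (del_rho \<rho> w) = sqrt ((\<Sum>j\<in>UNIV. (norm (G w $ j))\<^sup>2) / 4)"
    unfolding norm_vec_def L2_set_def del_rho_def wirtinger_rho by simp
  then show ?thesis unfolding norm_vec_def L2_set_def real_sqrt_divide by simp
qed

text \<open>The quadratic form in the definition of strong \<open>\<complex>\<close>-convexity is half the real second derivative of
  \<open>\<rho>\<close>. In both sums the derivatives in the two real directions of a coordinate combine; adding
  them keeps the real parts of the pairings with \<open>v\<close> and cancels the imaginary ones.\<close>

lemma levi_eq_hessian:
  "Re (\<Sum>j\<in>UNIV. \<Sum>k\<in>UNIV. wirtinger j (wirtinger_bar k (\<lambda>u. of_real (\<rho> u))) w * v $ j * cnj (v $ k))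
   + Re (\<Sum>j\<in>UNIV. \<Sum>k\<in>UNIV. wirtinger j (wirtinger k (\<lambda>u. of_real (\<rho> u))) w * v $ j * v $ k)
   = (blinfun_apply (H w) v \<bullet> v) / 2"
proof -
  let ?H = "blinfun_apply (H w)"
  have comp: "((\<lambda>z. G z $ k / 2) has_derivative (\<lambda>u. ?H u $ k / 2)) (at w)" for k
    using bounded_linear.has_derivative[OF bounded_linear_vec_nth H[of w], of k]
    by (auto intro!: derivative_eq_intros)
  have compc: "((\<lambda>z. cnj (G z $ k) / 2) has_derivative (\<lambda>u. cnj (?H u $ k) / 2)) (at w)" for k
    by (rule bounded_linear.has_derivative[OF bounded_linear_divide[of 2]
          bounded_linear.has_derivative[OF bounded_linear_cnj bounded_linear.has_derivative[OF bounded_linear_vec_nth H]]])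
  define A where "A j = hform (?H (axis j 1)) v" for j
  define B where "B j = hform (?H (axis j \<i>)) v" for j
  have 1: "(\<Sum>k\<in>UNIV. wirtinger j (wirtinger_bar k (\<lambda>u. of_real (\<rho> u))) w * v $ j * cnj (v $ k))
      = v $ j * (cnj (A j) - \<i> * cnj (B j)) / 4" for j
    unfolding wirtinger_bar_rho wirtinger_def dir_deriv_eq[OF comp] A_def B_def hform_def
    by (simp add: sum_distrib_left sum_subtractf sum_divide_distrib algebra_simps diff_divide_distrib)
  have 2: "(\<Sum>k\<in>UNIV. wirtinger j (wirtinger k (\<lambda>u. of_real (\<rho> u))) w * v $ j * v $ k)
      = v $ j * (A j - \<i> * B j) / 4" for j
    unfolding wirtinger_rho wirtinger_def dir_deriv_eq[OF compc] A_def B_def hform_def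
    by (simp add: sum_distrib_left sum_subtractf sum_divide_distrib algebra_simps diff_divide_distrib)
  have 3: "Re (v $ j * (cnj (A j) - \<i> * cnj (B j)) / 4) + Re (v $ j * (A j - \<i> * B j) / 4)
      = ((Re (v $ j) *\<^sub>R ?H (axis j 1) + Im (v $ j) *\<^sub>R ?H (axis j \<i>)) \<bullet> v) / 2" for j
  proof -
    have "(Re (v $ j) *\<^sub>R ?H (axis j 1) + Im (v $ j) *\<^sub>R ?H (axis j \<i>)) \<bullet> v
        = Re (v $ j) * Re (A j) + Im (v $ j) * Re (B j)"
      by (simp add: inner_add_left A_def B_def Re_hform)
    then show ?thesis by (simp add: field_simps)
  qed
  have "?H v = (\<Sum>j\<in>UNIV. Re (v $ j) *\<^sub>R ?H (axis j 1) + Im (v $ j) *\<^sub>R ?H (axis j \<i>))"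
    by (subst complex_axis_expansion[of v]) (simp add: blinfun.sum_right blinfun.add_right blinfun.scaleR_right)
  then have "?H v \<bullet> v = (\<Sum>j\<in>UNIV. (Re (v $ j) *\<^sub>R ?H (axis j 1) + Im (v $ j) *\<^sub>R ?H (axis j \<i>)) \<bullet> v)"
    by (simp add: inner_sum_left)
  then show ?thesis
    unfolding 1 2 Re_sum sum.distrib[symmetric] 3 by (simp add: sum_divide_distrib)
qed

end

subsection \<open>Strongly convex boundary points\<close>

text \<open>If \<open>F\<close> is positive wherever \<open>Q\<close> vanishes, a large multiple of \<open>Q\<close> compensates for its negative values:
  counterexamples for growing multiples would accumulate at a zero of \<open>Q\<close> where \<open>F\<close> is not positive.\<close>

lemma compact_penalty:
  fixes F Q :: "'b::metric_space \<Rightarrow> real"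
  assumes K: "compact K" and F: "continuous_on K F" and Q: "continuous_on K Q" "\<And>x. x \<in> K \<Longrightarrow> 0 \<le> Q x"
    and pos: "\<And>x. x \<in> K \<Longrightarrow> Q x = 0 \<Longrightarrow> 0 < F x"
  obtains k :: nat where "k > 0" "\<And>x. x \<in> K \<Longrightarrow> 1 / real k < F x + real k * Q x"
proof -
  have "\<exists>k>0. \<forall>x\<in>K. 1 / real k < F x + real k * Q x"
  proof (rule ccontr)
    assume "\<not> ?thesis"
    then have "\<exists>x. x \<in> K \<and> F x + real (Suc k) * Q x \<le> 1 / real (Suc k)" for k
      by (metis not_le zero_less_Suc)
    then obtain x where x: "\<And>k. x k \<in> K" "\<And>k. F (x k) + real (Suc k) * Q (x k) \<le> 1 / real (Suc k)"
      by metis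
    obtain l r where l: "l \<in> K" "strict_mono r" "(x \<circ> r) \<longlonglongrightarrow> l"
      using K x(1) unfolding compact_def by metis
    have Fl: "(\<lambda>k. F (x (r k))) \<longlonglongrightarrow> F l" and Ql: "(\<lambda>k. Q (x (r k))) \<longlonglongrightarrow> Q l"
      using continuous_on_tendsto_compose[OF F l(3,1)] continuous_on_tendsto_compose[OF Q(1) l(3,1)] x(1)
      by (auto simp: o_def)
    have inv: "(\<lambda>k. 1 / real (Suc (r k))) \<longlonglongrightarrow> 0"
      using LIMSEQ_subseq_LIMSEQ[OF LIMSEQ_inverse_real_of_nat l(2)] by (simp add: o_def inverse_eq_divide)
    have "F l \<le> 0"
    proof (rule LIMSEQ_le[OF Fl inv], intro exI allI impI)
      fix k
      have "0 \<le> real (Suc (r k)) * Q (x (r k))" using Q(2) x(1) by simp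
      then show "F (x (r k)) \<le> 1 / real (Suc (r k))" using x(2)[of "r k"] by linarith
    qed
    moreover have "Q l \<le> 0"
    proof (rule LIMSEQ_le[OF Ql])
      show "(\<lambda>k. (1 / real (Suc (r k)) - F (x (r k))) * (1 / real (Suc (r k)))) \<longlonglongrightarrow> 0"
        using tendsto_mult[OF tendsto_diff[OF inv Fl] inv] by simp
      show "\<exists>N. \<forall>k\<ge>N. Q (x (r k)) \<le> (1 / real (Suc (r k)) - F (x (r k))) * (1 / real (Suc (r k)))"
        using x(2) by (intro exI allI impI) (simp add: le_divide_eq mult.commute algebra_simps del: of_nat_Suc)
    qed
    ultimately show False using pos[OF l(1)] Q(2)[OF l(1)] by force
  qed
  then show ?thesis using that by blast
qed

text \<open>The tube lemma, as closedness of the projection along a compact factor.\<close>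

lemma open_forall_compact:
  fixes f :: "'x::euclidean_space \<Rightarrow> 'y::euclidean_space \<Rightarrow> 'z::topological_space"
  assumes K: "compact K" and f: "continuous_on UNIV (\<lambda>z. f (fst z) (snd z))" and S: "open S"
  shows "open {x. \<forall>y\<in>K. f x y \<in> S}"
proof -
  have "closed ((\<lambda>z. f (snd z) (fst z)) -` (- S))"
    using S by (intro closed_vimage) (auto intro!: continuous_on_compose2[OF f, of UNIV "\<lambda>z. (snd z, fst z)", simplified] continuous_intros)
  from closed_compact_projection[OF K this]
  have "closed {x. \<exists>y\<in>K. f x y \<notin> S}" by (simp add: vimage_def Bex_def)
  moreover have "{x. \<exists>y\<in>K. f x y \<notin> S} = - {x. \<forall>y\<in>K. f x y \<in> S}" by auto
  ultimately show ?thesis by (simp add: closed_def)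
qed

locale C_convex_domain = regular_domain \<rho> G D
  for \<rho> :: "complex ^ 'd \<Rightarrow> real" and G D +
  fixes H :: "complex ^ 'd \<Rightarrow> (complex ^ 'd) \<Rightarrow>\<^sub>L (complex ^ 'd)"
  assumes G_deriv: "\<And>x. (G has_derivative blinfun_apply (H x)) (at x)"
    and contH: "continuous_on UNIV H"
    and connected_D: "connected D"
    and hessian_pos: "\<And>w v. w \<in> frontier D \<Longrightarrow> hform (G w) v = 0 \<Longrightarrow> v \<noteq> 0 \<Longrightarrow> 0 < blinfun_apply (H w) v \<bullet> v"
begin

lemma rho_taylor:
  obtains t where "0 < t" "t < 1" "\<rho> (w + u) = \<rho> w + G w \<bullet> u + (blinfun_apply (H (w + t *\<^sub>R u)) u \<bullet> u) / 2"
proof -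
  define d where "d m = (if m = 0 then (\<lambda>t. \<rho> (w + t *\<^sub>R u)) else if m = 1 then (\<lambda>t. G (w + t *\<^sub>R u) \<bullet> u)
      else (\<lambda>t. blinfun_apply (H (w + t *\<^sub>R u)) u \<bullet> u))" for m :: nat
  have line: "((\<lambda>t. w + t *\<^sub>R u) has_derivative (\<lambda>s. s *\<^sub>R u)) (at t)" for t
    by (auto intro!: derivative_eq_intros)
  have 0: "((\<lambda>t. \<rho> (w + t *\<^sub>R u)) has_real_derivative G (w + t *\<^sub>R u) \<bullet> u) (at t)" for t
    unfolding has_field_derivative_def
    by (rule has_derivative_eq_rhs, rule has_derivative_compose[OF line rho_deriv]) (auto simp: mult.commute)
  have 1: "((\<lambda>t. G (w + t *\<^sub>R u) \<bullet> u) has_real_derivative blinfun_apply (H (w + t *\<^sub>R u)) u \<bullet> u) (at t)" for t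
    unfolding has_field_derivative_def
    by (rule has_derivative_eq_rhs, rule has_derivative_inner_left, rule has_derivative_compose[OF line G_deriv])
       (auto simp: blinfun.scaleR_right mult.commute)
  have "\<forall>m t. m < 2 \<and> 0 \<le> t \<and> t \<le> 1 \<longrightarrow> DERIV (d m) t :> d (Suc m) t"
    using 0 1 by (auto simp: d_def less_2_cases_iff)
  from Maclaurin[of 1 2 d "d 0", OF _ _ _ this]
  obtain t where "0 < t" "t < 1" "d 0 1 = (\<Sum>m<2. d m 0 / fact m * 1 ^ m) + d 2 t / fact 2 * 1 ^ 2" by auto
  then show ?thesis using that[of t] by (simp add: d_def numeral_2_eq_2)
qed

text \<open>The basic estimate. Along complex tangent directions \<open>\<rho>\<close> grows quadratically; in the remaining
  directions the linear term \<open>hform\<close> dominates. Hence a small value of the pairing between a boundary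
  point and a nearby point of the domain bounds both their distance and the depth of the latter.\<close>

lemma tangent_pairing_estimate:
  obtains r c C where "r > 0" "c > 0" "C \<ge> 0"
    "\<And>w u. w \<in> frontier D \<Longrightarrow> norm u \<le> r \<Longrightarrow>
       c * (norm u)\<^sup>2 - \<rho> (w + u) \<le> cmod (hform (G w) u) * (1 + C * norm u)"
proof -
  define K where "K = frontier D \<times> sphere (0 :: complex ^ 'd) 1"
  have cK: "compact K" unfolding K_def by (intro compact_Times compact_frontier_D compact_sphere)
  have contH': "continuous_on A (\<lambda>x. H (f x))" if "continuous_on A f" for A :: "'z::topological_space set" and f
    by (rule continuous_on_compose2[OF contH that]) auto
  have contG': "continuous_on A (\<lambda>x. G (f x))" if "continuous_on A f" for A :: "'z::topological_space set" and f
    by (rule continuous_on_compose2[OF contG that]) auto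
  obtain k :: nat where k: "k > 0"
    "\<And>x. x \<in> K \<Longrightarrow> 1 / real k < blinfun_apply (H (fst x)) (snd x) \<bullet> snd x + real k * cmod (hform (G (fst x)) (snd x))"
  proof (rule compact_penalty[OF cK, of "\<lambda>x. blinfun_apply (H (fst x)) (snd x) \<bullet> snd x" "\<lambda>x. cmod (hform (G (fst x)) (snd x))"])
    show "continuous_on K (\<lambda>x. blinfun_apply (H (fst x)) (snd x) \<bullet> snd x)"
      by (intro continuous_intros contH')
    show "continuous_on K (\<lambda>x. cmod (hform (G (fst x)) (snd x)))"
      by (intro continuous_intros contG')
    show "0 < blinfun_apply (H (fst x)) (snd x) \<bullet> snd x" if "x \<in> K" "cmod (hform (G (fst x)) (snd x)) = 0" for x
      using that by (intro hessian_pos) (auto simp: K_def)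
  qed auto
  have hom: "(norm u)\<^sup>2 / real k - real k * (cmod (hform (G w) u) * norm u) \<le> blinfun_apply (H w) u \<bullet> u"
    if w: "w \<in> frontier D" for w u
  proof (cases "u = 0")
    case False
    define e where "e = (1 / norm u) *\<^sub>R u"
    have ue: "u = norm u *\<^sub>R e" using False by (simp add: e_def)
    have "(w, e) \<in> K" using w False by (simp add: K_def e_def)
    from k(2)[OF this] have *: "1 / real k \<le> blinfun_apply (H w) e \<bullet> e + real k * cmod (hform (G w) e)" by simp
    have "blinfun_apply (H w) u \<bullet> u = (norm u)\<^sup>2 * (blinfun_apply (H w) e \<bullet> e)"
      by (subst (1 2) ue) (simp add: blinfun.scaleR_right power2_eq_square)
    moreover have "cmod (hform (G w) u) * norm u = (norm u)\<^sup>2 * cmod (hform (G w) e)"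
      by (subst (1) ue) (simp add: hform_scaleR norm_mult power2_eq_square)
    ultimately show ?thesis using mult_left_mono[OF *, of "(norm u)\<^sup>2"] by (simp add: algebra_simps)
  qed (simp add: hform_def)
  define K1 where "K1 = (\<Union>x\<in>frontier D. \<Union>y\<in>cball 0 1. {x + y})"
  have "compact K1" unfolding K1_def by (intro compact_sums' compact_frontier_D compact_cball)
  then have "uniformly_continuous_on K1 H"
    using contH continuous_on_subset by (intro compact_uniformly_continuous) blast+
  then obtain r0 where r0: "r0 > 0" "\<And>x y. x \<in> K1 \<Longrightarrow> y \<in> K1 \<Longrightarrow> dist y x < r0 \<Longrightarrow> dist (H y) (H x) < 1 / (2 * real k)"
    unfolding uniformly_continuous_on_def using k(1) by (metis divide_pos_pos mult_pos_pos of_nat_0_less_iff zero_less_numeral zero_less_one)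
  define r where "r = min 1 (r0 / 2)"
  show ?thesis
  proof (rule that[of r "1 / (4 * real k)" "real k / 2"])
    show "r > 0" "0 < 1 / (4 * real k)" "0 \<le> real k / 2" using r0 k(1) by (auto simp: r_def)
    fix w u :: "complex ^ 'd" assume w: "w \<in> frontier D" and u: "norm u \<le> r"
    obtain t where t: "0 < t" "t < 1" "\<rho> (w + u) = \<rho> w + G w \<bullet> u + (blinfun_apply (H (w + t *\<^sub>R u)) u \<bullet> u) / 2"
      by (rule rho_taylor)
    have tu: "norm (t *\<^sub>R u) \<le> norm u" using t by (simp add: mult_left_le_one_le)
    have "w \<in> K1" unfolding K1_def using w by force
    moreover have "w + t *\<^sub>R u \<in> K1" unfolding K1_def using w u tu by (force simp: r_def)
    ultimately have "dist (H (w + t *\<^sub>R u)) (H w) < 1 / (2 * real k)"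
      using u tu r0(1) by (intro r0(2)) (auto simp: r_def dist_norm)
    then have small: "norm (H w - H (w + t *\<^sub>R u)) \<le> 1 / (2 * real k)" by (simp add: dist_norm norm_minus_commute)
    have "blinfun_apply (H w - H (w + t *\<^sub>R u)) u \<bullet> u \<le> norm (H w - H (w + t *\<^sub>R u)) * norm u * norm u"
      using norm_cauchy_schwarz norm_blinfun by (meson mult_right_mono norm_ge_zero order_trans)
    also have "\<dots> \<le> 1 / (2 * real k) * norm u * norm u" using small by (intro mult_right_mono) auto
    finally have hd: "blinfun_apply (H w) u \<bullet> u - (norm u)\<^sup>2 / (2 * real k) \<le> blinfun_apply (H (w + t *\<^sub>R u)) u \<bullet> u"
      by (simp add: blinfun.diff_left inner_diff_left power2_eq_square)
    define q where "q = cmod (hform (G w) u)"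
    have "- q \<le> G w \<bullet> u" using abs_Re_le_cmod[of "hform (G w) u"] by (simp add: Re_hform q_def)
    moreover have "\<rho> w = 0" using w by (rule frontier_zero)
    moreover have "- q + (A - c - b) / 2 \<le> x" if "- q \<le> g" "x = 0 + g + h' / 2" "h - b \<le> h'" "A - c \<le> h"
      for x g h h' A b c :: real
    proof -
      have "A - c - b \<le> h'" using that(3,4) by simp
      then have "(A - c - b) / 2 \<le> h' / 2" by simp
      with that(1) have "- q + (A - c - b) / 2 \<le> g + h' / 2" by (rule add_mono)
      also have "\<dots> = x" using that(2) by simp
      finally show ?thesis .
    qed
    ultimately have low: "- q + ((norm u)\<^sup>2 / real k - real k * (q * norm u) - (norm u)\<^sup>2 / (2 * real k)) / 2 \<le> \<rho> (w + u)"
      using t(3) hd hom[OF w, of u] unfolding q_def[symmetric] by metis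
    have eq: "((norm u)\<^sup>2 / real k - real k * (q * norm u) - (norm u)\<^sup>2 / (2 * real k)) / 2
        = 1 / (4 * real k) * (norm u)\<^sup>2 - q * (real k / 2 * norm u)"
      using k(1) by (simp add: field_simps)
    have "q * (1 + real k / 2 * norm u) = q + q * (real k / 2 * norm u)" by (simp only: distrib_left mult_1_right)
    then show "1 / (4 * real k) * (norm u)\<^sup>2 - \<rho> (w + u) \<le> q * (1 + real k / 2 * norm u)"
      using low unfolding eq by linarith
  qed
qed

subsection \<open>Sections by complex lines\<close>

text \<open>Let \<open>\<Omega>\<close> be the section of the domain by the complex line \<open>\<zeta> \<mapsto> z\<^sub>0 + \<zeta> v\<close>. If the line is tangent to the
  boundary at a point then the point is isolated in the section of the closure; if it is transversal,
  the section lies locally on one side of a curve. In both cases a component of \<open>\<Omega>\<close> does not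
  share a boundary point with another one, so its closure is relatively open in the section of
  the closure of the domain.\<close>

lemma section_component_closure_open:
  fixes z0 v :: "complex ^ 'd"
  defines "\<Omega> \<equiv> {\<zeta>. z0 + \<zeta> *s v \<in> D}"
  assumes v: "v \<noteq> 0" and \<zeta>: "\<zeta> \<in> closure (connected_component_set \<Omega> a)"
  obtains \<epsilon> where "\<epsilon> > 0" "\<And>\<xi>. \<xi> \<in> ball \<zeta> \<epsilon> \<Longrightarrow> z0 + \<xi> *s v \<in> closure D \<Longrightarrow> \<xi> \<in> closure (connected_component_set \<Omega> a)"
proof -
  let ?C = "connected_component_set \<Omega> a"
  define f where "f \<xi> = z0 + \<xi> *s v" for \<xi>
  have contf: "continuous_on A f" for A unfolding f_def by (intro continuous_intros)
  have \<Omega>: "\<Omega> = f -` D" unfolding \<Omega>_def f_def by auto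
  have open\<Omega>: "open \<Omega>" unfolding \<Omega> using open_D contf by (rule open_vimage)
  have f_diff: "f \<xi> - f \<xi>' = (\<xi> - \<xi>') *s v" for \<xi> \<xi>' by (simp add: f_def vec_eq_iff algebra_simps)
  have joined: "\<xi>' \<in> ?C" if "\<xi> \<in> ?C" "connected T" "T \<subseteq> \<Omega>" "\<xi> \<in> T" "\<xi>' \<in> T" for \<xi> \<xi>' T
  proof -
    have "connected_component \<Omega> \<xi> \<xi>'" unfolding connected_component_def using that(2-5) by blast
    moreover have "connected_component \<Omega> a \<xi>" using that(1) by simp
    ultimately show ?thesis by (simp add: connected_component_trans[of \<Omega> a \<xi> \<xi>'])
  qed
  have "closed (f -` closure D)" using contf by (intro closed_vimage) auto
  moreover have "?C \<subseteq> f -` closure D"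
    using connected_component_subset[of \<Omega> a] closure_subset[of D] unfolding \<Omega> by blast
  ultimately have f\<zeta>: "f \<zeta> \<in> closure D" using \<zeta> closure_minimal by blast
  show ?thesis
  proof (cases "\<zeta> \<in> \<Omega>")
    case True
    then obtain \<epsilon> where \<epsilon>: "\<epsilon> > 0" "ball \<zeta> \<epsilon> \<subseteq> \<Omega>" using open\<Omega> open_contains_ball by blast
    obtain \<xi>0 where \<xi>0: "\<xi>0 \<in> ?C" "dist \<xi>0 \<zeta> < \<epsilon>" using \<zeta> \<epsilon>(1) closure_approachable by blast
    have "ball \<zeta> \<epsilon> \<subseteq> ?C"
    proof
      fix \<xi> assume "\<xi> \<in> ball \<zeta> \<epsilon>"
      then show "\<xi> \<in> ?C" using joined[OF \<xi>0(1) connected_ball \<epsilon>(2)] \<xi>0(2) by (auto simp: dist_commute)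
    qed
    then show ?thesis using that[OF \<epsilon>(1)] closure_subset by blast
  next
    case False
    then have w: "f \<zeta> \<in> frontier D" using f\<zeta> by (simp add: frontier_closure \<Omega>)
    show ?thesis
    proof (cases "hform (G (f \<zeta>)) v = 0")
      case True
      obtain r c C where KE: "r > 0" "c > 0" "C \<ge> 0"
        "\<And>w u. w \<in> frontier D \<Longrightarrow> norm u \<le> r \<Longrightarrow>
          c * (norm u)\<^sup>2 - \<rho> (w + u) \<le> cmod (hform (G w) u) * (1 + C * norm u)"
        by (rule tangent_pairing_estimate) (rule that)
      define \<epsilon> where "\<epsilon> = r / norm v"
      have \<epsilon>: "\<epsilon> > 0" using v KE(1) by (simp add: \<epsilon>_def)
      have isolated: "\<xi> = \<zeta>" if "\<xi> \<in> ball \<zeta> \<epsilon>" "f \<xi> \<in> closure D" for \<xi>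
      proof (rule ccontr)
        assume ne: "\<xi> \<noteq> \<zeta>"
        define u where "u = (\<xi> - \<zeta>) *s v"
        have fu: "f \<xi> = f \<zeta> + u" using f_diff[of \<xi> \<zeta>] by (simp add: u_def algebra_simps)
        have "cmod (\<xi> - \<zeta>) < \<epsilon>" using that(1) by (simp add: dist_norm norm_minus_commute)
        moreover have nu: "norm u = cmod (\<xi> - \<zeta>) * norm v" unfolding u_def by (rule norm_complex_scale)
        ultimately have "norm u \<le> r" using v by (simp add: \<epsilon>_def less_divide_eq)
        from KE(4)[OF w this] have "c * (norm u)\<^sup>2 \<le> \<rho> (f \<xi>)"
        proof -
          have "hform (G (f \<zeta>)) u = 0" unfolding u_def hform_scale True by simp
          then show ?thesis using KE(4)[OF w \<open>norm u \<le> r\<close>] by (simp add: fu)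
        qed
        moreover have "c * (norm u)\<^sup>2 > 0" unfolding nu using KE(2) ne v by simp
        ultimately show False using closure_le[OF that(2)] by linarith
      qed
      show ?thesis
      proof (rule that[OF \<epsilon>])
        fix \<xi> assume "\<xi> \<in> ball \<zeta> \<epsilon>" "z0 + \<xi> *s v \<in> closure D"
        then have "\<xi> = \<zeta>" using isolated unfolding f_def by blast
        then show "\<xi> \<in> closure ?C" using \<zeta> by simp
      qed
    next
      case False
      define m where "m = cmod (hform (G (f \<zeta>)) v)"
      have m: "m > 0" using False by (simp add: m_def)
      \<comment> \<open>Turning \<open>v\<close> by the phase \<open>\<eta>\<close> makes it point out of the domain.\<close>
      define \<eta> where "\<eta> = cnj (hform (G (f \<zeta>)) v) / m"
      have \<eta>1: "cmod \<eta> = 1" using m by (simp add: \<eta>_def norm_divide m_def)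
      have "hform (G (f \<zeta>)) (\<eta> *s v) = (hform (G (f \<zeta>)) v * cnj (hform (G (f \<zeta>)) v)) / of_real m"
        by (simp add: hform_scale \<eta>_def mult.commute)
      also have "\<dots> = of_real m"
        unfolding complex_norm_square[symmetric] using m by (simp add: power2_eq_square m_def)
      finally have "G (f \<zeta>) \<bullet> (\<eta> *s v) = m" unfolding Re_hform[symmetric] by simp
      moreover have "open {\<xi>. m / 2 < G (f \<xi>) \<bullet> (\<eta> *s v)}"
        by (intro open_Collect_less continuous_intros continuous_on_compose2[OF contG contf]) auto
      ultimately obtain R where R: "R > 0" "ball \<zeta> R \<subseteq> {\<xi>. m / 2 < G (f \<xi>) \<bullet> (\<eta> *s v)}"
        using m unfolding open_contains_ball by force
      have down: "f (\<xi> - of_real t * \<eta>) \<in> D"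
        if "dist \<xi> \<zeta> < R / 2" "\<rho> (f \<xi>) \<le> 0" "0 < t" "t < R / 2" for \<xi> t
      proof -
        define y where "y = f (\<xi> - of_real t * \<eta>)"
        define u where "u = t *\<^sub>R (\<eta> *s v)"
        have "f \<xi> - y = (of_real t * \<eta>) *s v" unfolding y_def f_diff by simp
        also have "\<dots> = u" unfolding u_def by (simp only: scaleR_complex_scale)
        finally have fy: "f \<xi> = y + u" by (simp add: algebra_simps)
        obtain s where s: "0 < s" "s < 1" "\<rho> (y + u) = \<rho> y + G (y + s *\<^sub>R u) \<bullet> u" by (rule rho_mean_value)
        define \<xi>' where "\<xi>' = \<xi> - of_real ((1 - s) * t) * \<eta>"
        have "\<xi>' - (\<xi> - of_real t * \<eta>) = of_real s * (of_real t * \<eta>)"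
          by (simp add: \<xi>'_def algebra_simps)
        then have "f \<xi>' - y = (of_real s * (of_real t * \<eta>)) *s v" unfolding y_def f_diff by simp
        also have "\<dots> = s *\<^sub>R u" unfolding u_def scaleR_complex_scale ..
        finally have "y + s *\<^sub>R u = f \<xi>'" by (simp add: algebra_simps)
        moreover have "\<xi>' \<in> ball \<zeta> R"
        proof -
          have "dist \<xi>' \<xi> = (1 - s) * t"
            using s that(3) \<eta>1 by (simp add: \<xi>'_def dist_norm norm_mult del: of_real_mult of_real_diff)
          also have "\<dots> \<le> t" using s that(3) by (simp add: mult_left_le_one_le)
          finally show ?thesis using that(1,4) dist_triangle[of \<xi>' \<zeta> \<xi>] by (simp add: dist_commute)
        qed
        ultimately have "m / 2 * t < G (y + s *\<^sub>R u) \<bullet> u"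
          using R(2) that(3) by (auto simp: u_def mult.commute)
        moreover have "m / 2 * t > 0" using m that(3) by simp
        ultimately show ?thesis using s(3) that(2) fy unfolding D_eq y_def[symmetric] by simp
      qed
      define \<zeta>1 where "\<zeta>1 = \<zeta> - of_real (R / 4) * \<eta>"
      have "f \<zeta>1 \<in> D" unfolding \<zeta>1_def using closure_le[OF f\<zeta>] R(1) by (intro down) auto
      then have "\<zeta>1 \<in> \<Omega>" by (simp add: \<Omega>)
      then obtain \<epsilon>1 where \<epsilon>1: "\<epsilon>1 > 0" "ball \<zeta>1 \<epsilon>1 \<subseteq> \<Omega>" using open\<Omega> open_contains_ball by blast
      define \<epsilon> where "\<epsilon> = min \<epsilon>1 (R / 4)"
      have \<epsilon>: "\<epsilon> > 0" using \<epsilon>1 R by (simp add: \<epsilon>_def)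
      define T where "T \<xi> = ball \<zeta>1 \<epsilon>1 \<union> (\<lambda>t. \<xi> - of_real t * \<eta>) ` {0<..R / 4}" for \<xi>
      have T: "connected (T \<xi>)" "T \<xi> \<subseteq> \<Omega>" if "\<xi> \<in> ball \<zeta> \<epsilon>" "\<rho> (f \<xi>) \<le> 0" for \<xi>
      proof -
        have "\<xi> - of_real (R / 4) * \<eta> \<in> ball \<zeta>1 \<epsilon>1"
          using that(1) by (simp add: \<zeta>1_def \<epsilon>_def dist_norm)
        moreover have "\<xi> - of_real (R / 4) * \<eta> \<in> (\<lambda>t. \<xi> - of_real t * \<eta>) ` {0<..R / 4}"
          by (rule image_eqI[OF refl]) (use R(1) in simp)
        moreover have "connected ((\<lambda>t. \<xi> - of_real t * \<eta>) ` {0<..R / 4})"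
          by (intro connected_continuous_image continuous_intros convex_connected) simp
        ultimately show "connected (T \<xi>)" unfolding T_def by (intro connected_Un) auto
        have "dist \<xi> \<zeta> < R / 2" using that(1) R(1) by (simp add: \<epsilon>_def dist_commute)
        then show "T \<xi> \<subseteq> \<Omega>" unfolding T_def using \<epsilon>1(2) that(2) R(1) by (auto simp: \<Omega> intro!: down)
      qed
      obtain \<xi>0 where \<xi>0: "\<xi>0 \<in> ?C" "dist \<xi>0 \<zeta> < \<epsilon>" using \<zeta> \<epsilon> closure_approachable by blast
      have "\<xi>0 \<in> \<Omega>" using \<xi>0(1) connected_component_subset by blast
      \<comment> \<open>Both \<open>\<xi>\<^sub>0\<close> and every other nearby point of the section can be pushed into the same ball.\<close>
      have "\<zeta>1 \<in> ?C"
      proof -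
        have r0: "\<rho> (f \<xi>0) \<le> 0" using \<open>\<xi>0 \<in> \<Omega>\<close> by (auto simp: \<Omega> D_eq)
        have "\<xi>0 \<in> ball \<zeta> \<epsilon>" using \<xi>0(2) by (simp add: dist_commute)
        note T0 = T[OF this r0]
        define S where "S = insert \<xi>0 (T \<xi>0)"
        have "connected S"
        proof (rule connected_intermediate_closure[OF T0(1)])
          show "T \<xi>0 \<subseteq> S" by (auto simp: S_def)
          have "((\<lambda>t. \<xi>0 - of_real t * \<eta>) \<longlongrightarrow> \<xi>0 - of_real 0 * \<eta>) (at_right 0)" by (intro tendsto_intros)
          moreover have "\<forall>\<^sub>F t in at_right 0. \<xi>0 - of_real t * \<eta> \<in> T \<xi>0"
            using eventually_at_right_real[of 0 "R / 4"] R(1) by (auto elim!: eventually_mono simp: T_def)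
          ultimately have "\<xi>0 \<in> closure (T \<xi>0)"
            by (intro Lim_in_closed_set[of "closure (T \<xi>0)" "\<lambda>t. \<xi>0 - of_real t * \<eta>" "at_right 0"])
               (auto elim!: eventually_mono intro: closure_subset[THEN subsetD])
          then show "S \<subseteq> closure (T \<xi>0)" using closure_subset by (auto simp: S_def)
        qed
        moreover have "S \<subseteq> \<Omega>" "\<xi>0 \<in> S" "\<zeta>1 \<in> S" using T0(2) \<open>\<xi>0 \<in> \<Omega>\<close> \<epsilon>1(1) by (auto simp: S_def T_def)
        ultimately show ?thesis using joined[OF \<xi>0(1)] by blast
      qed
      show ?thesis
      proof (rule that[OF \<epsilon>])
        fix \<xi> assume \<xi>: "\<xi> \<in> ball \<zeta> \<epsilon>" "z0 + \<xi> *s v \<in> closure D"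
        note T1 = T[OF \<xi>(1) closure_le[OF \<xi>(2), folded f_def]]
        have "T \<xi> \<subseteq> ?C" using joined[OF \<open>\<zeta>1 \<in> ?C\<close> T1] \<epsilon>1(1) by (auto simp: T_def)
        have "((\<lambda>t. \<xi> - of_real t * \<eta>) \<longlongrightarrow> \<xi> - of_real 0 * \<eta>) (at_right 0)" by (intro tendsto_intros)
        moreover have "\<forall>\<^sub>F t in at_right 0. \<xi> - of_real t * \<eta> \<in> T \<xi>"
          using eventually_at_right_real[of 0 "R / 4"] R(1) by (auto elim!: eventually_mono simp: T_def)
        ultimately have "\<xi> \<in> closure (T \<xi>)"
          by (intro Lim_in_closed_set[of "closure (T \<xi>)" "\<lambda>t. \<xi> - of_real t * \<eta>" "at_right 0"])
             (auto elim!: eventually_mono intro: closure_subset[THEN subsetD])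
        then show "\<xi> \<in> closure ?C" using closure_mono[OF \<open>T \<xi> \<subseteq> ?C\<close>] by blast
      qed
    qed
  qed
qed

text \<open>Connectedness of the sections by complex lines, in the form in which it is used: for a fixed \<open>z\<^sub>0\<close> the
  points \<open>z\<close> that are joined to \<open>z\<^sub>0\<close> inside the section by the line through both form a relatively
  open and closed subset of the domain without \<open>z\<^sub>0\<close>, which is connected because the real dimension
  is at least two. A compact connecting set survives small changes of \<open>z\<close>. So does a compact set
  outside the closure of the domain that separates two components.\<close>

lemma section_connected:
  assumes z0: "z0 \<in> D" and z1: "z1 \<in> D" "z1 \<noteq> z0"
  obtains K where "compact K" "connected K" "0 \<in> K" "1 \<in> K" "\<And>\<zeta>. \<zeta> \<in> K \<Longrightarrow> z0 + \<zeta> *s (z1 - z0) \<in> D"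
proof -
  define good where "good z K \<longleftrightarrow> compact K \<and> connected K \<and> 0 \<in> K \<and> 1 \<in> K \<and> (\<forall>\<zeta>\<in>K. z0 + \<zeta> *s (z - z0) \<in> D)"
    for z and K :: "complex set"
  define A where "A = {z \<in> D - {z0}. \<exists>K. good z K}"
  have tube: "open {z. \<forall>\<zeta>\<in>K. z0 + \<zeta> *s (z - z0) \<in> U}" if "compact K" "open U" for K U
    using that by (intro open_forall_compact[where f="\<lambda>z \<zeta>. z0 + \<zeta> *s (z - z0)"] continuous_intros)
  have op: "open (D - {z0})" using open_D by auto
  have "connected (D - {z0})"
    using open_D connected_D by (intro connected_open_delete) (auto simp: DIM_complex)
  moreover have "open A"
  proof (subst open_subopen, intro ballI)
    fix z assume "z \<in> A"
    then obtain K where z: "z \<in> D - {z0}" and K: "good z K" by (auto simp: A_def)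
    define N where "N = (D - {z0}) \<inter> {z. \<forall>\<zeta>\<in>K. z0 + \<zeta> *s (z - z0) \<in> D}"
    have "open N" unfolding N_def using op K open_D by (intro open_Int tube) (auto simp: good_def)
    moreover have "z \<in> N" "N \<subseteq> A" using z K by (auto simp: N_def A_def good_def)
    ultimately show "\<exists>T. open T \<and> z \<in> T \<and> T \<subseteq> A" by blast
  qed
  moreover have "open ((D - {z0}) - A)"
  proof (subst open_subopen, intro ballI)
    fix z assume z: "z \<in> (D - {z0}) - A"
    define v where "v = z - z0"
    have v: "v \<noteq> 0" using z by (simp add: v_def)
    define \<Omega> where "\<Omega> = {\<zeta>. z0 + \<zeta> *s v \<in> D}"
    define X where "X = {\<zeta>. z0 + \<zeta> *s v \<in> closure D}"
    let ?C = "connected_component_set \<Omega> 0"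
    have contf: "continuous_on B (\<lambda>\<zeta>. z0 + \<zeta> *s v)" for B by (intro continuous_intros)
    have open\<Omega>: "open \<Omega>" unfolding \<Omega>_def using open_vimage[OF open_D contf] by (simp add: vimage_def)
    have closedX: "closed X" unfolding X_def using closed_vimage[OF closed_closure contf] by (simp add: vimage_def)
    have in\<Omega>: "0 \<in> \<Omega>" "1 \<in> \<Omega>" using z z0 by (auto simp: \<Omega>_def v_def)
    have "1 \<notin> ?C"
    proof
      assume "1 \<in> ?C"
      have "path_connected ?C"
        using open\<Omega> by (intro connected_open_path_connected open_connected_component connected_connected_component)
      then obtain \<gamma> where \<gamma>: "path \<gamma>" "path_image \<gamma> \<subseteq> ?C" "pathstart \<gamma> = 0" "pathfinish \<gamma> = 1"
        using \<open>1 \<in> ?C\<close> in\<Omega>(1) unfolding path_connected_def by (metis connected_component_refl mem_Collect_eq)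
      have "path_image \<gamma> \<subseteq> \<Omega>" using \<gamma>(2) connected_component_subset by blast
      then have "good z (path_image \<gamma>)"
        using \<gamma> pathstart_in_path_image[of \<gamma>] pathfinish_in_path_image[of \<gamma>]
        by (auto simp: good_def compact_path_image connected_path_image \<Omega>_def v_def)
      then show False using z by (auto simp: A_def)
    qed
    have "?C \<subseteq> X" using connected_component_subset[of \<Omega> 0] closure_subset[of D] unfolding X_def \<Omega>_def by blast
    then have CX: "closure ?C \<subseteq> X" using closedX by (rule closure_minimal)
    have "closed (X - closure ?C)"
    proof -
      have "\<exists>\<epsilon>>0. \<forall>\<xi>\<in>ball \<zeta> \<epsilon>. \<xi> \<in> X \<longrightarrow> \<xi> \<in> closure ?C" if "\<zeta> \<in> closure ?C" for \<zeta>
        using section_component_closure_open[OF v that[unfolded \<Omega>_def]] unfolding X_def \<Omega>_def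
        by (metis (no_types, lifting) mem_Collect_eq)
      then obtain e where e: "\<And>\<zeta>. \<zeta> \<in> closure ?C \<Longrightarrow> e \<zeta> > 0"
        "\<And>\<zeta> \<xi>. \<zeta> \<in> closure ?C \<Longrightarrow> \<xi> \<in> ball \<zeta> (e \<zeta>) \<Longrightarrow> \<xi> \<in> X \<Longrightarrow> \<xi> \<in> closure ?C" by metis
      have "\<xi> \<in> closure ?C" if "\<xi> \<in> X" "\<xi> \<in> (\<Union>\<zeta>\<in>closure ?C. ball \<zeta> (e \<zeta>))" for \<xi>
        using that e(2) by blast
      moreover have "\<xi> \<in> (\<Union>\<zeta>\<in>closure ?C. ball \<zeta> (e \<zeta>))" if "\<xi> \<in> closure ?C" for \<xi>
        using that e(1)[OF that] centre_in_ball by blast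
      ultimately have "X - closure ?C = X - (\<Union>\<zeta>\<in>closure ?C. ball \<zeta> (e \<zeta>))" by blast
      moreover have "closed (X - (\<Union>\<zeta>\<in>closure ?C. ball \<zeta> (e \<zeta>)))"
        by (intro closed_Diff closedX open_UN ballI open_ball)
      ultimately show ?thesis by simp
    qed
    moreover have "bounded X"
    proof -
      obtain B where B: "\<And>y. y \<in> closure D \<Longrightarrow> norm y \<le> B"
        using bounded_D bounded_closure bounded_iff by metis
      have "cmod \<zeta> \<le> (B + norm z0) / norm v" if "\<zeta> \<in> X" for \<zeta>
      proof -
        have "norm (\<zeta> *s v) \<le> norm (z0 + \<zeta> *s v) + norm z0"
          using norm_triangle_ineq4[of "z0 + \<zeta> *s v" z0] by simp
        also have "\<dots> \<le> B + norm z0" using B that by (simp add: X_def)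
        finally show ?thesis using v by (simp add: norm_complex_scale pos_le_divide_eq)
      qed
      then show ?thesis unfolding bounded_iff by blast
    qed
    ultimately have "compact (closure ?C)" "closed (X - closure ?C)"
      using CX bounded_subset by (auto simp: compact_eq_bounded_closed)
    from separate_compact_closed[OF this]
    obtain d where d: "d > 0" "\<And>x y. x \<in> closure ?C \<Longrightarrow> y \<in> X - closure ?C \<Longrightarrow> d \<le> dist x y" by auto
    have C0: "0 \<in> closure ?C" using in\<Omega>(1) closure_subset connected_component_refl by fastforce
    have one: "1 \<in> X - closure ?C"
    proof -
      have "1 \<notin> closure ?C"
      proof
        assume 1: "1 \<in> closure ?C"
        obtain \<epsilon> where \<epsilon>: "\<epsilon> > 0" "ball 1 \<epsilon> \<subseteq> \<Omega>" using open\<Omega> in\<Omega>(2) open_contains_ball by blast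
        obtain \<xi> where "\<xi> \<in> ?C" "dist \<xi> 1 < \<epsilon>" using 1 \<epsilon>(1) closure_approachable by blast
        moreover have "connected_component \<Omega> \<xi> 1"
          unfolding connected_component_def using \<epsilon> \<open>dist \<xi> 1 < \<epsilon>\<close>
          by (intro exI[of _ "ball 1 \<epsilon>"]) (auto simp: dist_commute)
        ultimately show False using \<open>1 \<notin> ?C\<close> by (auto intro: connected_component_trans)
      qed
      moreover have "1 \<in> X" using in\<Omega>(2) closure_subset[of D] unfolding X_def \<Omega>_def by blast
      ultimately show ?thesis by blast
    qed
    \<comment> \<open>The level set \<open>B\<close> separates \<open>0\<close> from \<open>1\<close> and lies outside the section of the closure.\<close>
    define \<phi> where "\<phi> \<zeta> = infdist \<zeta> (closure ?C)" for \<zeta>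
    define B where "B = {\<zeta>. \<phi> \<zeta> = d / 2}"
    have cont\<phi>: "continuous_on S \<phi>" for S unfolding \<phi>_def by (intro continuous_intros)
    have ne: "closure ?C \<noteq> {}" by (metis C0 empty_iff)
    have far: "d \<le> \<phi> \<zeta>" if "\<zeta> \<in> X - closure ?C" for \<zeta>
      unfolding \<phi>_def infdist_notempty[OF ne]
      by (rule cINF_greatest[OF ne]) (use d(2)[OF _ that] in \<open>simp add: dist_commute\<close>)
    have BX: "B \<inter> X = {}"
    proof -
      have "\<phi> \<zeta> \<noteq> d / 2" if "\<zeta> \<in> X" for \<zeta>
      proof (cases "\<zeta> \<in> closure ?C")
        case False
        have "d \<le> \<phi> \<zeta>" using far[of \<zeta>] False that by blast
        then show ?thesis using d(1) by linarith
      qed (use d(1) in \<open>simp add: \<phi>_def\<close>)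
      then show ?thesis by (auto simp: B_def)
    qed
    have "compact B"
    proof -
      have "closed B" unfolding B_def by (intro closed_Collect_eq cont\<phi> continuous_intros)
      moreover have "bounded B"
      proof -
        have "bounded (closure ?C)" using \<open>compact (closure ?C)\<close> by (rule compact_imp_bounded)
        then obtain b where b: "\<And>\<zeta>. \<zeta> \<in> closure ?C \<Longrightarrow> norm \<zeta> \<le> b" unfolding bounded_iff by blast
        have "norm \<zeta> \<le> b + d" if "\<zeta> \<in> B" for \<zeta>
        proof -
          obtain \<xi> where "\<xi> \<in> closure ?C" "infdist \<zeta> (closure ?C) = dist \<zeta> \<xi>"
            by (rule infdist_attains_inf[OF closed_closure ne])
          then show ?thesis using b[of \<xi>] that d(1) norm_triangle_sub[of \<zeta> \<xi>]
            by (auto simp: B_def \<phi>_def dist_norm)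
        qed
        then show ?thesis unfolding bounded_iff by blast
      qed
      ultimately show ?thesis by (simp add: compact_eq_bounded_closed)
    qed
    define N where "N = (D - {z0}) \<inter> {z. \<forall>\<zeta>\<in>B. z0 + \<zeta> *s (z - z0) \<in> - closure D}"
    have "open N" unfolding N_def using op \<open>compact B\<close> by (intro open_Int tube) auto
    moreover have "z \<in> N" using z BX by (auto simp: N_def X_def v_def)
    moreover have "N \<subseteq> (D - {z0}) - A"
    proof (safe)
      fix z' assume "z' \<in> N" "z' \<in> A"
      then obtain K where K: "good z' K" by (auto simp: A_def)
      have "d \<le> \<phi> 1" using far one by blast
      have "\<phi> 0 = 0" using C0 by (simp add: \<phi>_def)
      have conn: "connected (\<phi> ` K)" using K cont\<phi> by (intro connected_continuous_image) (auto simp: good_def)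
      have m01: "\<phi> 0 \<in> \<phi> ` K" "\<phi> 1 \<in> \<phi> ` K" using K unfolding good_def by blast+
      have "d / 2 \<in> \<phi> ` K"
        by (rule connectedD_interval[OF conn m01]) (use \<open>d \<le> \<phi> 1\<close> \<open>\<phi> 0 = 0\<close> d(1) in simp_all)
      then obtain \<zeta> where "\<zeta> \<in> K" "\<zeta> \<in> B" by (auto simp: B_def)
      then have "z0 + \<zeta> *s (z' - z0) \<in> D" "z0 + \<zeta> *s (z' - z0) \<notin> closure D"
        using K \<open>z' \<in> N\<close> by (auto simp: good_def N_def)
      then show False using closure_subset by blast
    qed (auto simp: N_def)
    ultimately show "\<exists>T. open T \<and> z \<in> T \<and> T \<subseteq> (D - {z0}) - A" by blast
  qed
  moreover have "A \<noteq> {}"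
  proof -
    obtain e where e: "e > 0" "ball z0 e \<subseteq> D" using open_D z0 open_contains_ball by blast
    define v where "v = (e / 2 / norm (z1 - z0)) *\<^sub>R (z1 - z0)"
    have v: "norm v = e / 2" using z1 e(1) by (simp add: v_def)
    have "good (z0 + v) (closed_segment 0 1)"
      unfolding good_def
    proof (intro conjI ballI)
      fix \<zeta> :: complex assume "\<zeta> \<in> closed_segment 0 1"
      then have "cmod \<zeta> \<le> 1" using segment_bound1[of \<zeta> 0 1] by simp
      then have "norm (\<zeta> *s v) \<le> e / 2"
        unfolding norm_complex_scale v using e(1) mult_right_mono[of "cmod \<zeta>" 1 "e / 2"] by simp
      then show "z0 + \<zeta> *s (z0 + v - z0) \<in> D" using e by (auto simp: dist_norm)
    qed auto
    moreover have "z0 + v \<in> D - {z0}" using e v by (auto simp: dist_norm)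
    ultimately show ?thesis by (auto simp: A_def)
  qed
  moreover have "A \<subseteq> D - {z0}" by (auto simp: A_def)
  ultimately have "(D - {z0}) - A = {}"
    using connectedD[of "D - {z0}" A "(D - {z0}) - A"] by blast
  then have "z1 \<in> A" using z1 by blast
  then show ?thesis using that by (auto simp: A_def good_def)
qed

text \<open>If the complex tangent hyperplane at \<open>w\<close> met the closure again at \<open>z\<close>, one could move the line through
  \<open>w\<close> and \<open>z\<close> slightly, so that it passes through points of the domain near both. Its section is connected,
  but a small circle around \<open>w\<close>, on which \<open>\<rho>\<close> is positive, separates the two points.\<close>

theorem tangent_hyperplane_supporting:
  assumes w: "w \<in> frontier D" and z: "z \<in> closure D" and tangent: "hform (G w) (z - w) = 0"
  shows "z = w"
proof (rule ccontr)
  assume ne: "z \<noteq> w"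
  obtain r c C where KE: "r > 0" "c > 0" "C \<ge> 0"
    "\<And>w u. w \<in> frontier D \<Longrightarrow> norm u \<le> r \<Longrightarrow>
      c * (norm u)\<^sup>2 - \<rho> (w + u) \<le> cmod (hform (G w) u) * (1 + C * norm u)"
    by (rule tangent_pairing_estimate) (rule that)
  define \<epsilon> where "\<epsilon> = min (1 / 2) (r / norm (z - w))"
  have \<epsilon>: "0 < \<epsilon>" "\<epsilon> < 1" "\<epsilon> * norm (z - w) \<le> r"
    using KE(1) ne by (auto simp: \<epsilon>_def min_def field_simps)
  define N where "N = {x. \<forall>\<zeta>\<in>sphere 0 \<epsilon>. fst x + \<zeta> *s (snd x - fst x) \<in> {y. 0 < \<rho> y}}"
  have "open {y. 0 < \<rho> y}" by (intro open_Collect_less continuous_intros cont_rho)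
  then have "open N" unfolding N_def
    by (intro open_forall_compact[where f="\<lambda>x \<zeta>. fst x + \<zeta> *s (snd x - fst x)"] compact_sphere continuous_intros)
  moreover have "(w, z) \<in> N"
  proof -
    have "0 < \<rho> (w + \<zeta> *s (z - w))" if "cmod \<zeta> = \<epsilon>" for \<zeta>
    proof -
      define u where "u = \<zeta> *s (z - w)"
      have nu: "norm u = \<epsilon> * norm (z - w)" unfolding u_def norm_complex_scale that ..
      have "hform (G w) u = 0" unfolding u_def hform_scale tangent by simp
      then have "c * (norm u)\<^sup>2 - \<rho> (w + u) \<le> 0"
        using KE(4)[OF w, of u] \<epsilon>(3) nu by simp
      moreover have "0 < c * (norm u)\<^sup>2" unfolding nu using KE(2) \<epsilon>(1) ne by simp
      ultimately show ?thesis unfolding u_def by linarith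
    qed
    then show ?thesis by (simp add: N_def)
  qed
  moreover have "open {x. fst x \<noteq> (snd x :: complex ^ 'd)}" by (intro open_Collect_neq continuous_intros)
  moreover have "(w, z) \<in> closure (D \<times> D)" using w z by (simp add: closure_Times frontier_closure)
  ultimately have "(N \<inter> {x. fst x \<noteq> snd x}) \<inter> (D \<times> D) \<noteq> {}"
    using ne open_Int_closure_eq_empty[of "N \<inter> {x. fst x \<noteq> snd x}" "D \<times> D"] by (auto simp: open_Int)
  then obtain w' z' where N: "(w', z') \<in> N" and D: "w' \<in> D" "z' \<in> D" "z' \<noteq> w'" by force
  obtain K where "compact K"
    and K: "connected K" "0 \<in> K" "1 \<in> K" "\<And>\<zeta>. \<zeta> \<in> K \<Longrightarrow> w' + \<zeta> *s (z' - w') \<in> D"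
    by (rule section_connected[OF D]) (rule that)
  have "connected (cmod ` K)" using K(1) by (intro connected_continuous_image continuous_intros)
  moreover have "cmod 0 \<in> cmod ` K" "cmod 1 \<in> cmod ` K" using K(2,3) by blast+
  ultimately have "\<epsilon> \<in> cmod ` K"
    by (rule connectedD_interval) (use \<epsilon> in simp_all)
  then obtain \<zeta> where "\<zeta> \<in> K" "cmod \<zeta> = \<epsilon>" by auto
  then have "w' + \<zeta> *s (z' - w') \<in> D" "0 < \<rho> (w' + \<zeta> *s (z' - w'))" using K(4) N by (auto simp: N_def)
  then show False by (simp add: D_eq)
qed

text \<open>The compactness form of the preceding theorem.\<close>

lemma tangent_pairing_separated:
  assumes "r > 0"
  obtains m where "m > 0" "\<And>w z. w \<in> frontier D \<Longrightarrow> z \<in> closure D \<Longrightarrow> r \<le> dist w z \<Longrightarrow> m \<le> cmod (hform (G w) (z - w))"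
proof -
  define K where "K = (frontier D \<times> closure D) \<inter> {x. r \<le> dist (fst x) (snd x)}"
  have "closed {x :: (complex ^ 'd) \<times> (complex ^ 'd). r \<le> dist (fst x) (snd x)}"
    by (intro closed_Collect_le continuous_intros)
  moreover have "compact (closure D)" using bounded_D compact_closure by blast
  ultimately have cK: "compact K" unfolding K_def by (intro compact_Int_closed compact_Times compact_frontier_D)
  have cont: "continuous_on K (\<lambda>x. cmod (hform (G (fst x)) (snd x - fst x)))"
    by (intro continuous_intros continuous_on_compose2[OF contG]) auto
  show ?thesis
  proof (cases "K = {}")
    case True
    show ?thesis by (rule that[of 1]) (use True in \<open>auto simp: K_def\<close>)
  next
    case False
    obtain x0 where x0: "x0 \<in> K" "\<And>x. x \<in> K \<Longrightarrow> cmod (hform (G (fst x0)) (snd x0 - fst x0)) \<le> cmod (hform (G (fst x)) (snd x - fst x))"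
      using continuous_attains_inf[OF cK False cont] by auto
    have "hform (G (fst x0)) (snd x0 - fst x0) \<noteq> 0"
      using tangent_hyperplane_supporting[of "fst x0" "snd x0"] x0(1) assms by (auto simp: K_def)
    then show ?thesis using x0(2)
      by (intro that[of "cmod (hform (G (fst x0)) (snd x0 - fst x0))"]) (force simp: K_def)+
  qed
qed

end

section \<open>Points cut off by caps\<close>

locale cut_domain = C_convex_domain \<rho> G D H
  for \<rho> :: "complex ^ 'd \<Rightarrow> real" and G D H +
  fixes g :: "complex ^ 'd \<Rightarrow> real" and \<delta> :: "nat \<Rightarrow> real"
  assumes cont_g: "continuous_on (frontier D) g"
    and g_pos: "\<And>w. w \<in> frontier D \<Longrightarrow> 0 < g w"
    and \<delta>_pos: "\<And>n. 0 < \<delta> n" and \<delta>_lim: "\<delta> \<longlonglongrightarrow> 0"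
begin

text \<open>Caps have depth \<open>g \<delta>\<close> in the normal direction. Measured by \<open>- \<rho>\<close> this is \<open>weight\<close> times \<open>\<delta>\<close>.\<close>

definition weight :: "complex ^ 'd \<Rightarrow> real" where
  "weight w = (if w \<in> frontier D then norm (G w) * g w else 0)"

definition cut_off :: "nat \<Rightarrow> complex ^ 'd \<Rightarrow> complex ^ 'd \<Rightarrow> bool" where
  "cut_off n z w \<longleftrightarrow> cmod (hform (G w) (w - z)) \<le> weight w * \<delta> n"

lemma cont_weight: "continuous_on (frontier D) weight"
proof -
  have "continuous_on (frontier D) (\<lambda>w. norm (G w) * g w)"
    by (intro continuous_intros cont_g continuous_on_subset[OF contG]) auto
  then show ?thesis by (rule continuous_on_eq) (simp add: weight_def)
qed

lemma weight_nonneg: "0 \<le> weight w"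
  using g_pos by (auto simp: weight_def less_imp_le)

lemma weight_measurable [measurable]: "weight \<in> borel_measurable borel"
proof -
  have "continuous_on (frontier D) (\<lambda>w. norm (G w) * g w)"
    by (intro continuous_intros cont_g continuous_on_subset[OF contG]) auto
  then have "(\<lambda>w. if w \<in> frontier D then norm (G w) * g w else 0) \<in> borel_measurable borel"
    by (intro borel_measurable_continuous_on_if) auto
  then show ?thesis unfolding weight_def[abs_def] .
qed

lemma weight_bound:
  obtains B where "B > 0" "\<And>w. weight w \<le> B"
proof -
  have "compact (weight ` frontier D)" using cont_weight compact_frontier_D by (rule compact_continuous_image)
  then have "bounded (weight ` frontier D)" by (rule compact_imp_bounded)
  then obtain B where B: "B > 0" "\<forall>x\<in>weight ` frontier D. norm x \<le> B" unfolding bounded_pos by blast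
  have "weight w \<le> B" for w
  proof (cases "w \<in> frontier D")
    case True
    then have "norm (weight w) \<le> B" using B(2) by blast
    then show ?thesis by simp
  qed (use B(1) in \<open>simp add: weight_def\<close>)
  with B(1) show ?thesis by (rule that)
qed

text \<open>For small \<open>\<delta>\<close> the pairing of a cap's centre with a point cut off is below its minimum over distant
  pairs, so the basic estimate applies.\<close>

lemma cut_off_near:
  obtains A C where "A > 0" "C \<ge> 0"
    "\<forall>\<^sub>F n in sequentially. \<forall>w\<in>frontier D. \<forall>z\<in>closure D. cut_off n z w \<longrightarrow>
       (dist w z)\<^sup>2 \<le> A * \<delta> n \<and> - \<rho> z \<le> weight w * \<delta> n * (1 + C * dist w z)"
proof -
  obtain r c C where KE: "r > 0" "c > 0" "C \<ge> 0"
    "\<And>w u. w \<in> frontier D \<Longrightarrow> norm u \<le> r \<Longrightarrow>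
      c * (norm u)\<^sup>2 - \<rho> (w + u) \<le> cmod (hform (G w) u) * (1 + C * norm u)"
    by (rule tangent_pairing_estimate) (rule that)
  obtain m where m: "m > 0"
    "\<And>w z. w \<in> frontier D \<Longrightarrow> z \<in> closure D \<Longrightarrow> r \<le> dist w z \<Longrightarrow> m \<le> cmod (hform (G w) (z - w))"
    by (rule tangent_pairing_separated[OF KE(1)]) (rule that)
  obtain B where B: "B > 0" "\<And>w. weight w \<le> B" by (rule weight_bound) (rule that)
  define A where "A = B * (1 + C * r) / c"
  have "A > 0" using B KE by (simp add: A_def add_pos_nonneg)
  have "\<forall>\<^sub>F n in sequentially. B * \<delta> n < m"
    using tendsto_mult_right_zero[OF \<delta>_lim, of B] m(1) by (rule order_tendstoD(2))
  then have "\<forall>\<^sub>F n in sequentially. \<forall>w\<in>frontier D. \<forall>z\<in>closure D. cut_off n z w \<longrightarrow>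
       (dist w z)\<^sup>2 \<le> A * \<delta> n \<and> - \<rho> z \<le> weight w * \<delta> n * (1 + C * dist w z)"
  proof eventually_elim
    case (elim n)
    show ?case
    proof (intro ballI impI)
      fix w z assume w: "w \<in> frontier D" and z: "z \<in> closure D" and cut: "cut_off n z w"
      define u where "u = z - w"
      have "hform (G w) (w - z) = - hform (G w) u" unfolding u_def hform_minus[symmetric] by simp
      then have q: "cmod (hform (G w) u) \<le> weight w * \<delta> n" using cut by (simp add: cut_off_def)
      also have qB: "\<dots> \<le> B * \<delta> n" using B(2) \<delta>_pos[of n] by (intro mult_right_mono) auto
      finally have "\<not> r \<le> dist w z" using m(2)[OF w z] elim unfolding u_def by linarith
      then have ur: "norm u \<le> r" by (simp add: u_def dist_norm norm_minus_commute)
      have "c * (norm u)\<^sup>2 - \<rho> z \<le> cmod (hform (G w) u) * (1 + C * norm u)"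
        using KE(4)[OF w ur] by (simp add: u_def)
      also have "\<dots> \<le> weight w * \<delta> n * (1 + C * norm u)"
        using q KE(3) by (intro mult_right_mono) auto
      finally have main: "c * (norm u)\<^sup>2 - \<rho> z \<le> weight w * \<delta> n * (1 + C * norm u)" .
      have "weight w * \<delta> n * (1 + C * norm u) \<le> B * \<delta> n * (1 + C * r)"
        using qB ur KE(1,3) B(1) \<delta>_pos[of n] by (intro mult_mono add_left_mono mult_left_mono) auto
      moreover have "\<rho> z \<le> 0" using z by (rule closure_le)
      ultimately have "c * (norm u)\<^sup>2 \<le> B * \<delta> n * (1 + C * r)" using main by linarith
      then have "(norm u)\<^sup>2 \<le> A * \<delta> n" using KE(2) by (simp add: A_def field_simps)
      moreover have "- \<rho> z \<le> weight w * \<delta> n * (1 + C * norm u)"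
      proof -
        have "0 \<le> c * (norm u)\<^sup>2" using KE(2) by simp
        then show ?thesis using main by linarith
      qed
      ultimately show "(dist w z)\<^sup>2 \<le> A * \<delta> n \<and> - \<rho> z \<le> weight w * \<delta> n * (1 + C * dist w z)"
        by (simp add: u_def dist_norm norm_minus_commute)
    qed
  qed
  with \<open>A > 0\<close> KE(3) show ?thesis by (rule that)
qed

definition cuttable :: "nat \<Rightarrow> (complex ^ 'd) set" where
  "cuttable n = {z \<in> D. \<exists>w\<in>frontier D. cut_off n z w}"

lemma cuttable_measurable [measurable]: "cuttable n \<in> sets borel"
proof -
  let ?T = "{x \<in> frontier D \<times> UNIV. cmod (hform (G (fst x)) (fst x - snd x)) \<le> weight (fst x) * \<delta> n}"
  have "closed ?T"
    by (intro continuous_on_closed_Collect_le continuous_intros continuous_on_compose2[OF contG]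
          continuous_on_compose2[OF cont_weight] closed_Times)
       (auto simp: compact_imp_closed[OF compact_frontier_D])
  from closed_compact_projection[OF compact_frontier_D this]
  have "closed {z. \<exists>w. w \<in> frontier D \<and> (w, z) \<in> ?T}" .
  moreover have "cuttable n = D \<inter> {z. \<exists>w. w \<in> frontier D \<and> (w, z) \<in> ?T}"
    by (auto simp: cuttable_def cut_off_def)
  ultimately show ?thesis using open_D by (auto intro: borel_open borel_closed)
qed

lemma cuttable_near_frontier:
  obtains C where "C \<ge> 0" "\<forall>\<^sub>F n in sequentially. \<forall>z\<in>cuttable n. \<exists>y\<in>frontier D. dist z y \<le> C * \<delta> n"
proof -
  obtain A C where AC: "A > 0" "C \<ge> 0" and ev: "\<forall>\<^sub>F n in sequentially. \<forall>w\<in>frontier D. \<forall>z\<in>closure D. cut_off n z w \<longrightarrow>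
       (dist w z)\<^sup>2 \<le> A * \<delta> n \<and> - \<rho> z \<le> weight w * \<delta> n * (1 + C * dist w z)"
    by (rule cut_off_near) (rule that)
  obtain B where B: "B > 0" "\<And>w. weight w \<le> B" by (rule weight_bound) (rule that)
  obtain E where E: "E > 0" "\<And>z. z \<in> D \<Longrightarrow> \<exists>y\<in>frontier D. dist z y \<le> E * - \<rho> z"
    by (rule boundary_distance_le) (rule that)
  have "\<forall>\<^sub>F n in sequentially. A * \<delta> n < 1"
    using tendsto_mult_right_zero[OF \<delta>_lim, of A] by (rule order_tendstoD(2)) simp
  with ev have "\<forall>\<^sub>F n in sequentially. \<forall>z\<in>cuttable n. \<exists>y\<in>frontier D. dist z y \<le> (E * (B * (1 + C))) * \<delta> n"
  proof eventually_elim
    case (elim n)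
    show ?case
    proof
      fix z assume "z \<in> cuttable n"
      then obtain w where z: "z \<in> D" and w: "w \<in> frontier D" "cut_off n z w" by (auto simp: cuttable_def)
      have "(dist w z)\<^sup>2 \<le> A * \<delta> n \<and> - \<rho> z \<le> weight w * \<delta> n * (1 + C * dist w z)"
        using elim(1) w z closure_subset by blast
      then have 1: "(dist w z)\<^sup>2 \<le> 1" "- \<rho> z \<le> weight w * \<delta> n * (1 + C * dist w z)" using elim(2) by auto
      have d1: "dist w z \<le> 1" using 1(1) by (simp add: power_le_one_iff)
      have "weight w * \<delta> n * (1 + C * dist w z) \<le> B * \<delta> n * (1 + C * 1)"
        using B d1 AC(2) \<delta>_pos[of n] by (intro mult_mono add_left_mono mult_left_mono) auto
      then have "- \<rho> z \<le> B * (1 + C) * \<delta> n" using 1(2) by (simp add: mult.commute mult.left_commute)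
      then have "E * - \<rho> z \<le> E * (B * (1 + C) * \<delta> n)" using E(1) by (intro mult_left_mono) auto
      moreover obtain y where "y \<in> frontier D" "dist z y \<le> E * - \<rho> z" using E(2)[OF z] by blast
      ultimately show "\<exists>y\<in>frontier D. dist z y \<le> (E * (B * (1 + C))) * \<delta> n"
        by (intro bexI[of _ y]) (auto simp: mult.assoc)
    qed
  qed
  moreover have "E * (B * (1 + C)) \<ge> 0" using E(1) B(1) AC(2) by simp
  ultimately show ?thesis using that by blast
qed

text \<open>Below the depth \<open>weight\<close> no cap reaches: a cap cutting off such a point would have its centre
  close to \<open>p\<close>, hence nearly the same weight, and the linear term of the basic estimate would be too
  small.\<close>

lemma not_cuttable:
  assumes p: "p \<in> frontier D" and s: "s \<noteq> 0" and out: "s * (G p \<bullet> b) < 0 \<or> weight p < s * (G p \<bullet> b)"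
  shows "\<forall>\<^sub>F n in sequentially. p - (s * \<delta> n) *\<^sub>R b \<notin> cuttable n"
proof -
  define q where "q n = p - (s * \<delta> n) *\<^sub>R b" for n
  define a where "a = s * (G p \<bullet> b)"
  have lim: "(\<lambda>n. \<rho> (q n) / \<delta> n) \<longlonglongrightarrow> - a"
    unfolding q_def a_def by (rule rho_quotient_limit[OF \<delta>_pos \<delta>_lim p s])
  show ?thesis
  proof (cases "a < 0")
    case True
    then have "\<forall>\<^sub>F n in sequentially. \<rho> (q n) / \<delta> n > 0" using lim by (intro order_tendstoD(1)) auto
    then show ?thesis unfolding q_def[symmetric]
    proof eventually_elim
      case (elim n)
      then have "0 < \<rho> (q n)" using \<delta>_pos[of n] by (simp add: zero_less_divide_iff)
      then have "q n \<notin> D" by (simp add: D_eq)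
      then show ?case by (simp add: cuttable_def)
    qed
  next
    case False
    then have L: "weight p < a" using out by (simp add: a_def)
    define \<eta> where "\<eta> = (a - weight p) / 3"
    have \<eta>: "\<eta> > 0" using L by (simp add: \<eta>_def)
    obtain r where r: "r > 0" "\<And>w. w \<in> frontier D \<Longrightarrow> dist w p < r \<Longrightarrow> dist (weight w) (weight p) < \<eta>"
      using cont_weight p \<eta> unfolding continuous_on_iff by blast
    obtain A C where AC: "A > 0" "C \<ge> 0" and ev: "\<forall>\<^sub>F n in sequentially. \<forall>w\<in>frontier D. \<forall>z\<in>closure D. cut_off n z w \<longrightarrow>
         (dist w z)\<^sup>2 \<le> A * \<delta> n \<and> - \<rho> z \<le> weight w * \<delta> n * (1 + C * dist w z)"
      by (rule cut_off_near) (rule that)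
    have 1: "\<forall>\<^sub>F n in sequentially. sqrt (A * \<delta> n) + norm ((s * \<delta> n) *\<^sub>R b) < r"
    proof -
      have "(\<lambda>n. sqrt (A * \<delta> n) + norm ((s * \<delta> n) *\<^sub>R b)) \<longlonglongrightarrow> sqrt (A * 0) + norm ((s * 0) *\<^sub>R b)"
        by (intro tendsto_intros \<delta>_lim)
      then show ?thesis using r(1) by (intro order_tendstoD(2)) auto
    qed
    have 2: "\<forall>\<^sub>F n in sequentially. (weight p + \<eta>) * (1 + C * sqrt (A * \<delta> n)) < weight p + 2 * \<eta>"
    proof -
      have "(\<lambda>n. (weight p + \<eta>) * (1 + C * sqrt (A * \<delta> n))) \<longlonglongrightarrow> (weight p + \<eta>) * (1 + C * sqrt (A * 0))"
        by (intro tendsto_intros \<delta>_lim)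
      then show ?thesis using \<eta> by (intro order_tendstoD(2)) auto
    qed
    have 3: "\<forall>\<^sub>F n in sequentially. \<rho> (q n) / \<delta> n < - (weight p + 2 * \<eta>)"
    proof (rule order_tendstoD(2)[OF lim])
      have "3 * \<eta> = a - weight p" by (simp add: \<eta>_def)
      then show "- a < - (weight p + 2 * \<eta>)" using \<eta> by linarith
    qed
    from ev 1 2 3 show ?thesis unfolding q_def[symmetric]
    proof eventually_elim
      case (elim n)
      show ?case
      proof
        assume "q n \<in> cuttable n"
        then obtain w where w: "q n \<in> D" "w \<in> frontier D" "cut_off n (q n) w" by (auto simp: cuttable_def)
        then have "q n \<in> closure D" using closure_subset by blast
        then have *: "(dist w (q n))\<^sup>2 \<le> A * \<delta> n" "- \<rho> (q n) \<le> weight w * \<delta> n * (1 + C * dist w (q n))"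
          using elim(1) w by blast+
        have d: "dist w (q n) \<le> sqrt (A * \<delta> n)" using *(1) by (rule real_le_rsqrt)
        have "dist w p \<le> dist w (q n) + dist (q n) p" by (rule dist_triangle)
        also have "dist (q n) p = norm ((s * \<delta> n) *\<^sub>R b)" by (simp add: q_def dist_norm)
        finally have "dist w p < r" using d elim(2) by linarith
        then have wt: "weight w \<le> weight p + \<eta>" using r(2)[OF w(2)] by (simp add: dist_real_def abs_less_iff)
        have "weight w * (1 + C * dist w (q n)) \<le> (weight p + \<eta>) * (1 + C * sqrt (A * \<delta> n))"
          using wt d AC(2) weight_nonneg[of p] \<eta> by (intro mult_mono add_left_mono mult_left_mono) auto
        then have "weight w * (1 + C * dist w (q n)) < weight p + 2 * \<eta>" using elim(3) by linarith
        then have "weight w * (1 + C * dist w (q n)) * \<delta> n < (weight p + 2 * \<eta>) * \<delta> n"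
          using \<delta>_pos[of n] by (rule mult_strict_right_mono)
        then have "- \<rho> (q n) < (weight p + 2 * \<eta>) * \<delta> n" using *(2) by (simp add: mult.commute mult.left_commute)
        moreover have "\<rho> (q n) < - (weight p + 2 * \<eta>) * \<delta> n" using elim(4) \<delta>_pos[of n] by (simp add: pos_divide_less_eq)
        ultimately show False by simp
      qed
    qed
  qed
qed

lemma eventually_in_D:
  assumes p: "p \<in> frontier D" and s: "0 < s * (G p \<bullet> b)"
  shows "\<forall>\<^sub>F n in sequentially. p - (s * \<delta> n) *\<^sub>R b \<in> D"
proof -
  have "(\<lambda>n. \<rho> (p - (s * \<delta> n) *\<^sub>R b) / \<delta> n) \<longlonglongrightarrow> - (s * (G p \<bullet> b))"
    by (rule rho_quotient_limit[OF \<delta>_pos \<delta>_lim p]) (use s in auto)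
  then have "\<forall>\<^sub>F n in sequentially. \<rho> (p - (s * \<delta> n) *\<^sub>R b) / \<delta> n < 0" using s by (intro order_tendstoD(2)) auto
  then show ?thesis
  proof eventually_elim
    case (elim n)
    then show ?case using \<delta>_pos[of n] by (simp add: D_eq divide_less_0_iff)
  qed
qed

text \<open>Weights squeezed below the cuttable set form a boundary layer of thickness \<open>weight\<close> as soon as they
  tend to one at the points that some cap can still reach.\<close>

lemma boundary_layer_cut:
  assumes meas: "\<And>n. u n \<in> borel_measurable borel" and u: "\<And>n z. 0 \<le> u n z" "\<And>n z. u n z \<le> indicat_real (cuttable n) z"
    and low: "\<And>p b s. p \<in> frontier D \<Longrightarrow> b \<in> Basis \<Longrightarrow> 0 < s * (G p \<bullet> b) \<Longrightarrow> s * (G p \<bullet> b) < weight p \<Longrightarrow>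
       (\<lambda>n. u n (p - (s * \<delta> n) *\<^sub>R b)) \<longlonglongrightarrow> 1"
  shows "boundary_layer \<delta> u weight"
  unfolding boundary_layer_def
proof (intro conjI allI ballI impI)
  obtain C where C: "C \<ge> 0" "\<forall>\<^sub>F n in sequentially. \<forall>z\<in>cuttable n. \<exists>y\<in>frontier D. dist z y \<le> C * \<delta> n"
    by (rule cuttable_near_frontier) (rule that)
  have zero: "u n z = 0" if "z \<notin> cuttable n" for n z using u[of n z] that by simp
  show "\<exists>C\<ge>0. \<forall>\<^sub>F n in sequentially. \<forall>z. u n z \<noteq> 0 \<longrightarrow> (\<exists>y\<in>frontier D. dist z y \<le> C * \<delta> n)"
    using C zero by (intro exI[of _ C] conjI) (auto elim!: eventually_mono)
  show "u n z \<le> 1" for n z using u(2)[of n z] by (rule order_trans) (simp add: indicator_def)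
  fix p b s assume p: "p \<in> frontier D" "b \<in> Basis" and s: "s \<noteq> 0" "G p \<bullet> b \<noteq> 0" "s * (G p \<bullet> b) \<noteq> weight p"
  show "(\<lambda>n. u n (p - (s * \<delta> n) *\<^sub>R b))
      \<longlonglongrightarrow> (if 0 < s * (G p \<bullet> b) \<and> s * (G p \<bullet> b) < weight p then 1 else 0)"
  proof (cases "0 < s * (G p \<bullet> b) \<and> s * (G p \<bullet> b) < weight p")
    case True
    then show ?thesis using low[OF p] by simp
  next
    case False
    have "s * (G p \<bullet> b) \<noteq> 0" using s by simp
    with False s have "s * (G p \<bullet> b) < 0 \<or> weight p < s * (G p \<bullet> b)" by linarith
    from not_cuttable[OF p(1) s(1) this]
    have "\<forall>\<^sub>F n in sequentially. u n (p - (s * \<delta> n) *\<^sub>R b) = 0" by eventually_elim (rule zero)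
    moreover have "(if 0 < s * (G p \<bullet> b) \<and> s * (G p \<bullet> b) < weight p then 1 else 0) = (0::real)" using False by simp
    ultimately show ?thesis by (simp only: tendsto_eventually)
  qed
qed (use \<delta>_pos \<delta>_lim meas u weight_nonneg in auto)

end

subsection \<open>The area of a cap\<close>

text \<open>The set is a strip of width \<open>\<tau>\<^sup>2\<close> across a ball of radius \<open>\<tau>\<close> in the hyperplane orthogonal to \<open>e\<^sub>0\<close>, times
  a unit interval. Lines in a coordinate direction \<open>e\<^sub>1\<close> transversal to the strip meet it in segments of
  length proportional to \<open>\<tau>\<^sup>2\<close>, and the other coordinates range over intervals of length proportional
  to \<open>\<tau>\<close>.\<close>

lemma slab_strip_volume:
  fixes p c e0 e1 :: "'a::euclidean_space" and \<theta> \<kappa> :: real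
  assumes e: "e0 \<in> Basis" "e1 \<in> Basis" "e1 \<noteq> e0" and c: "c \<bullet> e0 = 0" "c \<bullet> e1 \<noteq> 0" and \<kappa>: "\<kappa> > 0"
  obtains c0 \<tau>0 where "c0 > 0" "\<tau>0 > 0"
    "\<And>\<tau>. 0 < \<tau> \<Longrightarrow> \<tau> < \<tau>0 \<Longrightarrow> ennreal (c0 * \<tau> ^ DIM('a)) \<le> emeasure lborel
       {x. 0 \<le> x \<bullet> e0 \<and> x \<bullet> e0 \<le> 1 \<and> norm (x - p - ((x - p) \<bullet> e0) *\<^sub>R e0) \<le> \<kappa> * \<tau> \<and> \<bar>c \<bullet> (x - p) + \<theta> * \<tau>\<^sup>2\<bar> \<le> \<kappa> * \<tau>\<^sup>2}"
proof -
  define N where "N = real DIM('a)"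
  define c1 where "c1 = \<bar>c \<bullet> e1\<bar>"
  define \<Sigma> where "\<Sigma> = (\<Sum>e\<in>Basis. \<bar>c \<bullet> e\<bar>)"
  have N: "N > 0" by (simp add: N_def)
  have c1: "c1 > 0" using c by (simp add: c1_def)
  have "c1 \<le> \<Sigma>" unfolding c1_def \<Sigma>_def by (rule member_le_sum) (use e in auto)
  then have \<Sigma>: "\<Sigma> > 0" "c1 \<le> \<Sigma>" using c1 by auto
  \<comment> \<open>With \<open>\<kappa>\<^sub>2 \<tau>\<close> bounding the other coordinates and \<open>\<tau> < \<tau>\<^sub>0\<close>, each of the two contributions to the coordinate
    along \<open>e\<^sub>1\<close> is at most \<open>\<kappa> \<tau> / (2 N)\<close>.\<close>
  define \<kappa>2 where "\<kappa>2 = \<kappa> * c1 / (2 * N * \<Sigma>)"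
  have \<kappa>2: "\<kappa>2 > 0" using \<kappa> c1 N \<Sigma> by (simp add: \<kappa>2_def)
  have \<kappa>2N: "\<kappa>2 \<le> \<kappa> / N"
  proof -
    have "\<kappa> * c1 / (2 * N * \<Sigma>) \<le> \<kappa> * \<Sigma> / (N * \<Sigma>)"
      using \<kappa> c1 N \<Sigma> by (intro frac_le mult_left_mono mult_right_mono) auto
    then show ?thesis using \<Sigma> by (simp add: \<kappa>2_def)
  qed
  have \<kappa>2\<Sigma>: "\<Sigma> * \<kappa>2 = c1 * \<kappa> / (2 * N)" using \<Sigma> by (simp add: \<kappa>2_def)
  define \<tau>0 where "\<tau>0 = c1 * \<kappa> / (2 * N * (\<kappa> + \<bar>\<theta>\<bar>))"
  have \<tau>0: "\<tau>0 > 0" using \<kappa> c1 N by (simp add: \<tau>0_def add_pos_nonneg)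
  define c0 where "c0 = (2 * \<kappa> / c1) * (2 * \<kappa>2) ^ (DIM('a) - 2)"
  have c0: "c0 > 0" using \<kappa> c1 \<kappa>2 by (simp add: c0_def)
  have card2: "card {e0, e1} = 2" using e by simp
  have "card {e0, e1} \<le> DIM('a)" using e by (intro card_mono) auto
  then have dim2: "2 \<le> DIM('a)" using card2 by simp
  show ?thesis
  proof (rule that[OF c0 \<tau>0])
    fix \<tau> :: real assume \<tau>: "0 < \<tau>" "\<tau> < \<tau>0"
    define B where "B = {x. 0 \<le> x \<bullet> e0 \<and> x \<bullet> e0 \<le> 1 \<and> norm (x - p - ((x - p) \<bullet> e0) *\<^sub>R e0) \<le> \<kappa> * \<tau> \<and> \<bar>c \<bullet> (x - p) + \<theta> * \<tau>\<^sup>2\<bar> \<le> \<kappa> * \<tau>\<^sup>2}"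
    have "closed B" unfolding B_def by (intro closed_Collect_conj closed_Collect_le continuous_intros)
    then have [measurable]: "B \<in> sets borel" by (rule borel_closed)
    define lf where "lf e = (if e \<in> {e0, e1} then 0 else p \<bullet> e - \<kappa>2 * \<tau>)" for e
    define uf where "uf e = (if e \<in> {e0, e1} then 1 else p \<bullet> e + \<kappa>2 * \<tau>)" for e
    define l where "l = (\<Sum>e\<in>Basis. lf e *\<^sub>R e)"
    define u where "u = (\<Sum>e\<in>Basis. uf e *\<^sub>R e)"
    have lu: "l \<bullet> e = lf e" "u \<bullet> e = uf e" if "e \<in> Basis" for e using that by (auto simp: l_def u_def)
    define Q where "Q = cbox l u"
    have \<kappa>\<tau>: "0 < \<kappa>2 * \<tau>" using \<kappa>2 \<tau> by simp
    have "emeasure lborel Q = ennreal (\<Prod>e\<in>Basis. (u - l) \<bullet> e)"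
      unfolding Q_def using \<kappa>\<tau> lu by (subst emeasure_lborel_cbox) (auto simp: lf_def uf_def)
    also have "(\<Prod>e\<in>Basis. (u - l) \<bullet> e) = (\<Prod>e\<in>Basis. if e \<in> {e0, e1} then 1 else 2 * \<kappa>2 * \<tau>)"
      by (intro prod.cong) (auto simp: inner_diff_left lu lf_def uf_def)
    also have "\<dots> = (2 * \<kappa>2 * \<tau>) ^ card (Basis - {e0, e1})"
      by (subst prod.If_cases) (simp_all add: Diff_eq del: insert_iff)
    also have "card (Basis - {e0, e1}) = DIM('a) - 2"
      using e card2 by (subst card_Diff_subset) auto
    finally have Q: "emeasure lborel Q = ennreal ((2 * \<kappa>2 * \<tau>) ^ (DIM('a) - 2))" .
    have inB: "x + t *\<^sub>R e1 \<in> B" if x: "x \<in> Q" and t: "\<bar>c \<bullet> (x - p) + \<theta> * \<tau>\<^sup>2 + t * (c \<bullet> e1)\<bar> \<le> \<kappa> * \<tau>\<^sup>2" for x t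
    proof -
      define x' where "x' = x + t *\<^sub>R e1"
      have xe: "lf e \<le> x \<bullet> e" "x \<bullet> e \<le> uf e" if "e \<in> Basis" for e
        using x that lu by (auto simp: Q_def mem_box)
      have e10: "e1 \<bullet> e0 = 0" using e by (simp add: inner_Basis)
      have 1: "0 \<le> x' \<bullet> e0" "x' \<bullet> e0 \<le> 1"
        using xe[OF e(1)] e10 by (auto simp: x'_def inner_add_left lf_def uf_def)
      have cx: "c \<bullet> (x' - p) = c \<bullet> (x - p) + t * (c \<bullet> e1)"
        by (simp add: x'_def inner_diff_right inner_add_right algebra_simps)
      have 2: "\<bar>c \<bullet> (x' - p) + \<theta> * \<tau>\<^sup>2\<bar> \<le> \<kappa> * \<tau>\<^sup>2" using t unfolding cx by (simp add: algebra_simps)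
      have other: "\<bar>(x' - p) \<bullet> e\<bar> \<le> \<kappa>2 * \<tau>" if "e \<in> Basis" "e \<noteq> e0" "e \<noteq> e1" for e
        using xe[OF that(1)] that e by (auto simp: x'_def lf_def uf_def inner_diff_left inner_add_left inner_Basis abs_le_iff)
      have "c \<bullet> (x' - p) = (\<Sum>e\<in>Basis. (c \<bullet> e) * ((x' - p) \<bullet> e))" by (rule euclidean_inner)
      also have "\<dots> = (c \<bullet> e1) * ((x' - p) \<bullet> e1) + (\<Sum>e\<in>Basis - {e1}. (c \<bullet> e) * ((x' - p) \<bullet> e))"
        using e by (intro sum.remove) auto
      finally have split: "(c \<bullet> e1) * ((x' - p) \<bullet> e1) = c \<bullet> (x' - p) - (\<Sum>e\<in>Basis - {e1}. (c \<bullet> e) * ((x' - p) \<bullet> e))"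
        by simp
      have "\<bar>\<Sum>e\<in>Basis - {e1}. (c \<bullet> e) * ((x' - p) \<bullet> e)\<bar> \<le> (\<Sum>e\<in>Basis - {e1}. \<bar>c \<bullet> e\<bar> * (\<kappa>2 * \<tau>))"
      proof (rule order_trans[OF sum_abs sum_mono])
        fix e assume "e \<in> Basis - {e1}"
        then show "\<bar>(c \<bullet> e) * ((x' - p) \<bullet> e)\<bar> \<le> \<bar>c \<bullet> e\<bar> * (\<kappa>2 * \<tau>)"
          using other[of e] c(1) by (cases "e = e0") (auto simp: abs_mult intro: mult_left_mono)
      qed
      also have "\<dots> \<le> \<Sigma> * (\<kappa>2 * \<tau>)"
        unfolding sum_distrib_right[symmetric] \<Sigma>_def using \<kappa>\<tau> by (intro mult_right_mono sum_mono2) auto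
      also have "\<dots> = c1 * \<kappa> / (2 * N) * \<tau>" unfolding \<kappa>2\<Sigma>[symmetric] by simp
      finally have s1: "\<bar>\<Sum>e\<in>Basis - {e1}. (c \<bullet> e) * ((x' - p) \<bullet> e)\<bar> \<le> c1 * \<kappa> / (2 * N) * \<tau>" .
      have "\<bar>c \<bullet> (x' - p)\<bar> \<le> \<kappa> * \<tau>\<^sup>2 + \<bar>\<theta> * \<tau>\<^sup>2\<bar>" using 2 by linarith
      also have "\<dots> = ((\<kappa> + \<bar>\<theta>\<bar>) * \<tau>) * \<tau>" by (simp add: abs_mult power2_eq_square algebra_simps)
      also have "\<dots> \<le> ((\<kappa> + \<bar>\<theta>\<bar>) * \<tau>0) * \<tau>" using \<tau> \<kappa> by (intro mult_right_mono mult_left_mono) auto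
      also have "(\<kappa> + \<bar>\<theta>\<bar>) * \<tau>0 = c1 * \<kappa> / (2 * N)"
      proof -
        have "\<kappa> + \<bar>\<theta>\<bar> \<noteq> 0" using \<kappa> by linarith
        then show ?thesis by (simp add: \<tau>0_def)
      qed
      finally have s2: "\<bar>c \<bullet> (x' - p)\<bar> \<le> c1 * \<kappa> / (2 * N) * \<tau>" .
      have "c1 * \<bar>(x' - p) \<bullet> e1\<bar> = \<bar>(c \<bullet> e1) * ((x' - p) \<bullet> e1)\<bar>" by (simp add: c1_def abs_mult)
      also have "\<dots> \<le> c1 * \<kappa> / (2 * N) * \<tau> + c1 * \<kappa> / (2 * N) * \<tau>" unfolding split using s1 s2 by linarith
      also have "\<dots> = c1 * (\<kappa> / N * \<tau>)" using N by (simp add: field_simps)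
      finally have d1: "\<bar>(x' - p) \<bullet> e1\<bar> \<le> \<kappa> / N * \<tau>" using c1 by (rule mult_left_le_imp_le)
      define y where "y = x' - p - ((x' - p) \<bullet> e0) *\<^sub>R e0"
      have ye: "\<bar>y \<bullet> e\<bar> \<le> \<kappa> / N * \<tau>" if "e \<in> Basis" for e
      proof -
        have ye: "y \<bullet> e = (if e = e0 then 0 else (x' - p) \<bullet> e)"
          using that e by (simp add: y_def inner_diff_left inner_Basis)
        have "\<kappa>2 * \<tau> \<le> \<kappa> / N * \<tau>" using \<kappa>2N \<tau> by (intro mult_right_mono) auto
        moreover have "0 \<le> \<kappa> / N * \<tau>" using \<kappa> N \<tau> by simp
        ultimately show ?thesis unfolding ye using d1 other[OF that] by (cases "e = e0"; cases "e = e1"; simp; linarith)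
      qed
      have "norm y \<le> (\<Sum>e\<in>Basis. \<bar>y \<bullet> e\<bar>)" by (rule norm_le_l1)
      also have "\<dots> \<le> (\<Sum>e\<in>(Basis :: 'a set). \<kappa> / N * \<tau>)" using ye by (rule sum_mono)
      also have "\<dots> = \<kappa> * \<tau>" using N by (simp add: N_def)
      finally show ?thesis using 1 2 unfolding B_def y_def x'_def by simp
    qed
    have "ennreal (c0 * \<tau> ^ DIM('a)) = ennreal (2 * \<kappa> * \<tau>\<^sup>2 / c1) * emeasure lborel Q"
    proof -
      have "\<tau> ^ DIM('a) = \<tau>\<^sup>2 * \<tau> ^ (DIM('a) - 2)" using dim2 by (metis le_add_diff_inverse power_add)
      then have "c0 * \<tau> ^ DIM('a) = (2 * \<kappa> * \<tau>\<^sup>2 / c1) * (2 * \<kappa>2 * \<tau>) ^ (DIM('a) - 2)"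
        by (simp add: c0_def power_mult_distrib)
      then show ?thesis unfolding Q using \<kappa> c1 \<kappa>2 \<tau> by (simp add: ennreal_mult[symmetric])
    qed
    also have "\<dots> = (\<integral>\<^sup>+ x. ennreal (2 * \<kappa> * \<tau>\<^sup>2 / c1) * indicator Q x \<partial>lborel)"
      by (rule nn_integral_cmult_indicator[symmetric]) (simp add: Q_def)
    also have "\<dots> \<le> (\<integral>\<^sup>+ x. indicator {0..1} (x \<bullet> e1) * (\<integral>\<^sup>+ t. indicator B (x + t *\<^sub>R e1) \<partial>lborel) \<partial>lborel)"
    proof (rule nn_integral_mono)
      fix x :: 'a
      show "ennreal (2 * \<kappa> * \<tau>\<^sup>2 / c1) * indicator Q x \<le> indicator {0..1} (x \<bullet> e1) * (\<integral>\<^sup>+ t. indicator B (x + t *\<^sub>R e1) \<partial>lborel)"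
      proof (cases "x \<in> Q")
        case True
        define A where "A = c \<bullet> (x - p) + \<theta> * \<tau>\<^sup>2"
        define m where "m = - A / (c \<bullet> e1)"
        define r where "r = \<kappa> * \<tau>\<^sup>2 / c1"
        have r: "r \<ge> 0" using \<kappa> c1 by (simp add: r_def)
        have "x + t *\<^sub>R e1 \<in> B" if "t \<in> {m - r..m + r}" for t
        proof (rule inB[OF True])
          have "A + t * (c \<bullet> e1) = (t - m) * (c \<bullet> e1)" using c(2) by (simp add: m_def field_simps)
          then have "\<bar>A + t * (c \<bullet> e1)\<bar> = \<bar>t - m\<bar> * c1" by (simp add: abs_mult c1_def)
          also have "\<dots> \<le> r * c1" using that c1 by (intro mult_right_mono) auto
          also have "r * c1 = \<kappa> * \<tau>\<^sup>2" using c1 by (simp add: r_def)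
          finally show "\<bar>c \<bullet> (x - p) + \<theta> * \<tau>\<^sup>2 + t * (c \<bullet> e1)\<bar> \<le> \<kappa> * \<tau>\<^sup>2" unfolding A_def .
        qed
        then have "(\<integral>\<^sup>+ t. indicator {m - r..m + r} t \<partial>lborel) \<le> (\<integral>\<^sup>+ t. indicator B (x + t *\<^sub>R e1) \<partial>lborel)"
          by (intro nn_integral_mono) (auto simp: indicator_def)
        moreover have "(\<integral>\<^sup>+ t. indicator {m - r..m + r} t \<partial>lborel) = ennreal (2 * \<kappa> * \<tau>\<^sup>2 / c1)"
          using r by (simp add: r_def)
        moreover have "x \<bullet> e1 \<in> {0..1}" using True e(2) lu by (auto simp: Q_def mem_box lf_def uf_def)
        ultimately show ?thesis using True by simp
      qed simp
    qed
    also have "\<dots> = (\<integral>\<^sup>+ x. indicator B x \<partial>lborel)"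
      by (rule nn_integral_lborel_slab[symmetric]) (use e in auto)
    finally show "ennreal (c0 * \<tau> ^ DIM('a)) \<le> emeasure lborel
       {x. 0 \<le> x \<bullet> e0 \<and> x \<bullet> e0 \<le> 1 \<and> norm (x - p - ((x - p) \<bullet> e0) *\<^sub>R e0) \<le> \<kappa> * \<tau> \<and> \<bar>c \<bullet> (x - p) + \<theta> * \<tau>\<^sup>2\<bar> \<le> \<kappa> * \<tau>\<^sup>2}"
      unfolding B_def[symmetric] by simp
  qed
qed

context cut_domain
begin

lemma cutters_measurable: "{w \<in> frontier D. cut_off n z w} \<in> sets borel"
proof -
  have "closed {w \<in> frontier D. cmod (hform (G w) (w - z)) \<le> weight w * \<delta> n}"
    by (intro continuous_on_closed_Collect_le continuous_intros continuous_on_compose2[OF contG] cont_weight)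
       (auto simp: compact_imp_closed[OF compact_frontier_D])
  then show ?thesis unfolding cut_off_def by (rule borel_closed)
qed

text \<open>A point at depth less than \<open>weight\<close> below \<open>p\<close> is cut off by all boundary points \<open>p + u\<close> for which \<open>u\<close> has
  size at most a small multiple of \<open>\<surd>\<delta>\<close> and the pairing with \<open>u\<close> has the right imaginary part up to a
  small multiple of \<open>\<delta>\<close>. The real part of the pairing takes care of itself, since it is quadratic in
  \<open>u\<close> along the boundary. In a chart these conditions describe a strip across a ball, with exponents
  adding up to \<open>\<delta>\<^sup>d\<close>.\<close>

lemma cap_area_lower_bound:
  assumes p: "p \<in> frontier D" and b: "b \<in> Basis"
    and s: "0 < s * (G p \<bullet> b)" "s * (G p \<bullet> b) < weight p"
  obtains c where "c > 0"
    "\<forall>\<^sub>F n in sequentially. ennreal (c * \<delta> n ^ CARD('d)) \<le> emeasure area {w \<in> frontier D. cut_off n (p - (s * \<delta> n) *\<^sub>R b) w}"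
proof -
  obtain ch where "graph_chart (frontier D) ch" "p \<in> chart_dom ch" by (rule chart_at_boundary_point[OF p])
  then obtain e0 V h Gh where chart: "graph_chart (frontier D) (e0, V, h, Gh)" and pV: "p \<in> V"
    by (cases ch) auto
  interpret graph_chart_of "frontier D" e0 V h Gh using chart by unfold_locales
  have e0: "e0 \<in> Basis" by (rule b_Basis)
  define a where "a = s * (G p \<bullet> b)"
  define a0 where "a0 = G p \<bullet> e0"
  have a0: "a0 \<noteq> 0" unfolding a0_def by (rule chart_slope(1)[OF chart p pV])
  \<comment> \<open>\<open>T\<close> represents the imaginary part of the pairing, and \<open>cv\<close> its restriction to the tangent space as a
    functional of the coordinates orthogonal to \<open>e\<^sub>0\<close>.\<close>
  define T where "T = \<i> *s G p"
  define cv where "cv = T - (T \<bullet> e0 / a0) *\<^sub>R G p"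
  have cv0: "cv \<bullet> e0 = 0" using a0 by (simp add: cv_def inner_diff_left a0_def)
  have "cv \<noteq> 0"
  proof
    assume "cv = 0"
    have "G p \<bullet> T = Re (hform (G p) T)" by (simp add: Re_hform)
    also have "\<dots> = 0" unfolding T_def hform_scale hform_self by simp
    finally have "cv \<bullet> T = T \<bullet> T" by (simp add: cv_def inner_diff_left)
    with \<open>cv = 0\<close> have "norm T = 0" by simp
    then have "norm (G p) = 0" unfolding T_def norm_complex_scale by simp
    then show False using G_nonzero[OF p] by simp
  qed
  then obtain e1 where e1: "e1 \<in> Basis" "cv \<bullet> e1 \<noteq> 0" using euclidean_all_zero_iff by blast
  then have "e1 \<noteq> e0" using cv0 by auto
  \<comment> \<open>Lipschitz and Taylor constants at \<open>p\<close>.\<close>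
  have "bounded (H ` cball p 1)"
    using compact_continuous_image[OF continuous_on_subset[OF contH], of "cball p 1"] compact_imp_bounded by auto
  then obtain \<Lambda> where \<Lambda>: "\<Lambda> > 0" "\<forall>x\<in>H ` cball p 1. norm x \<le> \<Lambda>" unfolding bounded_pos by blast
  have GL: "norm (G (p + u) - G p) \<le> \<Lambda> * norm u" if "norm u \<le> 1" for u
  proof -
    have "norm (G (p + u) - G p) \<le> \<Lambda> * norm ((p + u) - p)"
    proof (rule differentiable_bound[of "cball p 1" G "\<lambda>x. blinfun_apply (H x)"])
      show "(G has_derivative blinfun_apply (H x)) (at x within cball p 1)" for x
        by (rule has_derivative_at_withinI[OF G_deriv])
      show "onorm (blinfun_apply (H x)) \<le> \<Lambda>" if "x \<in> cball p 1" for x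
        using \<Lambda>(2) that by (simp add: norm_blinfun.rep_eq)
    qed (use that in \<open>auto simp: dist_norm\<close>)
    then show ?thesis by simp
  qed
  have GT: "\<bar>G p \<bullet> u\<bar> \<le> \<Lambda> * (norm u)\<^sup>2" if "p + u \<in> frontier D" "norm u \<le> 1" for u
  proof -
    obtain t where t: "0 < t" "t < 1" "\<rho> (p + u) = \<rho> p + G p \<bullet> u + (blinfun_apply (H (p + t *\<^sub>R u)) u \<bullet> u) / 2"
      by (rule rho_taylor)
    have "norm (t *\<^sub>R u) \<le> 1 * 1" unfolding norm_scaleR using t that(2) by (intro mult_mono) auto
    then have "norm (H (p + t *\<^sub>R u)) \<le> \<Lambda>" using \<Lambda>(2) by (simp add: dist_norm)
    have "\<bar>blinfun_apply (H (p + t *\<^sub>R u)) u \<bullet> u\<bar> \<le> norm (blinfun_apply (H (p + t *\<^sub>R u)) u) * norm u"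
      by (rule Cauchy_Schwarz_ineq2)
    also have "\<dots> \<le> (norm (H (p + t *\<^sub>R u)) * norm u) * norm u" by (intro mult_right_mono norm_blinfun) auto
    also have "\<dots> \<le> (\<Lambda> * norm u) * norm u" using \<open>norm (H (p + t *\<^sub>R u)) \<le> \<Lambda>\<close> by (intro mult_right_mono) auto
    finally have "\<bar>blinfun_apply (H (p + t *\<^sub>R u)) u \<bullet> u\<bar> \<le> \<Lambda> * (norm u)\<^sup>2" by (simp add: power2_eq_square)
    moreover have "G p \<bullet> u = - (blinfun_apply (H (p + t *\<^sub>R u)) u \<bullet> u) / 2"
      using t(3) frontier_zero[OF p] frontier_zero[OF that(1)] by simp
    ultimately show ?thesis by simp
  qed
  define \<Lambda>h where "\<Lambda>h = norm (Gh p) + 1"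
  obtain r1 where r1: "r1 > 0" "\<And>y. norm (y - p) < r1 \<Longrightarrow> \<bar>h y - h p\<bar> \<le> \<Lambda>h * norm (y - p)"
  proof -
    have "\<forall>e>0. \<exists>d>0. \<forall>y. norm (y - p) < d \<longrightarrow> norm (h y - h p - (y - p) \<bullet> Gh p) \<le> e * norm (y - p)"
      using h_deriv[OF pV] unfolding has_derivative_at_alt by blast
    then obtain d where d: "d > 0" "\<forall>y. norm (y - p) < d \<longrightarrow> norm (h y - h p - (y - p) \<bullet> Gh p) \<le> 1 * norm (y - p)"
      using zero_less_one by blast
    show ?thesis
    proof (rule that[OF d(1)])
      fix y assume "norm (y - p) < d"
      then have "\<bar>h y - h p - (y - p) \<bullet> Gh p\<bar> \<le> norm (y - p)" using d(2) by simp
      moreover have "\<bar>(y - p) \<bullet> Gh p\<bar> \<le> norm (y - p) * norm (Gh p)" by (rule Cauchy_Schwarz_ineq2)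
      ultimately show "\<bar>h y - h p\<bar> \<le> \<Lambda>h * norm (y - p)"
        unfolding \<Lambda>h_def distrib_right mult_1_left mult.commute[of "norm (Gh p)"] by linarith
    qed
  qed
  obtain r2 where r2: "r2 > 0" "ball p r2 \<subseteq> V" using open_V pV open_contains_ball by blast
  define \<eta> where "\<eta> = (weight p - a) / 2"
  have \<eta>: "\<eta> > 0" using s by (simp add: \<eta>_def a_def)
  obtain r3 where r3: "r3 > 0" "\<And>w. w \<in> frontier D \<Longrightarrow> dist w p < r3 \<Longrightarrow> dist (weight w) (weight p) < \<eta>"
    using cont_weight p \<eta> unfolding continuous_on_iff by blast
  define M where "M = 1 + \<Lambda>h"
  have M: "M \<ge> 1" by (simp add: M_def \<Lambda>h_def)
  define K where "K = \<bar>T \<bullet> e0 / a0\<bar>"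
  \<comment> \<open>The sum of the constants of all error terms, each of which is at most a constant times \<open>\<kappa> \<delta>\<close>.\<close>
  define Mt where "Mt = \<Lambda> * M\<^sup>2 + 1 + K * (\<Lambda> * M\<^sup>2) + \<Lambda> * M * (M + \<bar>s\<bar>)"
  have K: "K \<ge> 0" by (simp add: K_def)
  have Mt: "Mt \<ge> 1" using M \<Lambda>(1) K by (simp add: Mt_def)
  define \<kappa> where "\<kappa> = min 1 (\<eta> / Mt)"
  have \<kappa>: "0 < \<kappa>" "\<kappa> \<le> 1" "\<kappa> * Mt \<le> \<eta>" using \<eta> Mt by (auto simp: \<kappa>_def min_def field_simps)
  define \<theta> where "\<theta> = s * Im (hform (G p) b)"
  obtain c0 \<tau>0 where c0: "c0 > 0" "\<tau>0 > 0"
    "\<And>\<tau>. 0 < \<tau> \<Longrightarrow> \<tau> < \<tau>0 \<Longrightarrow> ennreal (c0 * \<tau> ^ DIM(complex ^ 'd)) \<le> emeasure lborel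
       {x. 0 \<le> x \<bullet> e0 \<and> x \<bullet> e0 \<le> 1 \<and> norm (x - p - ((x - p) \<bullet> e0) *\<^sub>R e0) \<le> \<kappa> * \<tau> \<and> \<bar>cv \<bullet> (x - p) + \<theta> * \<tau>\<^sup>2\<bar> \<le> \<kappa> * \<tau>\<^sup>2}"
    by (rule slab_strip_volume[OF e0 e1(1) \<open>e1 \<noteq> e0\<close> cv0 e1(2) \<kappa>(1), of p \<theta>]) (rule that)
  define R where "R = min 1 (min r1 (min r2 r3))"
  have R: "R > 0" using r1 r2 r3 by (simp add: R_def)
  have "(\<lambda>n. sqrt (\<delta> n)) \<longlonglongrightarrow> sqrt 0" by (intro tendsto_intros \<delta>_lim)
  then have lim: "(\<lambda>n. sqrt (\<delta> n)) \<longlonglongrightarrow> 0" by simp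
  have small: "\<forall>\<^sub>F n in sequentially. sqrt (\<delta> n) < min \<tau>0 (min 1 (R / M))"
    using c0(2) R M by (intro order_tendstoD(2)[OF lim]) auto
  show ?thesis
  proof (rule that[OF c0(1)])
    show "\<forall>\<^sub>F n in sequentially. ennreal (c0 * \<delta> n ^ CARD('d)) \<le> emeasure area {w \<in> frontier D. cut_off n (p - (s * \<delta> n) *\<^sub>R b) w}"
      using small
    proof eventually_elim
      case (elim n)
      define \<tau> where "\<tau> = sqrt (\<delta> n)"
      have \<tau>: "0 < \<tau>" "\<tau> < \<tau>0" "\<tau> \<le> 1" "M * \<tau> < R" "\<tau>\<^sup>2 = \<delta> n"
        using elim \<delta>_pos[of n] M by (auto simp: \<tau>_def pos_less_divide_eq mult.commute)
      define q where "q = p - (s * \<delta> n) *\<^sub>R b"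
      define A where "A = {w \<in> frontier D. cut_off n q w}"
      define B where "B = {x. 0 \<le> x \<bullet> e0 \<and> x \<bullet> e0 \<le> 1 \<and> norm (x - p - ((x - p) \<bullet> e0) *\<^sub>R e0) \<le> \<kappa> * \<tau> \<and> \<bar>cv \<bullet> (x - p) + \<theta> * \<tau>\<^sup>2\<bar> \<le> \<kappa> * \<tau>\<^sup>2}"
      have [measurable]: "A \<in> sets borel" "V \<in> sets borel"
        unfolding A_def using cutters_measurable open_V by (auto intro: borel_open)
      have "closed B" unfolding B_def by (intro closed_Collect_conj closed_Collect_le continuous_intros)
      then have [measurable]: "B \<in> sets borel" by (rule borel_closed)
      have foot: "x \<in> chart_shadow e0 V h \<and> chart_foot e0 h x \<in> A \<inter> V" if x: "x \<in> B" for x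
      proof -
        define y where "y = x - p - ((x - p) \<bullet> e0) *\<^sub>R e0"
        define \<beta> where "\<beta> = h (p + y) - h p"
        define u where "u = y + \<beta> *\<^sub>R e0"
        have yn: "norm y \<le> \<kappa> * \<tau>" and strip: "\<bar>cv \<bullet> (x - p) + \<theta> * \<tau>\<^sup>2\<bar> \<le> \<kappa> * \<tau>\<^sup>2" using x by (auto simp: B_def y_def)
        have "p \<in> {x \<in> V. x \<bullet> e0 = h x}" using p pV unfolding graph_eq[symmetric] by simp
        then have hp: "h p = p \<bullet> e0" by simp
        have "p + y = x + (- ((x - p) \<bullet> e0)) *\<^sub>R e0" by (simp add: y_def)
        then have hx: "h (p + y) = h x" by (simp only: h_line)
        have "u = y + (h x - p \<bullet> e0) *\<^sub>R e0" by (simp only: u_def \<beta>_def hx hp)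
        then have fu: "chart_foot e0 h x = p + u"
          by (simp add: chart_foot_def y_def inner_diff_left algebra_simps)
        have y1: "norm y \<le> \<tau>" using yn \<kappa>(1,2) \<tau>(1) by (meson mult_left_le_one_le order_trans less_imp_le)
        have "\<tau> \<le> M * \<tau>" using M \<tau>(1) by simp
        then have "norm y < r1" using y1 \<tau>(4) by (simp add: R_def)
        then have "\<bar>\<beta>\<bar> \<le> \<Lambda>h * norm y" using r1(2)[of "p + y"] by (simp add: \<beta>_def)
        moreover have "norm u \<le> norm y + \<bar>\<beta>\<bar>" using norm_triangle_ineq[of y "\<beta> *\<^sub>R e0"] e0 by (simp add: u_def)
        ultimately have uy: "norm u \<le> M * norm y" by (simp add: M_def distrib_right)
        have "M * norm y \<le> M * (\<kappa> * \<tau>)" using yn M by (intro mult_left_mono) auto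
        then have un: "norm u \<le> M * \<kappa> * \<tau>" using uy by simp
        have "M * norm y \<le> M * \<tau>" using y1 M by (intro mult_left_mono) auto
        then have uR: "norm u < R" using uy \<tau>(4) by linarith
        then have "p + u \<in> ball p r2" by (simp add: R_def dist_norm)
        then have inV: "p + u \<in> V" using r2(2) by blast
        then have sh: "x \<in> chart_shadow e0 V h" by (simp add: chart_shadow_def fu)
        have inS: "p + u \<in> frontier D" using foot_in_S[OF sh] by (simp add: fu)
        have u1: "norm u \<le> 1" using uR by (simp add: R_def)
        have usq: "(norm u)\<^sup>2 \<le> M\<^sup>2 * \<kappa> * \<tau>\<^sup>2"
        proof -
          have "(norm u)\<^sup>2 \<le> (M * \<kappa> * \<tau>)\<^sup>2" using un by (intro power_mono) auto
          also have "\<dots> = M\<^sup>2 * (\<kappa> * \<kappa>) * \<tau>\<^sup>2" by (simp add: power_mult_distrib power2_eq_square)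
          also have "\<dots> \<le> M\<^sup>2 * \<kappa> * \<tau>\<^sup>2" using \<kappa> by (intro mult_right_mono mult_left_mono) (auto simp: mult_left_le)
          finally show ?thesis .
        qed
        define \<epsilon> where "\<epsilon> = \<kappa> * \<tau>\<^sup>2"
        have \<epsilon>: "\<epsilon> > 0" using \<kappa>(1) \<tau>(1) by (simp add: \<epsilon>_def)
        have gpu: "\<bar>G p \<bullet> u\<bar> \<le> \<Lambda> * M\<^sup>2 * \<epsilon>"
        proof -
          have "\<Lambda> * (norm u)\<^sup>2 \<le> \<Lambda> * (M\<^sup>2 * \<kappa> * \<tau>\<^sup>2)" using usq \<Lambda>(1) by (intro mult_left_mono) auto
          then show ?thesis using GT[OF inS u1] by (simp add: \<epsilon>_def mult.assoc)
        qed
        \<comment> \<open>The boundary condition determines the component of \<open>u\<close> along \<open>e\<^sub>0\<close> up to second order.\<close>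
        have "G p \<bullet> u = G p \<bullet> y + \<beta> * a0" by (simp add: u_def inner_add_right a0_def)
        then have \<beta>_eq: "\<beta> = (G p \<bullet> u - G p \<bullet> y) / a0" using a0 by (simp add: field_simps)
        have cvy: "cv \<bullet> y = cv \<bullet> (x - p)" using cv0 by (simp add: y_def inner_diff_right)
        have "T \<bullet> u = T \<bullet> y + \<beta> * (T \<bullet> e0)" by (simp add: u_def inner_add_right)
        also have "\<dots> = cv \<bullet> y + (T \<bullet> e0 / a0) * (G p \<bullet> u)"
          using a0 by (simp add: \<beta>_eq cv_def inner_diff_left field_simps)
        finally have Tu: "T \<bullet> u = cv \<bullet> (x - p) + (T \<bullet> e0 / a0) * (G p \<bullet> u)" by (simp only: cvy)
        have "\<bar>(T \<bullet> e0 / a0) * (G p \<bullet> u)\<bar> \<le> K * (\<Lambda> * M\<^sup>2 * \<epsilon>)"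
          unfolding abs_mult K_def[symmetric] using gpu K by (rule mult_left_mono)
        then have im: "\<bar>T \<bullet> u + \<theta> * \<tau>\<^sup>2\<bar> \<le> \<epsilon> + K * (\<Lambda> * M\<^sup>2 * \<epsilon>)"
          using strip unfolding Tu \<epsilon>_def by linarith
        define v where "v = u + (s * \<delta> n) *\<^sub>R b"
        have vq: "p + u - q = v" by (simp add: v_def q_def)
        have reh: "Re (hform (G p) v) = G p \<bullet> u + a * \<tau>\<^sup>2"
          by (simp add: Re_hform v_def inner_add_right a_def \<tau>(5) mult.commute mult.left_commute)
        have imh: "Im (hform (G p) v) = T \<bullet> u + \<theta> * \<tau>\<^sup>2"
          unfolding v_def hform_add hform_scaleR by (simp add: Im_hform T_def \<theta>_def \<tau>(5))
        have "norm b = 1" using b by simp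
        have vn: "norm v \<le> M * \<tau> + \<bar>s\<bar> * \<tau>"
        proof -
          have "norm v \<le> norm u + norm ((s * \<delta> n) *\<^sub>R b)" unfolding v_def by (rule norm_triangle_ineq)
          also have "norm ((s * \<delta> n) *\<^sub>R b) = \<bar>s\<bar> * \<tau>\<^sup>2" using \<open>norm b = 1\<close> \<tau>(5) \<delta>_pos[of n] by (simp add: abs_mult)
          also have "\<bar>s\<bar> * \<tau>\<^sup>2 \<le> \<bar>s\<bar> * \<tau>" using \<tau>(1,3) by (intro mult_left_mono) (auto simp: power2_eq_square mult_left_le)
          also have "norm u \<le> M * \<tau>" using uy \<open>M * norm y \<le> M * \<tau>\<close> by linarith
          finally show ?thesis by simp
        qed
        have dif: "cmod (hform (G (p + u) - G p) v) \<le> \<Lambda> * M * (M + \<bar>s\<bar>) * \<epsilon>"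
        proof -
          have "cmod (hform (G (p + u) - G p) v) \<le> norm (G (p + u) - G p) * norm v" by (rule norm_hform_le)
          also have "\<dots> \<le> (\<Lambda> * (M * \<kappa> * \<tau>)) * (M * \<tau> + \<bar>s\<bar> * \<tau>)"
          proof (rule mult_mono[OF _ vn])
            have "\<Lambda> * norm u \<le> \<Lambda> * (M * \<kappa> * \<tau>)" using un \<Lambda>(1) by (intro mult_left_mono) auto
            then show "norm (G (p + u) - G p) \<le> \<Lambda> * (M * \<kappa> * \<tau>)" using GL[OF u1] by linarith
          qed (use \<Lambda>(1) M \<kappa>(1) \<tau>(1) in auto)
          also have "\<dots> = \<Lambda> * M * (M + \<bar>s\<bar>) * \<epsilon>" by (simp add: \<epsilon>_def power2_eq_square algebra_simps)
          finally show ?thesis .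
        qed
        have "hform (G (p + u)) v = hform (G p) v + hform (G (p + u) - G p) v" by (simp add: hform_diff_left)
        then have "cmod (hform (G (p + u)) v) \<le> cmod (hform (G p) v) + cmod (hform (G (p + u) - G p) v)"
          by (simp add: norm_triangle_ineq)
        also have "cmod (hform (G p) v) \<le> \<bar>Re (hform (G p) v)\<bar> + \<bar>Im (hform (G p) v)\<bar>" by (rule cmod_le)
        also have "\<bar>Re (hform (G p) v)\<bar> \<le> \<Lambda> * M\<^sup>2 * \<epsilon> + a * \<tau>\<^sup>2"
        proof -
          have "0 \<le> a * \<tau>\<^sup>2" using s(1) by (simp add: a_def)
          then show ?thesis unfolding reh using gpu by linarith
        qed
        also have "\<bar>Im (hform (G p) v)\<bar> \<le> \<epsilon> + K * (\<Lambda> * M\<^sup>2 * \<epsilon>)" unfolding imh by (rule im)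
        finally have "cmod (hform (G (p + u)) v) \<le> \<Lambda> * M\<^sup>2 * \<epsilon> + a * \<tau>\<^sup>2 + (\<epsilon> + K * (\<Lambda> * M\<^sup>2 * \<epsilon>)) + cmod (hform (G (p + u) - G p) v)"
          by simp
        also have "\<dots> \<le> \<Lambda> * M\<^sup>2 * \<epsilon> + a * \<tau>\<^sup>2 + (\<epsilon> + K * (\<Lambda> * M\<^sup>2 * \<epsilon>)) + \<Lambda> * M * (M + \<bar>s\<bar>) * \<epsilon>"
          using dif by simp
        also have "\<dots> = a * \<tau>\<^sup>2 + (\<kappa> * Mt) * \<tau>\<^sup>2" by (simp add: Mt_def \<epsilon>_def algebra_simps)
        also have "\<dots> \<le> a * \<tau>\<^sup>2 + \<eta> * \<tau>\<^sup>2" using \<kappa>(3) by (intro add_left_mono mult_right_mono) auto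
        also have "\<dots> = (weight p - \<eta>) * \<tau>\<^sup>2" by (simp add: \<eta>_def field_simps)
        also have "\<dots> \<le> weight (p + u) * \<tau>\<^sup>2"
        proof (rule mult_right_mono)
          have "dist (p + u) p < r3" using uR by (simp add: R_def dist_norm)
          then show "weight p - \<eta> \<le> weight (p + u)" using r3(2)[OF inS] by (simp add: dist_real_def abs_less_iff)
        qed simp
        finally have "cut_off n q (p + u)" unfolding cut_off_def vq \<tau>(5) .
        then show ?thesis using sh inS inV by (simp add: A_def fu)
      qed
      have "ennreal (c0 * \<delta> n ^ CARD('d)) = ennreal (c0 * \<tau> ^ DIM(complex ^ 'd))"
        by (simp add: \<tau>(5)[symmetric] power_mult[symmetric] mult.commute)
      also have "\<dots> \<le> emeasure lborel B" unfolding B_def by (rule c0(3)[OF \<tau>(1,2)])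
      also have "\<dots> = (\<integral>\<^sup>+ x. indicator B x \<partial>lborel)" by simp
      also have "\<dots> \<le> (\<integral>\<^sup>+ x. chart_density (e0, V, h, Gh) x * indicator (A \<inter> V) (x + chart_height e0 V h x *\<^sub>R e0) \<partial>lborel)"
      proof (rule nn_integral_mono)
        fix x
        show "indicator B x \<le> chart_density (e0, V, h, Gh) x * indicator (A \<inter> V) (x + chart_height e0 V h x *\<^sub>R e0)"
        proof (cases "x \<in> B")
          case True
          have "1 \<le> sqrt (1 + (norm (Gh (chart_foot e0 h x)))\<^sup>2)" by simp
          then have "1 \<le> ennreal (sqrt (1 + (norm (Gh (chart_foot e0 h x)))\<^sup>2))" by (simp add: ennreal_leI[of 1, simplified])
          then show ?thesis using True foot[OF True] by (simp add: chart_density_def height_foot B_def)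
        qed simp
      qed
      also have "\<dots> = (\<integral>\<^sup>+ z. indicator (A \<inter> V) z \<partial>chart_measure (e0, V, h, Gh))"
        by (rule nn_integral_chart_measure[symmetric]) measurable
      also have "\<dots> = emeasure (chart_measure (e0, V, h, Gh)) (A \<inter> V)" by simp
      also have "\<dots> = emeasure area (A \<inter> V)"
      proof (rule emeasure_area_chart[OF chart, symmetric])
        show "A \<inter> V \<in> sets borel" by measurable
      qed (auto simp: A_def)
      also have "\<dots> \<le> emeasure area A"
      proof (rule emeasure_mono)
        have "A \<subseteq> frontier D" by (auto simp: A_def)
        then show "A \<in> sets area" unfolding sets_area by simp
      qed auto
      finally show ?case unfolding A_def q_def .
    qed
  qed
qed

end

section \<open>Random caps\<close>

text \<open>Markov's inequality for the nonnegative variable \<open>y n - X n\<close>, the mean of which tends to zero.\<close>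

lemma (in prob_space) concentrated_below_bound:
  fixes X :: "nat \<Rightarrow> 'a \<Rightarrow> real"
  assumes X: "\<And>n. X n \<in> borel_measurable M" and nn: "\<And>n \<omega>. 0 \<le> X n \<omega>" and le: "\<And>n \<omega>. X n \<omega> \<le> y n"
    and y: "y \<longlonglongrightarrow> c" and mean: "(\<lambda>n. expectation (X n)) \<longlonglongrightarrow> c" and \<epsilon>: "\<epsilon> > 0"
  shows "(\<lambda>n. prob {\<omega> \<in> space M. \<bar>X n \<omega> - c\<bar> > \<epsilon>}) \<longlonglongrightarrow> 0"
proof (rule tendsto_sandwich[where f="\<lambda>_. 0"])
  have int: "integrable M (X n)" for n
    using nn le X by (intro integrable_const_bound[where B="y n"]) auto
  have "\<forall>\<^sub>F n in sequentially. \<bar>y n - c\<bar> < \<epsilon> / 2"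
    using y \<epsilon> unfolding tendsto_iff dist_real_def by (metis half_gt_zero)
  then show "\<forall>\<^sub>F n in sequentially. prob {\<omega> \<in> space M. \<bar>X n \<omega> - c\<bar> > \<epsilon>} \<le> (y n - expectation (X n)) / (\<epsilon> / 2)"
  proof eventually_elim
    case (elim n)
    have "prob {\<omega> \<in> space M. \<bar>X n \<omega> - c\<bar> > \<epsilon>} \<le> prob {\<omega> \<in> space M. y n - X n \<omega> \<ge> \<epsilon> / 2}"
    proof (rule finite_measure_mono)
      show "{\<omega> \<in> space M. \<bar>X n \<omega> - c\<bar> > \<epsilon>} \<subseteq> {\<omega> \<in> space M. y n - X n \<omega> \<ge> \<epsilon> / 2}"
      proof safe
        fix \<omega> assume "\<epsilon> < \<bar>X n \<omega> - c\<bar>"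
        then show "\<epsilon> / 2 \<le> y n - X n \<omega>" using le[of n \<omega>] elim by linarith
      qed
      show "{\<omega> \<in> space M. y n - X n \<omega> \<ge> \<epsilon> / 2} \<in> events" using X by measurable
    qed
    also have "\<dots> \<le> expectation (\<lambda>\<omega>. y n - X n \<omega>) / (\<epsilon> / 2)"
      using int le \<epsilon> by (intro integral_Markov_inequality_measure[where A="{}"]) auto
    also have "expectation (\<lambda>\<omega>. y n - X n \<omega>) = y n - expectation (X n)"
      using int by (simp add: prob_space)
    finally show ?case .
  qed
  have "(\<lambda>n. (y n - expectation (X n)) / (\<epsilon> / 2)) \<longlonglongrightarrow> (c - c) / (\<epsilon> / 2)"
    using \<epsilon> by (intro tendsto_intros y mean) auto
  then show "(\<lambda>n. (y n - expectation (X n)) / (\<epsilon> / 2)) \<longlonglongrightarrow> 0" by simp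
qed (auto simp: measure_nonneg)

text \<open>The number \<open>K n\<close> of points is random. Being rarely below \<open>n / 2\<close> is what Poisson numbers with mean \<open>n\<close>
  and the constant number \<open>n\<close> have in common.\<close>

locale random_cuts = cut_domain \<rho> G D H g \<delta> + prob_space M
  for \<rho> :: "complex ^ 'd \<Rightarrow> real" and G D H g \<delta> and M :: "'m measure" +
  fixes W :: "nat \<Rightarrow> 'm \<Rightarrow> complex ^ 'd" and K :: "nat \<Rightarrow> 'm \<Rightarrow> nat" and f :: "complex ^ 'd \<Rightarrow> real" and cf :: real
  assumes W_indep: "indep_vars (\<lambda>_. surface_measure (frontier D)) W UNIV"
    and W_distr: "\<And>i. distributed M (surface_measure (frontier D)) (W i) (\<lambda>z. ennreal (f z))"
    and f_density: "(\<integral>\<^sup>+ z. ennreal (f z) \<partial>surface_measure (frontier D)) = 1"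
    and cf: "cf > 0" "\<And>z. z \<in> frontier D \<Longrightarrow> cf \<le> f z"
    and K_meas: "\<And>n. K n \<in> measurable M (count_space UNIV)"
    and K_large: "(\<lambda>n. prob {\<omega> \<in> space M. K n \<omega> < n div 2}) \<longlonglongrightarrow> 0"
    and \<delta>_large: "filterlim (\<lambda>n. \<delta> n ^ CARD('d) * real (n div 2)) at_top sequentially"
begin

lemma W_measurable: "W i \<in> measurable M area"
  using W_distr by (rule distributed_measurable)

lemma W_borel [measurable]: "W i \<in> borel_measurable M"
  using W_measurable[of i] unfolding measurable_cong_sets[OF refl sets_surface_measure]
  by (rule measurable_restrict_space2_iff[THEN iffD1, THEN conjunct1])

lemma W_frontier: "\<omega> \<in> space M \<Longrightarrow> W i \<omega> \<in> frontier D"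
  using measurable_space[OF W_measurable, of \<omega> i] by simp

text \<open>By independence the probabilities of missing the set multiply, and each of them is at most
  \<open>1 - cf x \<le> exp (- cf x)\<close>.\<close>

lemma prob_all_miss:
  assumes A: "A \<in> sets area" and x: "ennreal x \<le> emeasure area A" "0 \<le> x"
  shows "prob {\<omega> \<in> space M. \<forall>i<m. W i \<omega> \<notin> A} \<le> exp (- (cf * x * real m))"
proof (cases "m = 0")
  case False
  have miss: "prob (W i -` (frontier D - A) \<inter> space M) \<le> 1 - cf * x" for i
  proof -
    have "ennreal (cf * x) = ennreal cf * ennreal x" using cf x by (simp add: ennreal_mult)
    also have "\<dots> \<le> ennreal cf * emeasure area A" using x by (intro mult_left_mono) auto
    also have "\<dots> = (\<integral>\<^sup>+ z. ennreal cf * indicator A z \<partial>area)" using A by (simp add: nn_integral_cmult_indicator)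
    also have "\<dots> \<le> (\<integral>\<^sup>+ z. ennreal (f z) * indicator A z \<partial>area)"
      using cf(2) by (intro nn_integral_mono mult_right_mono ennreal_leI) auto
    also have "\<dots> = emeasure M (W i -` A \<inter> space M)"
      by (rule distributed_emeasure[OF W_distr A, symmetric])
    finally have "cf * x \<le> prob (W i -` A \<inter> space M)"
      using cf x by (simp add: emeasure_eq_measure)
    moreover have "W i -` (frontier D - A) \<inter> space M = space M - (W i -` A \<inter> space M)"
      using W_frontier by auto
    moreover have "W i -` A \<inter> space M \<in> events" using W_measurable A by (rule measurable_sets)
    ultimately show ?thesis by (simp add: prob_compl)
  qed
  have "{\<omega> \<in> space M. \<forall>i<m. W i \<omega> \<notin> A} = (\<Inter>i\<in>{..<m}. W i -` (frontier D - A) \<inter> space M)"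
    using False W_frontier by auto
  also have "prob \<dots> = (\<Prod>i\<in>{..<m}. prob (W i -` (frontier D - A) \<inter> space M))"
  proof (rule indep_varsD[OF W_indep])
    show "frontier D - A \<in> sets area" using sets.compl_sets[OF A] by simp
  qed (use False in auto)
  also have "\<dots> \<le> (\<Prod>i\<in>{..<m}. exp (- (cf * x)))"
  proof (rule prod_mono)
    fix i
    have "1 + - (cf * x) \<le> exp (- (cf * x))" by (rule exp_ge_add_one_self)
    then show "0 \<le> prob (W i -` (frontier D - A) \<inter> space M) \<and> prob (W i -` (frontier D - A) \<inter> space M) \<le> exp (- (cf * x))"
      using miss[of i] by (simp add: measure_nonneg)
  qed
  also have "\<dots> = exp (- (cf * x * real m))" by (simp add: exp_of_nat_mult[symmetric] mult.commute)
  finally show ?thesis .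
qed (simp add: prob_space)

definition cut_set :: "nat \<Rightarrow> 'm \<Rightarrow> (complex ^ 'd) set" where
  "cut_set n \<omega> = {z \<in> D. \<exists>i<K n \<omega>. cut_off n z (W i \<omega>)}"

lemma cut_set_subset: "\<omega> \<in> space M \<Longrightarrow> cut_set n \<omega> \<subseteq> cuttable n"
  using W_frontier by (auto simp: cut_set_def cuttable_def)

text \<open>The graph of the random set in the product of the probability space with space, for Tonelli's
  theorem.\<close>

definition cut_pairs :: "nat \<Rightarrow> ('m \<times> (complex ^ 'd)) set" where
  "cut_pairs n = {x \<in> space (M \<Otimes>\<^sub>M lborel). snd x \<in> D \<and> (\<exists>i. i < K n (fst x) \<and> cut_off n (snd x) (W i (fst x)))}"

lemma cut_pairs_measurable [measurable]: "cut_pairs n \<in> sets (M \<Otimes>\<^sub>M lborel)"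
proof -
  note K_meas[measurable]
  have [measurable]: "D \<in> sets borel" using open_D by (rule borel_open)
  have [measurable]: "G \<in> borel_measurable borel" using contG by (rule borel_measurable_continuous_onI)
  have hm: "(\<lambda>x. hform (F x) (F' x)) \<in> borel_measurable N"
    if "F \<in> borel_measurable N" "F' \<in> borel_measurable N" for F F' :: "'n \<Rightarrow> complex ^ 'd" and N
    using that by (rule borel_measurable_continuous_Pair) (intro continuous_intros)
  have "(\<lambda>x. hform (G (W i (fst x))) (W i (fst x) - snd x)) \<in> borel_measurable (M \<Otimes>\<^sub>M lborel)" for i
    by (rule hm) measurable
  note this[measurable]
  show ?thesis unfolding cut_pairs_def cut_off_def by measurable
qed

lemma cut_pairs_section: "\<omega> \<in> space M \<Longrightarrow> Pair \<omega> -` cut_pairs n = cut_set n \<omega>"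
  by (auto simp: cut_pairs_def cut_set_def space_pair_measure)

lemma cut_set_measurable: "\<omega> \<in> space M \<Longrightarrow> cut_set n \<omega> \<in> sets borel"
  using sets_Pair1[OF cut_pairs_measurable[of n], of \<omega>] cut_pairs_section[of \<omega> n] by simp

definition cut_prob :: "nat \<Rightarrow> complex ^ 'd \<Rightarrow> real" where
  "cut_prob n z = prob {\<omega> \<in> space M. z \<in> cut_set n \<omega>}"

lemma cut_pairs_section2: "(\<lambda>\<omega>. (\<omega>, z)) -` cut_pairs n = {\<omega> \<in> space M. z \<in> cut_set n \<omega>}"
  by (auto simp: cut_pairs_def cut_set_def space_pair_measure)

lemma cut_event_measurable: "{\<omega> \<in> space M. z \<in> cut_set n \<omega>} \<in> events"
  using sets_Pair2[OF cut_pairs_measurable[of n], of z] by (simp add: cut_pairs_section2)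

text \<open>A point that the caps can reach is cut off with probability tending to one: it lies in a cap of area
  of order \<open>\<delta>\<^sup>d\<close>, and about \<open>n\<close> points are thrown.\<close>

lemma cut_prob_tendsto:
  assumes p: "p \<in> frontier D" and b: "b \<in> Basis" and s: "0 < s * (G p \<bullet> b)" "s * (G p \<bullet> b) < weight p"
  shows "(\<lambda>n. cut_prob n (p - (s * \<delta> n) *\<^sub>R b)) \<longlonglongrightarrow> 1"
proof -
  define q where "q n = p - (s * \<delta> n) *\<^sub>R b" for n
  obtain c where c: "c > 0"
    "\<forall>\<^sub>F n in sequentially. ennreal (c * \<delta> n ^ CARD('d)) \<le> emeasure area {w \<in> frontier D. cut_off n (p - (s * \<delta> n) *\<^sub>R b) w}"
    by (rule cap_area_lower_bound[OF p b s]) (rule that)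
  have low: "\<forall>\<^sub>F n in sequentially. 1 - prob {\<omega> \<in> space M. K n \<omega> < n div 2} - exp (- (cf * c * (\<delta> n ^ CARD('d) * real (n div 2)))) \<le> cut_prob n (q n)"
    using c(2) eventually_in_D[OF p s(1)]
  proof eventually_elim
    case (elim n)
    define A where "A = {w \<in> frontier D. cut_off n (q n) w}"
    have A: "A \<in> sets area" unfolding sets_area A_def using cutters_measurable by auto
    let ?E1 = "{\<omega> \<in> space M. K n \<omega> < n div 2}" and ?E2 = "{\<omega> \<in> space M. \<forall>i<n div 2. W i \<omega> \<notin> A}"
    note K_meas[measurable]
    have ev: "?E1 \<in> events" by measurable
    have "A \<in> sets borel" using A unfolding sets_area by simp
    then have ev2: "?E2 \<in> events" by measurable
    have ev3: "{\<omega> \<in> space M. q n \<in> cut_set n \<omega>} \<in> events" by (rule cut_event_measurable)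
    have "space M - {\<omega> \<in> space M. q n \<in> cut_set n \<omega>} \<subseteq> ?E1 \<union> ?E2"
      using elim(2) W_frontier by (auto simp: cut_set_def A_def q_def not_less) (meson le_less_trans less_le_trans)
    then have "prob (space M - {\<omega> \<in> space M. q n \<in> cut_set n \<omega>}) \<le> prob (?E1 \<union> ?E2)"
      by (rule finite_measure_mono) (rule sets.Un[OF ev ev2])
    also have "\<dots> \<le> prob ?E1 + prob ?E2" using ev ev2 by (rule measure_Un_le)
    also have "prob ?E2 \<le> exp (- (cf * (c * \<delta> n ^ CARD('d)) * real (n div 2)))"
      using elim(1) c(1) \<delta>_pos[of n] by (intro prob_all_miss[OF A]) (auto simp: A_def q_def)
    finally show ?case unfolding cut_prob_def using prob_compl[OF ev3] by (simp add: mult.assoc)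
  qed
  have "filterlim (\<lambda>n. cf * c * (\<delta> n ^ CARD('d) * real (n div 2))) at_top sequentially"
    using cf(1) c(1) by (intro filterlim_tendsto_pos_mult_at_top[OF tendsto_const _ \<delta>_large]) auto
  then have "filterlim (\<lambda>n. - (cf * c * (\<delta> n ^ CARD('d) * real (n div 2)))) at_bot sequentially"
    by (simp add: filterlim_uminus_at_top)
  then have e0: "(\<lambda>n. exp (- (cf * c * (\<delta> n ^ CARD('d) * real (n div 2))))) \<longlonglongrightarrow> 0"
    by (rule filterlim_compose[OF exp_at_bot])
  have "(\<lambda>n. 1 - prob {\<omega> \<in> space M. K n \<omega> < n div 2} - exp (- (cf * c * (\<delta> n ^ CARD('d) * real (n div 2))))) \<longlonglongrightarrow> 1 - 0 - 0"
    by (intro tendsto_intros K_large e0)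
  then have "(\<lambda>n. 1 - prob {\<omega> \<in> space M. K n \<omega> < n div 2} - exp (- (cf * c * (\<delta> n ^ CARD('d) * real (n div 2))))) \<longlonglongrightarrow> 1" by simp
  moreover have "\<forall>\<^sub>F n in sequentially. cut_prob n (q n) \<le> 1" by (simp add: cut_prob_def)
  ultimately have "(\<lambda>n. cut_prob n (q n)) \<longlonglongrightarrow> 1"
    using tendsto_sandwich[OF low _ _ tendsto_const] by blast
  then show ?thesis unfolding q_def .
qed

lemma area_finite: "emeasure area (frontier D) < \<infinity>"
proof -
  have "ennreal cf * emeasure area (frontier D) = (\<integral>\<^sup>+ z. ennreal cf \<partial>area)" by simp
  also have "\<dots> \<le> (\<integral>\<^sup>+ z. ennreal (f z) \<partial>area)" using cf(2) by (intro nn_integral_mono ennreal_leI) simp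
  also have "\<dots> = 1" by (rule f_density)
  finally have "ennreal cf * emeasure area (frontier D) < \<infinity>" by (rule le_less_trans) simp
  then show ?thesis using cf(1) by (auto simp: ennreal_mult_less_top)
qed

lemma surface_nonempty: "frontier D \<noteq> {}"
  using W_frontier not_empty by fastforce

lemma g_integral: "(\<integral>\<^sup>+ z. ennreal (weight z / norm (G z)) \<partial>area) = ennreal (\<integral>z. g z \<partial>area)"
proof -
  interpret A: finite_measure area using area_finite by (intro finite_measureI) simp
  have g_meas: "g \<in> borel_measurable area"
    unfolding measurable_cong_sets[OF sets_surface_measure refl]
    by (rule borel_measurable_continuous_on_restrict[OF cont_g])
  have "bounded (g ` frontier D)"
    using cont_g compact_frontier_D by (intro compact_imp_bounded compact_continuous_image)
  then obtain B where B: "\<And>z. z \<in> frontier D \<Longrightarrow> norm (g z) \<le> B" unfolding bounded_iff by auto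
  have int: "integrable area g" using B g_meas by (intro A.integrable_const_bound[where B=B]) auto
  have "(\<integral>\<^sup>+ z. ennreal (weight z / norm (G z)) \<partial>area) = (\<integral>\<^sup>+ z. ennreal (g z) \<partial>area)"
    by (intro nn_integral_cong) (use G_nonzero in \<open>auto simp: weight_def\<close>)
  also have "\<dots> = ennreal (\<integral>z. g z \<partial>area)"
    using int g_pos by (intro nn_integral_eq_integral) (auto intro!: AE_I2 less_imp_le)
  finally show ?thesis .
qed

lemma D_finite: "emeasure lborel D < \<infinity>"
  using bounded_D open_D by (intro emeasure_bounded_finite)

text \<open>Exchanging expectation and volume, the expected volume cut off is the integral of the cutting
  probability. This is a boundary layer, and so is the deterministic set of all points within reach of
  some cap. Both have the same asymptotic volume, and the random set lies in the deterministic one.\<close>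

theorem cut_volume_in_probability:
  assumes "\<epsilon> > 0"
  shows "(\<lambda>n. prob {\<omega> \<in> space M. \<bar>measure lborel (cut_set n \<omega>) / \<delta> n - (\<integral>z. g z \<partial>area)\<bar> > \<epsilon>}) \<longlonglongrightarrow> 0"
    and "(\<lambda>\<omega>. measure lborel (cut_set n \<omega>)) \<in> borel_measurable M"
proof -
  interpret P: pair_sigma_finite M lborel
    by (intro pair_sigma_finite.intro sigma_finite_measure_axioms lborel.sigma_finite_measure_axioms)
  let ?I = "\<integral>z. g z \<partial>area"
  have I: "?I \<ge> 0" using g_pos by (intro Bochner_Integration.integral_nonneg) (auto intro: less_imp_le)
  have meas: "(\<lambda>\<omega>. emeasure lborel (cut_set n \<omega>)) \<in> borel_measurable M" for n
    using lborel.measurable_emeasure_Pair[OF cut_pairs_measurable[of n]]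
    by (subst (asm) measurable_cong[where g="\<lambda>\<omega>. emeasure lborel (cut_set n \<omega>)"]) (auto simp: cut_pairs_section)
  then show vol_meas: "(\<lambda>\<omega>. measure lborel (cut_set n \<omega>)) \<in> borel_measurable M" for n
    unfolding measure_def by measurable
  have fin: "emeasure lborel (cuttable n) < \<infinity>" for n
    using D_finite emeasure_mono[of "cuttable n" D lborel] open_D
    by (auto simp: cuttable_def borel_open intro: le_less_trans)
  have cut_le: "emeasure lborel (cut_set n \<omega>) \<le> emeasure lborel (cuttable n)" if "\<omega> \<in> space M" for n \<omega>
    using cut_set_subset[OF that] by (intro emeasure_mono) auto
  have vol_le: "measure lborel (cut_set n \<omega>) \<le> measure lborel (cuttable n)" if "\<omega> \<in> space M" for n \<omega>
  proof (rule measure_mono_fmeasurable)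
    show "cut_set n \<omega> \<subseteq> cuttable n" using that by (rule cut_set_subset)
    show "cut_set n \<omega> \<in> sets lborel" using cut_set_measurable[OF that] by simp
    show "cuttable n \<in> fmeasurable lborel" using fin[of n] by (simp add: fmeasurable_def)
  qed
  have reach: "\<forall>\<^sub>F n in sequentially. p - (s * \<delta> n) *\<^sub>R b \<in> cuttable n"
    if "p \<in> frontier D" "b \<in> Basis" "0 < s * (G p \<bullet> b)" "s * (G p \<bullet> b) < weight p" for p b s
  proof -
    have "\<forall>\<^sub>F n in sequentially. 0 < cut_prob n (p - (s * \<delta> n) *\<^sub>R b)"
      using cut_prob_tendsto[OF that] by (rule order_tendstoD(1)) simp
    then show ?thesis
    proof eventually_elim
      case (elim n)
      then have "{\<omega> \<in> space M. p - (s * \<delta> n) *\<^sub>R b \<in> cut_set n \<omega>} \<noteq> {}" unfolding cut_prob_def by force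
      then show ?case using cut_set_subset by blast
    qed
  qed
  have layer1: "boundary_layer \<delta> (\<lambda>n. indicat_real (cuttable n)) weight"
  proof (rule boundary_layer_cut)
    fix p b s assume "p \<in> frontier D" "b \<in> Basis" "0 < s * (G p \<bullet> b)" "s * (G p \<bullet> b) < weight p"
    from reach[OF this] have "\<forall>\<^sub>F n in sequentially. indicat_real (cuttable n) (p - (s * \<delta> n) *\<^sub>R b) = 1"
      by eventually_elim simp
    then show "(\<lambda>n. indicat_real (cuttable n) (p - (s * \<delta> n) *\<^sub>R b)) \<longlonglongrightarrow> 1" by (rule tendsto_eventually)
  qed auto
  have cp_meas: "(\<lambda>z. emeasure M {\<omega> \<in> space M. z \<in> cut_set n \<omega>}) \<in> borel_measurable borel" for n
    using P.measurable_emeasure_Pair2[OF cut_pairs_measurable[of n]] by (simp add: cut_pairs_section2)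
  have layer2: "boundary_layer \<delta> cut_prob weight"
  proof (rule boundary_layer_cut)
    show "cut_prob n \<in> borel_measurable borel" for n
      using cp_meas unfolding cut_prob_def[abs_def] measure_def by measurable
    show "cut_prob n z \<le> indicat_real (cuttable n) z" for n z
    proof (cases "z \<in> cuttable n")
      case False
      then have "{\<omega> \<in> space M. z \<in> cut_set n \<omega>} = {}" using cut_set_subset by blast
      then have "cut_prob n z = 0" unfolding cut_prob_def by (simp only: measure_empty)
      then show ?thesis by simp
    qed (simp add: cut_prob_def)
  qed (auto simp: cut_prob_def measure_nonneg cut_prob_tendsto[unfolded cut_prob_def])
  have to_real: "(\<lambda>n. enn2real (X n / ennreal (\<delta> n))) \<longlonglongrightarrow> ?I" if "(\<lambda>n. X n / ennreal (\<delta> n)) \<longlonglongrightarrow> ennreal ?I" for X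
    using tendsto_enn2real[OF that] I by simp
  have y: "(\<lambda>n. measure lborel (cuttable n) / \<delta> n) \<longlonglongrightarrow> ?I"
  proof -
    have lim: "(\<lambda>n. emeasure lborel (cuttable n) / ennreal (\<delta> n)) \<longlonglongrightarrow> ennreal ?I"
      using layer_limit[OF layer1 surface_nonempty] unfolding g_integral by (simp add: ennreal_indicator)
    have "enn2real (emeasure lborel (cuttable n) / ennreal (\<delta> n)) = measure lborel (cuttable n) / \<delta> n" for n
    proof -
      have "emeasure lborel (cuttable n) = ennreal (measure lborel (cuttable n))"
        using fin[of n] by (intro emeasure_eq_ennreal_measure) auto
      also have "\<dots> / ennreal (\<delta> n) = ennreal (measure lborel (cuttable n) / \<delta> n)"
        using \<delta>_pos[of n] by (intro divide_ennreal) auto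
      finally show ?thesis using \<delta>_pos[of n] by (simp only: enn2real_ennreal divide_nonneg_pos measure_nonneg)
    qed
    then show ?thesis using to_real[OF lim] by (simp only:)
  qed
  have mean: "(\<lambda>n. expectation (\<lambda>\<omega>. measure lborel (cut_set n \<omega>) / \<delta> n)) \<longlonglongrightarrow> ?I"
  proof -
    have ex: "(\<integral>\<^sup>+ z. ennreal (cut_prob n z) \<partial>lborel) = (\<integral>\<^sup>+ \<omega>. emeasure lborel (cut_set n \<omega>) \<partial>M)" for n
    proof -
      have "(\<integral>\<^sup>+ z. ennreal (cut_prob n z) \<partial>lborel) = emeasure (M \<Otimes>\<^sub>M lborel) (cut_pairs n)"
        unfolding P.emeasure_pair_measure_alt2[OF cut_pairs_measurable] cut_pairs_section2
        by (simp add: cut_prob_def emeasure_eq_measure)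
      also have "\<dots> = (\<integral>\<^sup>+ \<omega>. emeasure lborel (cut_set n \<omega>) \<partial>M)"
        unfolding lborel.emeasure_pair_measure_alt[OF cut_pairs_measurable]
        by (intro nn_integral_cong) (simp add: cut_pairs_section)
      finally show ?thesis .
    qed
    have "enn2real ((\<integral>\<^sup>+ \<omega>. emeasure lborel (cut_set n \<omega>) \<partial>M) / ennreal (\<delta> n)) = expectation (\<lambda>\<omega>. measure lborel (cut_set n \<omega>) / \<delta> n)" for n
    proof -
      have "(\<integral>\<^sup>+ \<omega>. emeasure lborel (cut_set n \<omega>) \<partial>M) = (\<integral>\<^sup>+ \<omega>. ennreal (measure lborel (cut_set n \<omega>)) \<partial>M)"
        using le_less_trans[OF cut_le fin]
        by (intro nn_integral_cong emeasure_eq_ennreal_measure) (auto simp: less_top[symmetric])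
      also have "\<dots> = ennreal (expectation (\<lambda>\<omega>. measure lborel (cut_set n \<omega>)))"
      proof (rule nn_integral_eq_integral)
        show "integrable M (\<lambda>\<omega>. measure lborel (cut_set n \<omega>))"
          using vol_meas vol_le by (intro integrable_const_bound[where B="measure lborel (cuttable n)"]) auto
      qed auto
      finally show ?thesis using \<delta>_pos[of n] by (simp add: divide_ennreal)
    qed
    then show ?thesis
      using to_real[OF layer_limit[OF layer2 surface_nonempty, unfolded g_integral ex]] by simp
  qed
  define X where "X n \<omega> = (if \<omega> \<in> space M then measure lborel (cut_set n \<omega>) / \<delta> n else 0)" for n \<omega>
  have X_eq: "X n \<omega> = measure lborel (cut_set n \<omega>) / \<delta> n" if "\<omega> \<in> space M" for n \<omega>
    using that by (simp add: X_def)
  have X_meas: "X n \<in> borel_measurable M" for n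
  proof (subst measurable_cong[OF X_eq])
    show "(\<lambda>\<omega>. measure lborel (cut_set n \<omega>) / \<delta> n) \<in> borel_measurable M"
      by (intro borel_measurable_divide vol_meas borel_measurable_const)
  qed
  have X_nonneg: "0 \<le> X n \<omega>" for n \<omega> using \<delta>_pos[of n] by (simp add: X_def)
  have X_le: "X n \<omega> \<le> measure lborel (cuttable n) / \<delta> n" for n \<omega>
  proof (cases "\<omega> \<in> space M")
    case True
    have "measure lborel (cut_set n \<omega>) \<le> measure lborel (cuttable n)" using True by (rule vol_le)
    then show ?thesis using True \<delta>_pos[of n] by (simp add: X_def divide_right_mono)
  next
    case False
    then show ?thesis using \<delta>_pos[of n] by (simp add: X_def)
  qed
  have X_mean: "expectation (X n) = expectation (\<lambda>\<omega>. measure lborel (cut_set n \<omega>) / \<delta> n)" for n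
  proof (rule Bochner_Integration.integral_cong[OF refl])
    show "X n \<omega> = measure lborel (cut_set n \<omega>) / \<delta> n" if "\<omega> \<in> space M" for \<omega> using that by (rule X_eq)
  qed
  have "(\<lambda>n. expectation (X n)) \<longlonglongrightarrow> ?I" unfolding X_mean by (rule mean)
  from concentrated_below_bound[of X, OF X_meas X_nonneg X_le y this assms]
  have "(\<lambda>n. prob {\<omega> \<in> space M. \<bar>X n \<omega> - ?I\<bar> > \<epsilon>}) \<longlonglongrightarrow> 0" .
  moreover have "{\<omega> \<in> space M. \<bar>X n \<omega> - ?I\<bar> > \<epsilon>} = {\<omega> \<in> space M. \<bar>measure lborel (cut_set n \<omega>) / \<delta> n - ?I\<bar> > \<epsilon>}" for n
    using X_eq by auto
  ultimately show "(\<lambda>n. prob {\<omega> \<in> space M. \<bar>measure lborel (cut_set n \<omega>) / \<delta> n - ?I\<bar> > \<epsilon>}) \<longlonglongrightarrow> 0"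
    by (simp only:)
qed

end

section \<open>Approximation by induced polyhedra\<close>

text \<open>A point of the domain that satisfies all the inequalities lies in a component meeting the domain.
  Inside the domain the polyhedron is therefore the whole intersection.\<close>

lemma domain_minus_polyhedron:
  "D - induced_polyhedron \<rho> D \<phi> \<delta> =
    {z \<in> D. \<exists>w\<in>\<phi>. cmod (cpair (del_rho \<rho> w) (w - z)) / norm (del_rho \<rho> w) \<le> \<delta> w}"
proof -
  let ?Z = "{z. \<forall>w\<in>\<phi>. cmod (cpair (del_rho \<rho> w) (w - z)) / norm (del_rho \<rho> w) > \<delta> w}"
  have "z \<in> induced_polyhedron \<rho> D \<phi> \<delta> \<longleftrightarrow> z \<in> ?Z" if "z \<in> D" for z
  proof
    assume "z \<in> induced_polyhedron \<rho> D \<phi> \<delta>"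
    then show "z \<in> ?Z" unfolding induced_polyhedron_def using in_components_subset by blast
  next
    assume z: "z \<in> ?Z"
    then have "connected_component_set ?Z z \<in> components ?Z" by (rule componentsI)
    moreover have "z \<in> connected_component_set ?Z z" using z by (simp only: connected_component_refl mem_Collect_eq)
    ultimately show "z \<in> induced_polyhedron \<rho> D \<phi> \<delta>" unfolding induced_polyhedron_def using that by blast
  qed
  then have "z \<notin> induced_polyhedron \<rho> D \<phi> \<delta> \<longleftrightarrow>
      (\<exists>w\<in>\<phi>. cmod (cpair (del_rho \<rho> w) (w - z)) / norm (del_rho \<rho> w) \<le> \<delta> w)" if "z \<in> D" for z
    using that by (simp add: not_less)
  then show ?thesis by blast
qed

context random_cuts
begin

text \<open>On the event that the polyhedron is contained in \<open>D\<close> the error is the volume cut off, and the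
  complementary event becomes negligible.\<close>

theorem approximation_error_in_probability:
  assumes cp: "\<And>w u. cpair (del_rho \<rho> w) u = hform (G w) u / 2" and nr: "\<And>w. norm (del_rho \<rho> w) = norm (G w) / 2"
    and inside: "(\<lambda>n. prob {\<omega> \<in> space M. induced_polyhedron \<rho> D (first_points W (K n \<omega>) \<omega>) (\<lambda>w. g w * \<delta> n) \<subseteq> D}) \<longlonglongrightarrow> 1"
  shows "tends_in_probability M
    (\<lambda>n \<omega>. approx_error D (induced_polyhedron \<rho> D (first_points W (K n \<omega>) \<omega>) (\<lambda>w. g w * \<delta> n)) / \<delta> n) (\<integral>z. g z \<partial>area)"
proof -
  define P where "P n \<omega> = induced_polyhedron \<rho> D (first_points W (K n \<omega>) \<omega>) (\<lambda>w. g w * \<delta> n)" for n \<omega>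
  define I where "I = (\<integral>z. g z \<partial>area)"
  let ?A = "\<lambda>n. {\<omega> \<in> space M. P n \<omega> \<subseteq> D}"
  have diff: "D - P n \<omega> = cut_set n \<omega>" if "\<omega> \<in> space M" for n \<omega>
  proof -
    have "cmod (cpair (del_rho \<rho> (W i \<omega>)) (W i \<omega> - z)) / norm (del_rho \<rho> (W i \<omega>)) \<le> g (W i \<omega>) * \<delta> n \<longleftrightarrow> cut_off n z (W i \<omega>)" for i z
      using W_frontier[OF that, of i] G_nonzero[OF W_frontier[OF that, of i]]
      by (simp add: cp nr cut_off_def weight_def norm_divide pos_divide_le_eq mult.commute mult.left_commute)
    then show ?thesis unfolding P_def domain_minus_polyhedron cut_set_def first_points_def by auto
  qed
  have err: "approx_error D (P n \<omega>) = (if P n \<omega> \<subseteq> D then measure lborel (cut_set n \<omega>) else measure lebesgue D)"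
    if "\<omega> \<in> space M" for n \<omega>
    using that cut_set_measurable[OF that, of n] by (simp add: approx_error_def diff)
  \<comment> \<open>An event of positive measure is measurable, since the measure of any other set is zero.\<close>
  have "\<forall>\<^sub>F n in sequentially. prob (?A n) > 0"
    using inside unfolding P_def by (rule order_tendstoD(1)) simp
  then have A: "\<forall>\<^sub>F n in sequentially. ?A n \<in> events"
    by eventually_elim (metis less_irrefl measure_notin_sets)
  have "\<forall>\<^sub>F n in sequentially. (\<lambda>\<omega>. approx_error D (P n \<omega>) / \<delta> n) \<in> borel_measurable M"
    using A
  proof eventually_elim
    case (elim n)
    have "(\<lambda>\<omega>. if P n \<omega> \<subseteq> D then measure lborel (cut_set n \<omega>) else measure lebesgue D) \<in> borel_measurable M"
      using elim cut_volume_in_probability(2)[OF zero_less_one] by (intro measurable_If) auto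
    then have "(\<lambda>\<omega>. (if P n \<omega> \<subseteq> D then measure lborel (cut_set n \<omega>) else measure lebesgue D) / \<delta> n) \<in> borel_measurable M"
      by simp
    then show ?case by (subst measurable_cong[where g="\<lambda>\<omega>. (if P n \<omega> \<subseteq> D then measure lborel (cut_set n \<omega>) else measure lebesgue D) / \<delta> n"])
       (simp_all add: err)
  qed
  moreover have "(\<lambda>n. prob {\<omega> \<in> space M. \<bar>approx_error D (P n \<omega>) / \<delta> n - I\<bar> > \<epsilon>}) \<longlonglongrightarrow> 0" if \<epsilon>: "\<epsilon> > 0" for \<epsilon>
  proof (rule tendsto_sandwich[where f="\<lambda>_. 0"])
    let ?B = "\<lambda>n. {\<omega> \<in> space M. \<bar>measure lborel (cut_set n \<omega>) / \<delta> n - I\<bar> > \<epsilon>}"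
    show "\<forall>\<^sub>F n in sequentially. prob {\<omega> \<in> space M. \<bar>approx_error D (P n \<omega>) / \<delta> n - I\<bar> > \<epsilon>} \<le> prob (?B n) + (1 - prob (?A n))"
      using A
    proof eventually_elim
      case (elim n)
      note cut_volume_in_probability(2)[of \<epsilon> n, OF \<epsilon>, measurable]
      have B: "?B n \<in> events" by measurable
      have "prob {\<omega> \<in> space M. \<bar>approx_error D (P n \<omega>) / \<delta> n - I\<bar> > \<epsilon>} \<le> prob (?B n \<union> (space M - ?A n))"
        using B elim by (intro finite_measure_mono) (auto simp: err)
      also have "\<dots> \<le> prob (?B n) + prob (space M - ?A n)" using B elim by (intro measure_Un_le) auto
      finally show ?case using prob_compl[OF elim] by simp
    qed
    have "(\<lambda>n. prob (?B n) + (1 - prob (?A n))) \<longlonglongrightarrow> 0 + (1 - 1)"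
      by (intro tendsto_intros cut_volume_in_probability(1)[OF \<epsilon>, folded I_def] inside[folded P_def])
    then show "(\<lambda>n. prob (?B n) + (1 - prob (?A n))) \<longlonglongrightarrow> 0" by simp
  qed (auto simp: measure_nonneg)
  ultimately show ?thesis unfolding tends_in_probability_def P_def[symmetric] I_def[symmetric] by blast
qed

end

lemma tends_in_probability_cong:
  assumes "tends_in_probability M X c" and "\<forall>\<^sub>F n in sequentially. X n = Y n"
  shows "tends_in_probability M Y c"
proof -
  have "\<forall>\<^sub>F n in sequentially. Y n \<in> borel_measurable M"
    using assms(1)[unfolded tends_in_probability_def, THEN conjunct1] assms(2) by eventually_elim simp
  moreover have "(\<lambda>n. measure M {\<omega> \<in> space M. \<bar>Y n \<omega> - c\<bar> > \<epsilon>}) \<longlonglongrightarrow> 0" if "\<epsilon> > 0" for \<epsilon>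
  proof (rule Lim_transform_eventually)
    show "(\<lambda>n. measure M {\<omega> \<in> space M. \<bar>X n \<omega> - c\<bar> > \<epsilon>}) \<longlonglongrightarrow> 0"
      using assms(1) that unfolding tends_in_probability_def by blast
    show "\<forall>\<^sub>F n in sequentially. measure M {\<omega> \<in> space M. \<bar>X n \<omega> - c\<bar> > \<epsilon>} = measure M {\<omega> \<in> space M. \<bar>Y n \<omega> - c\<bar> > \<epsilon>}"
      using assms(2) by eventually_elim simp
  qed
  ultimately show ?thesis unfolding tends_in_probability_def by blast
qed

text \<open>Markov's inequality for \<open>2\<^sup>-\<^sup>N\<close>, whose mean for a Poisson variable \<open>N\<close> of mean \<open>r\<close> is
  \<open>exp (- r / 2)\<close>. The factor \<open>2\<^sup>m\<close> with \<open>m \<approx> r / 2\<close> is of smaller order, since \<open>ln 2 < 1\<close>.\<close>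

lemma poisson_lower_tail:
  assumes "r > 0"
  shows "measure (measure_pmf (poisson_pmf r)) {..<m} \<le> 2 ^ m * exp (- r / 2)"
proof -
  have "measure (measure_pmf (poisson_pmf r)) {..<m} = (\<Sum>k<m. r ^ k / fact k * exp (- r))"
    using assms by (simp add: measure_measure_pmf_finite)
  also have "\<dots> \<le> (\<Sum>k<m. 2 ^ m * exp (- r) * ((r / 2) ^ k /\<^sub>R fact k))"
  proof (rule sum_mono)
    fix k assume "k \<in> {..<m}"
    then have "2 ^ k \<le> (2 :: real) ^ m" by (intro power_increasing) auto
    then have "2 ^ k * (exp (- r) * (r / 2) ^ k / fact k) \<le> 2 ^ m * (exp (- r) * (r / 2) ^ k / fact k)"
      using assms by (intro mult_right_mono) auto
    moreover have "2 ^ k * (exp (- r) * (r / 2) ^ k / fact k) = r ^ k / fact k * exp (- r)"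
      by (simp add: power_divide)
    moreover have "2 ^ m * (exp (- r) * (r / 2) ^ k / fact k) = 2 ^ m * exp (- r) * ((r / 2) ^ k /\<^sub>R fact k)"
      by (simp only: real_scaleR_def divide_inverse[of _ "fact k"]) (simp only: ac_simps)
    ultimately show "r ^ k / fact k * exp (- r) \<le> 2 ^ m * exp (- r) * ((r / 2) ^ k /\<^sub>R fact k)"
      by (simp only:)
  qed
  also have "\<dots> = 2 ^ m * exp (- r) * (\<Sum>k<m. (r / 2) ^ k /\<^sub>R fact k)" by (simp add: sum_distrib_left)
  also have "\<dots> \<le> 2 ^ m * exp (- r) * exp (r / 2)"
  proof (rule mult_left_mono)
    show "(\<Sum>k<m. (r / 2) ^ k /\<^sub>R fact k) \<le> exp (r / 2)"
      unfolding exp_def using assms by (intro sum_le_suminf summable_exp_generic) auto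
  qed simp
  also have "\<dots> = 2 ^ m * exp (- r / 2)" by (simp add: mult_exp_exp mult.assoc)
  finally show ?thesis .
qed

lemma poisson_counts_large:
  assumes M: "prob_space M" and N: "poisson_counts M \<sigma> W N"
  shows "(\<lambda>n. measure M {\<omega> \<in> space M. (if n = 0 then 0 else N n \<omega>) < n div 2}) \<longlonglongrightarrow> 0"
proof (rule tendsto_sandwich[where f="\<lambda>_. 0"])
  define c where "c = (1 - ln 2 :: real) / 2"
  have c: "c > 0" using ln_2_less_1 by (simp add: c_def)
  have "measure M {\<omega> \<in> space M. (if n = 0 then 0 else N n \<omega>) < n div 2} \<le> exp (- (c * real n))" for n
  proof (cases "n = 0")
    case False
    have Nn: "N n \<in> measurable M (count_space UNIV)"
      "distr M (count_space UNIV) (N n) = measure_pmf (poisson_pmf (real n))"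
      using N False by (auto simp: poisson_counts_def)
    have "{\<omega> \<in> space M. (if n = 0 then 0 else N n \<omega>) < n div 2} = N n -` {..<n div 2} \<inter> space M"
      using False by auto
    also have "measure M \<dots> = measure (distr M (count_space UNIV) (N n)) {..<n div 2}"
      using Nn(1) by (simp add: measure_distr)
    also have "\<dots> \<le> 2 ^ (n div 2) * exp (- real n / 2)"
      unfolding Nn(2) using False by (intro poisson_lower_tail) simp
    also have "\<dots> \<le> exp (ln 2 * (real n / 2)) * exp (- real n / 2)"
    proof (rule mult_right_mono)
      have "real (n div 2) \<le> real n / 2" by linarith
      then have "ln 2 * real (n div 2) \<le> ln 2 * (real n / 2)" by (intro mult_left_mono) auto
      moreover have "(2::real) ^ (n div 2) = exp (ln 2 * real (n div 2))"
        by (simp add: exp_of_nat2_mult)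
      ultimately show "(2::real) ^ (n div 2) \<le> exp (ln 2 * (real n / 2))" by simp
    qed simp
    also have "\<dots> = exp (- (c * real n))"
      unfolding mult_exp_exp by (simp add: c_def algebra_simps diff_divide_distrib)
    finally show ?thesis by simp
  qed (use prob_space.prob_le_1[OF M] in \<open>simp add: c_def\<close>)
  then show "\<forall>\<^sub>F n in sequentially. measure M {\<omega> \<in> space M. (if n = 0 then 0 else N n \<omega>) < n div 2} \<le> exp (- (c * real n))"
    by (rule always_eventually[rule_format])
  have "filterlim (\<lambda>n. c * real n) at_top sequentially"
    using c by (intro filterlim_tendsto_pos_mult_at_top[OF tendsto_const _ filterlim_real_sequentially])
  then have "filterlim (\<lambda>n. - (c * real n)) at_bot sequentially" by (simp add: filterlim_uminus_at_top)
  then show "(\<lambda>n. exp (- (c * real n))) \<longlonglongrightarrow> 0" by (rule filterlim_compose[OF exp_at_bot])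
qed (auto simp: measure_nonneg)

lemma holder_imp_continuous_on:
  assumes "holder_on \<alpha> S g" "0 < \<alpha>"
  shows "continuous_on S g"
  unfolding continuous_on_def
proof
  fix x assume x: "x \<in> S"
  obtain L where L: "\<And>x y. x \<in> S \<Longrightarrow> y \<in> S \<Longrightarrow> \<bar>g x - g y\<bar> \<le> L * dist x y powr \<alpha>"
    using assms(1) unfolding holder_on_def by blast
  have "((\<lambda>y. dist y x) \<longlongrightarrow> dist x x) (at x within S)" by (intro tendsto_intros)
  then have "((\<lambda>y. dist y x powr \<alpha>) \<longlongrightarrow> 0) (at x within S)"
    using assms(2) by (intro tendsto_zero_powrI[where b=\<alpha>]) auto
  then have "((\<lambda>y. L * dist y x powr \<alpha>) \<longlongrightarrow> 0) (at x within S)" by (rule tendsto_mult_right_zero)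
  then have "((\<lambda>y. g y - g x) \<longlongrightarrow> 0) (at x within S)"
    by (rule Lim_null_comparison[rotated]) (use L x in \<open>auto simp: eventually_at_filter\<close>)
  then show "(g \<longlongrightarrow> g x) (at x within S)" by (rule LIM_zero_cancel)
qed

theorem theorem2p3:
  fixes \<rho> :: "complex ^ 'd \<Rightarrow> real" and D :: "(complex ^ 'd) set"
    and f g :: "complex ^ 'd \<Rightarrow> real" and \<alpha> :: real
    and M :: "'m measure" and W :: "nat \<Rightarrow> 'm \<Rightarrow> complex ^ 'd" and N :: "nat \<Rightarrow> 'm \<Rightarrow> nat"
  defines "\<sigma> \<equiv> surface_measure (frontier D)"
    and "\<delta> \<equiv> (\<lambda>(n::nat) w. g w * (ln (real n) / real n) powr (1 / real CARD('d)))"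
  assumes d: "CARD('d) \<ge> 2"
    and D: "strongly_C_convex_domain \<rho> D" "bounded D"
    and f_meas: "f \<in> borel_measurable \<sigma>"
    and f_density: "(\<integral>\<^sup>+ z. ennreal (f z) \<partial>\<sigma>) = 1"
    and f_bounds: "\<exists>c>0. \<exists>C. \<forall>z\<in>frontier D. c \<le> f z \<and> f z \<le> C"
    and g_pos: "\<And>z. z \<in> frontier D \<Longrightarrow> g z > 0"
    and \<alpha>: "0 < \<alpha>" "\<alpha> \<le> 1"
    and g_holder: "holder_on \<alpha> (frontier D) g"
    and M: "prob_space M"
    and W_indep: "prob_space.indep_vars M (\<lambda>_. \<sigma>) W UNIV"
    and W_distr: "\<And>i. distributed M \<sigma> (W i) (\<lambda>z. ennreal (f z))"
    and N: "poisson_counts M \<sigma> W N"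
  shows
    "((\<lambda>n. measure M {\<omega> \<in> space M.
          induced_polyhedron \<rho> D (first_points W (N n \<omega>) \<omega>) (\<delta> n) \<subseteq> D}) \<longlonglongrightarrow> 1
      \<longrightarrow> tends_in_probability M
            (\<lambda>n \<omega>. (real n / ln (real n)) powr (1 / real CARD('d)) *
               approx_error D (induced_polyhedron \<rho> D (first_points W (N n \<omega>) \<omega>) (\<delta> n)))
            (\<integral>z. g z \<partial>\<sigma>))
   \<and> ((\<lambda>n. measure M {\<omega> \<in> space M.
          induced_polyhedron \<rho> D (first_points W n \<omega>) (\<delta> n) \<subseteq> D}) \<longlonglongrightarrow> 1
      \<longrightarrow> tends_in_probability M
            (\<lambda>n \<omega>. (real n / ln (real n)) powr (1 / real CARD('d)) *
               approx_error D (induced_polyhedron \<rho> D (first_points W n \<omega>) (\<delta> n)))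
            (\<integral>z. g z \<partial>\<sigma>))"
proof -
  obtain G H where GH: "\<And>x. GDERIV \<rho> x :> G x" "\<And>x. (G has_derivative blinfun_apply (H x)) (at x)"
      "continuous_on UNIV H"
    using D(1) unfolding strongly_C_convex_domain_def C2_fun_def by blast
  note cp = cpair_del_rho[OF GH(1,2)] and nr = norm_del_rho[OF GH(1,2)]
  interpret C_convex_domain \<rho> G D H
  proof
    show "(\<rho> has_derivative (\<lambda>v. G x \<bullet> v)) (at x)" for x
      using GH(1)[of x] unfolding gderiv_def by (simp add: inner_commute)
    show "continuous_on UNIV G"
      by (intro continuous_at_imp_continuous_on ballI has_derivative_continuous[OF GH(2)])
    show "D = {x. \<rho> x < 0}" "connected D"
      using D(1) unfolding strongly_C_convex_domain_def by blast+
    show "G x \<noteq> 0" if "x \<in> frontier D" for x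
      using D(1) that GH(1)[of x] unfolding strongly_C_convex_domain_def by metis
    show "0 < blinfun_apply (H w) v \<bullet> v" if "w \<in> frontier D" "hform (G w) v = 0" "v \<noteq> 0" for w v
    proof -
      have "v \<in> complex_tangent_space \<rho> w" using that(2) by (simp add: complex_tangent_space_def cp)
      then have "0 < (blinfun_apply (H w) v \<bullet> v) / 2"
        unfolding levi_eq_hessian[OF GH(1,2), symmetric]
        using D(1) that(1,3) unfolding strongly_C_convex_domain_def by blast
      then show ?thesis by simp
    qed
  qed (use D(2) GH in auto)
  define d' where "d' = real CARD('d)"
  have d'0: "d' > 0" by (simp add: d'_def)
  \<comment> \<open>Below \<open>2\<close>, where \<open>ln n / n\<close> is not positive, the value \<open>1\<close> keeps the sequence positive.\<close>
  define \<epsilon> where "\<epsilon> n = (if n < 2 then 1 else (ln (real n) / real n) powr (1 / d'))" for n :: nat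
  have eq: "\<epsilon> n = (ln (real n) / real n) powr (1 / d')" if "n \<ge> 2" for n using that by (simp add: \<epsilon>_def)
  have pos: "ln (real n) / real n > 0" if "n \<ge> 2" for n using that by simp
  have \<epsilon>_pos: "\<epsilon> n > 0" for n using pos[of n] by (auto simp: \<epsilon>_def)
  have ge2: "\<forall>\<^sub>F n in sequentially. n \<ge> (2::nat)" by (rule eventually_ge_at_top)
  have \<epsilon>_lim: "\<epsilon> \<longlonglongrightarrow> 0"
  proof (rule Lim_transform_eventually)
    show "(\<lambda>n. (ln (real n) / real n) powr (1 / d')) \<longlonglongrightarrow> 0"
    proof (rule tendsto_zero_powrI[OF lim_ln_over_n tendsto_const])
      show "\<forall>\<^sub>F n in sequentially. 0 \<le> ln (real n) / real n" using ge2 by eventually_elim simp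
    qed (use d'0 in simp)
    show "\<forall>\<^sub>F n in sequentially. (ln (real n) / real n) powr (1 / d') = \<epsilon> n"
      using ge2 by eventually_elim (simp add: eq)
  qed
  have \<epsilon>_large: "filterlim (\<lambda>n. \<epsilon> n ^ CARD('d) * real (n div 2)) at_top sequentially"
  proof (rule filterlim_at_top_mono)
    have "filterlim (\<lambda>n. 1 / 4 * ln (real n)) at_top sequentially"
      by (intro filterlim_tendsto_pos_mult_at_top[OF tendsto_const] filterlim_compose[OF ln_at_top filterlim_real_sequentially]) simp
    then show "filterlim (\<lambda>n. 1 / 4 * ln (real n)) at_top sequentially" .
    show "\<forall>\<^sub>F n in sequentially. 1 / 4 * ln (real n) \<le> \<epsilon> n ^ CARD('d) * real (n div 2)"
      using ge2
    proof eventually_elim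
      case (elim n)
      have "(x powr (1 / d')) ^ CARD('d) = x" if "x > 0" for x :: real
      proof -
        have "(x powr (1 / d')) ^ CARD('d) = (x powr (1 / d')) powr d'"
          unfolding d'_def by (rule powr_realpow[symmetric]) (use that in simp)
        also have "\<dots> = x" using that d'0 by (simp add: powr_powr)
        finally show ?thesis .
      qed
      from this[OF pos[OF elim]] have e: "\<epsilon> n ^ CARD('d) = ln (real n) / real n" unfolding eq[OF elim] .
      have "n \<le> 4 * (n div 2)" using elim by presburger
      then have "real n / 4 \<le> real (n div 2)" by linarith
      then have "ln (real n) / real n * (real n / 4) \<le> ln (real n) / real n * real (n div 2)"
        using pos[OF elim] by (intro mult_left_mono) auto
      then show ?case unfolding e using elim by simp
    qed
  qed
  obtain cf where cf: "cf > 0" "\<And>z. z \<in> frontier D \<Longrightarrow> cf \<le> f z" using f_bounds by blast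
  interpret prob_space M by (rule M)
  have main: "tends_in_probability M
      (\<lambda>n \<omega>. (real n / ln (real n)) powr (1 / real CARD('d)) *
               approx_error D (induced_polyhedron \<rho> D (first_points W (K n \<omega>) \<omega>) (\<delta> n))) (\<integral>z. g z \<partial>\<sigma>)"
    if K: "\<And>n. K n \<in> measurable M (count_space UNIV)" "(\<lambda>n. prob {\<omega> \<in> space M. K n \<omega> < n div 2}) \<longlonglongrightarrow> 0"
      and inside: "(\<lambda>n. prob {\<omega> \<in> space M. induced_polyhedron \<rho> D (first_points W (K n \<omega>) \<omega>) (\<delta> n) \<subseteq> D}) \<longlonglongrightarrow> 1"
    for K
  proof -
    interpret random_cuts \<rho> G D H g \<epsilon> M W K f cf
      using holder_imp_continuous_on[OF g_holder \<alpha>(1)] g_pos \<epsilon>_pos \<epsilon>_lim \<epsilon>_large W_indep W_distr f_density cf K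
      unfolding \<sigma>_def by unfold_locales auto
    have \<delta>_eq: "\<forall>\<^sub>F n in sequentially. \<delta> n = (\<lambda>w. g w * \<epsilon> n)"
      using ge2 by eventually_elim (simp add: \<delta>_def eq d'_def)
    have "(\<lambda>n. prob {\<omega> \<in> space M. induced_polyhedron \<rho> D (first_points W (K n \<omega>) \<omega>) (\<lambda>w. g w * \<epsilon> n) \<subseteq> D}) \<longlonglongrightarrow> 1"
      by (rule Lim_transform_eventually[OF inside]) (use \<delta>_eq in \<open>eventually_elim, simp\<close>)
    from approximation_error_in_probability[OF cp nr this]
    show ?thesis unfolding \<sigma>_def
    proof (rule tends_in_probability_cong)
      show "\<forall>\<^sub>F n in sequentially.
        (\<lambda>\<omega>. approx_error D (induced_polyhedron \<rho> D (first_points W (K n \<omega>) \<omega>) (\<lambda>w. g w * \<epsilon> n)) / \<epsilon> n) =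
        (\<lambda>\<omega>. (real n / ln (real n)) powr (1 / real CARD('d)) *
               approx_error D (induced_polyhedron \<rho> D (first_points W (K n \<omega>) \<omega>) (\<delta> n)))"
        using \<delta>_eq ge2
      proof eventually_elim
        case (elim n)
        have "(real n / ln (real n)) powr (1 / d') = 1 / \<epsilon> n"
          unfolding eq[OF elim(2)] using elim(2) by (simp add: powr_divide)
        then show ?case unfolding elim(1) d'_def by simp
      qed
    qed
  qed
  show ?thesis
  proof (intro conjI impI)
    assume inside: "(\<lambda>n. prob {\<omega> \<in> space M. induced_polyhedron \<rho> D (first_points W (N n \<omega>) \<omega>) (\<delta> n) \<subseteq> D}) \<longlonglongrightarrow> 1"
    define K where "K n \<omega> = (if n = 0 then 0 else N n \<omega>)" for n \<omega>
    have KN: "\<forall>\<^sub>F n in sequentially. K n = N n" using ge2 by eventually_elim (simp add: K_def fun_eq_iff)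
    have "K n \<in> measurable M (count_space UNIV)" for n
      using N by (cases "n = 0") (auto simp: K_def[abs_def] poisson_counts_def)
    moreover have "(\<lambda>n. prob {\<omega> \<in> space M. K n \<omega> < n div 2}) \<longlonglongrightarrow> 0"
      unfolding K_def by (rule poisson_counts_large[OF M N])
    moreover have "(\<lambda>n. prob {\<omega> \<in> space M. induced_polyhedron \<rho> D (first_points W (K n \<omega>) \<omega>) (\<delta> n) \<subseteq> D}) \<longlonglongrightarrow> 1"
      by (rule Lim_transform_eventually[OF inside]) (use KN in \<open>eventually_elim, simp\<close>)
    ultimately have "tends_in_probability M
      (\<lambda>n \<omega>. (real n / ln (real n)) powr (1 / real CARD('d)) *
               approx_error D (induced_polyhedron \<rho> D (first_points W (K n \<omega>) \<omega>) (\<delta> n))) (\<integral>z. g z \<partial>\<sigma>)"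
      by (rule main)
    then show "tends_in_probability M
      (\<lambda>n \<omega>. (real n / ln (real n)) powr (1 / real CARD('d)) *
               approx_error D (induced_polyhedron \<rho> D (first_points W (N n \<omega>) \<omega>) (\<delta> n))) (\<integral>z. g z \<partial>\<sigma>)"
      by (rule tends_in_probability_cong) (use KN in \<open>eventually_elim, simp\<close>)
  next
    assume "(\<lambda>n. prob {\<omega> \<in> space M. induced_polyhedron \<rho> D (first_points W n \<omega>) (\<delta> n) \<subseteq> D}) \<longlonglongrightarrow> 1"
    note inside = this
    have "{\<omega> \<in> space M. n < n div 2} = {}" for n :: nat by auto
    then have "(\<lambda>n. prob {\<omega> \<in> space M. n < n div 2}) \<longlonglongrightarrow> 0"
      by (simp only: measure_empty tendsto_const)
    from main[of "\<lambda>n _. n", OF _ this inside] show "tends_in_probability M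
      (\<lambda>n \<omega>. (real n / ln (real n)) powr (1 / real CARD('d)) *
               approx_error D (induced_polyhedron \<rho> D (first_points W n \<omega>) (\<delta> n))) (\<integral>z. g z \<partial>\<sigma>)"
      by simp
  qed
qed

end
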